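(* Let $V:\mathbb{R}^d\to\mathbb{R}$ be a $\mathbb{Z}^d$-periodic function of class $C^3$ whose minima are non-degenerate. For $\hbar>0$ let $\mathcal{H}_\hbar=-\hbar^2\frac{\Delta}{2}+V$, and let $\psi_\hbar$ be the unique (up to a multiplicative constant) $\mathbb{Z}^d$-periodic positive eigenfunction of $\mathcal{H}_\hbar$, corresponding to the smallest eigenvalue of $\mathcal{H}_\hbar$. Then, as $\hbar\to0$, the probability measure $$\frac{\psi_\hbar^2(x)\,dx}{\int_{\mathbb{T}^d}\psi_\hbar^2(y)\,dy}$$ on $\mathbb{T}^d$ concentrates on the set of those minima of $V$ which have the smallest sum of nonnegative Lyapunov exponents, as equilibrium points of the flow on $\mathbb{T}^d\times\mathbb{R}^d$ associated to the differential equation $\ddot\gamma=+V'(\gamma)$.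
   Context: $\mathbb{T}^d=\mathbb{R}^d/\mathbb{Z}^d$; $V'$ denotes the gradient of $V$. "Minima of $V$" means the points where $V$ attains its global minimum; non-degenerate means that the Hessian of $V$ there is invertible. A minimum $x$ of $V$ is identified with the equilibrium point $(x,0)$ of the flow $(\gamma_0,\dot\gamma_0)\mapsto(\gamma_t,\dot\gamma_t)$ of $\ddot\gamma=V'(\gamma)$; its $2d$ Lyapunov exponents come in pairs $\pm\lambda_i^+$, $\lambda_i^+\ge0$, $1\le i\le d$, and the sum of nonnegative Lyapunov exponents is $\sum_{i=1}^d\lambda_i^+$. Concentrating on a finite set $S\subset\mathbb{T}^d$ means that the mass of the complement of any open neighbourhood of $S$ tends to $0$. *)

theory Defs
  imports "HOL-Probability.Probability_Measure"
begin

definition integer_periodic :: "(real ^ 'n \<Rightarrow> 'b) \<Rightarrow> bool" where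
  "integer_periodic f \<longleftrightarrow> (\<forall>x k. (\<forall>i. k $ i \<in> \<int>) \<longrightarrow> f (x + k) = f x)"

quotient_type (overloaded) 'n torus = "real ^ 'n::finite" / "\<lambda>x y. \<forall>i. x $ i - y $ i \<in> \<int>"
  morphisms rep_torus to_torus
proof (rule equivpI)
  show "reflp (\<lambda>x y::real ^ 'n. \<forall>i. x $ i - y $ i \<in> \<int>)"
    by (simp add: reflp_def)
  show "symp (\<lambda>x y::real ^ 'n. \<forall>i. x $ i - y $ i \<in> \<int>)"
  proof (rule sympI, rule allI)
    fix x y :: "real ^ 'n" and i
    assume "\<forall>i. x $ i - y $ i \<in> \<int>"
    then have "- (x $ i - y $ i) \<in> \<int>" by (meson Ints_minus)
    then show "y $ i - x $ i \<in> \<int>" by simp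
  qed
  show "transp (\<lambda>x y::real ^ 'n. \<forall>i. x $ i - y $ i \<in> \<int>)"
  proof (rule transpI, rule allI)
    fix x y z :: "real ^ 'n" and i
    assume "\<forall>i. x $ i - y $ i \<in> \<int>" "\<forall>i. y $ i - z $ i \<in> \<int>"
    then have "(x $ i - y $ i) + (y $ i - z $ i) \<in> \<int>"
      by (meson Ints_add)
    then show "x $ i - z $ i \<in> \<int>" by simp
  qed
qed

instantiation torus :: (finite) topological_space
begin

text \<open>The quotient topology.\<close>

definition open_torus :: "'a torus set \<Rightarrow> bool" where
  "open_torus U \<longleftrightarrow> open (to_torus -` U)"

instance
proof
  show "open (UNIV :: 'a torus set)" by (simp add: open_torus_def)
  show "open (S \<inter> T)" if "open S" "open T" for S T :: "'a torus set"
    using that by (simp add: open_torus_def vimage_Int open_Int)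
  show "open (\<Union>K)" if "\<forall>S\<in>K. open S" for K :: "'a torus set set"
    using that by (simp add: open_torus_def vimage_Union open_UN)
qed

end

definition torus_lebesgue :: "'n::finite torus measure" where
  "torus_lebesgue = distr (restrict_space lborel {x. \<forall>i. 0 \<le> x $ i \<and> x $ i < 1}) borel to_torus"

lemma integer_periodic_rep_torus:
  assumes "integer_periodic f"
  shows "f (rep_torus (to_torus x)) = f x"
proof -
  have "\<forall>i. rep_torus (to_torus x) $ i - x $ i \<in> \<int>"
    by (rule rep_abs_rsp_left[OF Quotient3_torus]) simp
  with assms have "f (x + (rep_torus (to_torus x) - x)) = f x"
    unfolding integer_periodic_def by (metis vector_minus_component)
  then show ?thesis by simp
qed

lemma measurable_to_torus [measurable]: "to_torus \<in> borel_measurable (borel :: (real ^ 'n::finite) measure)"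
  by (intro borel_measurable_continuous_onI)
     (simp add: continuous_on_open_vimage open_torus_def)

definition partial :: "'n \<Rightarrow> (real ^ 'n \<Rightarrow> real) \<Rightarrow> real ^ 'n::finite \<Rightarrow> real" where
  "partial i f x = frechet_derivative f (at x) (axis i 1)"

fun C_class :: "nat \<Rightarrow> (real ^ 'n::finite \<Rightarrow> real) \<Rightarrow> bool" where
  "C_class 0 f \<longleftrightarrow> continuous_on UNIV f"
| "C_class (Suc k) f \<longleftrightarrow> f differentiable_on UNIV \<and> (\<forall>i. C_class k (partial i f))"

definition gradient :: "(real ^ 'n::finite \<Rightarrow> real) \<Rightarrow> real ^ 'n \<Rightarrow> real ^ 'n" where
  "gradient f x = (\<chi> i. partial i f x)"

definition hessian :: "(real ^ 'n::finite \<Rightarrow> real) \<Rightarrow> real ^ 'n \<Rightarrow> real ^ 'n ^ 'n" where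
  "hessian f x = (\<chi> i j. partial i (partial j f) x)"

definition laplacian :: "(real ^ 'n::finite \<Rightarrow> real) \<Rightarrow> real ^ 'n \<Rightarrow> real" where
  "laplacian f x = (\<Sum>i\<in>UNIV. partial i (partial i f) x)"

definition is_minimum :: "(real ^ 'n::finite \<Rightarrow> real) \<Rightarrow> real ^ 'n \<Rightarrow> bool" where
  "is_minimum V x \<longleftrightarrow> (\<forall>y. V x \<le> V y)"

definition schroedinger ::
    "real \<Rightarrow> (real ^ 'n::finite \<Rightarrow> real) \<Rightarrow> (real ^ 'n \<Rightarrow> real) \<Rightarrow> real ^ 'n \<Rightarrow> real" where
  "schroedinger h V f x = - (h\<^sup>2) * (laplacian f x / 2) + V x * f x"

text \<open>Eigenfunctions on the torus are periodic classical solutions. For the potentials considered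
  here, elliptic regularity makes every eigenfunction in the \<open>L\<^sup>2\<close> sense of this kind, and as the
  operator is real it suffices to consider real-valued ones.\<close>

definition is_eigenfunction ::
    "real \<Rightarrow> (real ^ 'n::finite \<Rightarrow> real) \<Rightarrow> real \<Rightarrow> (real ^ 'n \<Rightarrow> real) \<Rightarrow> bool" where
  "is_eigenfunction h V E f \<longleftrightarrow>
     integer_periodic f \<and> C_class 2 f \<and> (\<exists>x. f x \<noteq> 0) \<and> (\<forall>x. schroedinger h V f x = E * f x)"

definition is_smallest_eigenvalue :: "real \<Rightarrow> (real ^ 'n::finite \<Rightarrow> real) \<Rightarrow> real \<Rightarrow> bool" where
  "is_smallest_eigenvalue h V E \<longleftrightarrow>
     (\<exists>f. is_eigenfunction h V E f) \<and> (\<forall>E' f. is_eigenfunction h V E' f \<longrightarrow> E \<le> E')"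

definition is_ground_state ::
    "real \<Rightarrow> (real ^ 'n::finite \<Rightarrow> real) \<Rightarrow> (real ^ 'n \<Rightarrow> real) \<Rightarrow> bool" where
  "is_ground_state h V \<psi> \<longleftrightarrow>
     (\<forall>x. \<psi> x > 0) \<and> (\<exists>E. is_smallest_eigenvalue h V E \<and> is_eigenfunction h V E \<psi>)"

text \<open>For periodic \<open>\<psi>\<close>, the function \<open>\<psi> \<circ> rep_torus\<close> is the induced function on the torus; it does
  not depend on the choice of representatives.\<close>

definition squared_measure :: "(real ^ 'n::finite \<Rightarrow> real) \<Rightarrow> 'n torus measure" where
  "squared_measure \<psi> = density torus_lebesgue
     (\<lambda>p. ennreal ((\<psi> (rep_torus p))\<^sup>2 / (\<integral>q. (\<psi> (rep_torus q))\<^sup>2 \<partial>torus_lebesgue)))"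

lemma prob_space_squared_measure:
  fixes \<psi> :: "real ^ 'n::finite \<Rightarrow> real"
  assumes per: "integer_periodic \<psi>" and cont: "continuous_on UNIV \<psi>" and pos: "\<And>x. \<psi> x > 0"
  shows "prob_space (squared_measure \<psi>)"
proof -
  let ?Q = "{x :: real ^ 'n. \<forall>i. 0 \<le> x $ i \<and> x $ i < 1}"
  let ?T = "torus_lebesgue :: 'n torus measure"
  let ?g = "\<lambda>p. (\<psi> (rep_torus p))\<^sup>2"
  have Q: "?Q \<in> sets lborel" by measurable
  have sub1: "?Q \<subseteq> cbox 0 1" by (auto simp: mem_box_cart less_imp_le)
  have sub2: "box 0 1 \<subseteq> ?Q" by (auto simp: mem_box_cart less_imp_le)
  have Qfin: "emeasure lborel ?Q < \<infinity>"
    using emeasure_mono[OF sub1, of lborel] emeasure_lborel_cbox_finite[of "0 :: real ^ 'n" 1]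
    by (simp add: order_le_less_trans)
  have "0 < measure lborel (box 0 1 :: (real ^ 'n) set)"
    by (subst measure_lborel_box) (auto simp: Basis_vec_def inner_axis intro!: prod_pos)
  then have Qpos: "emeasure lborel ?Q \<noteq> 0"
    using emeasure_mono[OF sub2 Q] by (auto simp: measure_def)
  have cg: "continuous_on UNIV ?g"
    unfolding continuous_on_open_vimage[OF open_UNIV]
  proof (intro allI impI)
    fix B :: "real set" assume "open B"
    have "to_torus -` (?g -` B) = (\<lambda>x. (\<psi> x)\<^sup>2) -` B"
      using integer_periodic_rep_torus[OF per] by auto
    moreover have "open ((\<lambda>x. (\<psi> x)\<^sup>2) -` B)"
      using cont \<open>open B\<close> by (intro open_vimage) (auto intro!: continuous_intros)
    ultimately show "open (?g -` B \<inter> UNIV)" by (simp add: open_torus_def)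
  qed
  then have mg [measurable]: "?g \<in> borel_measurable borel" by (rule borel_measurable_continuous_onI)
  have mt: "to_torus \<in> restrict_space lborel ?Q \<rightarrow>\<^sub>M borel"
    by (rule measurable_restrict_space1) measurable
  have emt: "emeasure ?T UNIV = emeasure lborel ?Q"
    unfolding torus_lebesgue_def
    by (subst emeasure_distr[OF mt])
       (use Q in \<open>auto simp: space_restrict_space emeasure_restrict_space\<close>)
  have st [simp]: "sets ?T = sets borel" by (simp add: torus_lebesgue_def)
  have spt [simp]: "space ?T = UNIV" by (simp add: torus_lebesgue_def)
  have fin: "finite_measure ?T"
    using Qfin by (intro finite_measureI) (simp add: emt)
  have mg' [measurable]: "?g \<in> borel_measurable ?T"
    using mg by (simp cong: measurable_cong_sets)
  have "bounded (\<psi> ` cbox 0 1)"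
    by (intro compact_imp_bounded compact_continuous_image continuous_on_subset[OF cont]) auto
  then obtain B where B: "\<And>x. x \<in> cbox 0 1 \<Longrightarrow> \<bar>\<psi> x\<bar> \<le> B" by (auto simp: bounded_iff)
  have "AE p in ?T. norm (?g p) \<le> B\<^sup>2"
    unfolding torus_lebesgue_def
  proof (subst AE_distr_iff[OF mt])
    show "{p \<in> space borel. norm (?g p) \<le> B\<^sup>2} \<in> sets borel" by measurable
    show "AE x in restrict_space lborel ?Q. norm (?g (to_torus x)) \<le> B\<^sup>2"
    proof (rule AE_I2)
      fix x assume "x \<in> space (restrict_space lborel ?Q)"
      then have "x \<in> cbox 0 1" using sub1 by (auto simp: space_restrict_space)
      then show "norm (?g (to_torus x)) \<le> B\<^sup>2"
        using power_mono[OF B, of x 2] by (simp add: integer_periodic_rep_torus[OF per])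
    qed
  qed
  then have int: "integrable ?T ?g"
    by (rule finite_measure.integrable_const_bound[OF fin]) simp
  have tpos: "emeasure ?T UNIV \<noteq> 0"
    using Qpos by (simp add: emt)
  let ?I = "\<integral>q. ?g q \<partial>?T"
  have "?I \<noteq> 0"
  proof
    assume "?I = 0"
    then have "AE p in ?T. ?g p = 0"
      by (subst (asm) integral_nonneg_eq_0_iff_AE[OF int]) auto
    then have "AE p in ?T. False"
      using pos by (auto simp: less_imp_neq[symmetric])
    then show False using tpos by (simp add: AE_iff_null null_sets_def)
  qed
  then have I: "?I > 0" by (simp add: order_less_le)
  have "(\<integral>\<^sup>+p. ennreal (?g p / ?I) \<partial>?T) = ennreal (\<integral>p. ?g p / ?I \<partial>?T)"
    by (rule nn_integral_eq_integral) (use int I in \<open>auto intro!: integrable_divide\<close>)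
  also have "\<dots> = 1" using I by simp
  finally show ?thesis
    unfolding squared_measure_def
    by (intro prob_spaceI) (simp add: emeasure_density)
qed

definition concentrates_on :: "('i \<Rightarrow> 'a::topological_space measure) \<Rightarrow> 'a set \<Rightarrow> 'i filter \<Rightarrow> bool" where
  "concentrates_on \<mu> S F \<longleftrightarrow>
     (\<forall>U. open U \<and> S \<subseteq> U \<longrightarrow> ((\<lambda>h. measure (\<mu> h) (- U)) \<longlongrightarrow> 0) F)"

text \<open>The flow on \<open>T\<^sup>d \<times> R\<^sup>d\<close> is represented by its lift to \<open>R\<^sup>d \<times> R\<^sup>d\<close>, which has the same
  differentials. For periodic \<open>V\<close> of class \<open>C\<^sup>2\<close> the gradient is globally Lipschitz, so there is
  exactly one solution curve for each initial condition and it is defined for all times.\<close>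

definition flow ::
    "(real ^ 'n::finite \<Rightarrow> real) \<Rightarrow> real \<Rightarrow> (real ^ 'n) \<times> (real ^ 'n) \<Rightarrow> (real ^ 'n) \<times> (real ^ 'n)" where
  "flow V t z =
     (THE c. c 0 = z \<and>
        (\<forall>s. (c has_vector_derivative (snd (c s), gradient V (fst (c s)))) (at s))) t"

definition lyapunov_exponent ::
    "(real \<Rightarrow> 'a \<Rightarrow> 'a) \<Rightarrow> 'a \<Rightarrow> 'a::euclidean_space \<Rightarrow> ereal" where
  "lyapunov_exponent \<phi> p w =
     Limsup at_top (\<lambda>t. ereal (ln (norm (frechet_derivative (\<phi> t) (at p) w)) / t))"

definition lyapunov_spectrum :: "(real \<Rightarrow> 'a \<Rightarrow> 'a) \<Rightarrow> 'a::euclidean_space \<Rightarrow> real set" where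
  "lyapunov_spectrum \<phi> p = {l. \<exists>w. w \<noteq> 0 \<and> lyapunov_exponent \<phi> p w = ereal l}"

text \<open>The multiplicity of an exponent is the jump of dimension in the filtration of the tangent
  space by sublevel sets of \<^const>\<open>lyapunov_exponent\<close>; the zero vector belongs to every
  member of the filtration.\<close>

definition lyapunov_multiplicity :: "(real \<Rightarrow> 'a \<Rightarrow> 'a) \<Rightarrow> 'a::euclidean_space \<Rightarrow> real \<Rightarrow> nat" where
  "lyapunov_multiplicity \<phi> p l =
     dim {w. w = 0 \<or> lyapunov_exponent \<phi> p w \<le> ereal l} -
     dim {w. w = 0 \<or> lyapunov_exponent \<phi> p w < ereal l}"

definition sum_nonneg_lyapunov :: "(real \<Rightarrow> 'a \<Rightarrow> 'a) \<Rightarrow> 'a::euclidean_space \<Rightarrow> real" where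
  "sum_nonneg_lyapunov \<phi> p =
     (\<Sum>l | l \<in> lyapunov_spectrum \<phi> p \<and> 0 \<le> l. real (lyapunov_multiplicity \<phi> p l) * l)"

definition selected_minima :: "(real ^ 'n::finite \<Rightarrow> real) \<Rightarrow> 'n torus set" where
  "selected_minima V = to_torus ` {x. is_minimum V x \<and>
     (\<forall>y. is_minimum V y \<longrightarrow>
        sum_nonneg_lyapunov (flow V) (x, 0) \<le> sum_nonneg_lyapunov (flow V) (y, 0))}"

end

theory Submission
  imports Defs
begin

text \<open>
  Write \<open>m\<close> for a minimum, \<open>A = (Hess V m)\<^sup>1\<^sup>/\<^sup>2\<close> and \<open>\<tau> = tr A\<close>. The linearization of the flow at
  \<open>(m, 0)\<close> has the eigenvalues \<open>\<plusminus>\<lambda>\<close>, with \<open>\<lambda>\<close> those of \<open>A\<close>, so \<open>\<tau>\<close> is the sum of the nonnegative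
  Lyapunov exponents. With the trial state \<open>exp (- f / h)\<close>, where \<open>f\<close> is periodic and behaves like
  \<open>(x - m) \<bullet> A (x - m) / 2\<close> at \<open>m\<close>, the lowest eigenvalue satisfies \<open>E \<le> min V + h/2 (\<tau> + o(1))\<close> for
  every \<open>m\<close>. Conversely, for each periodic vector field \<open>G\<close>, integrating
  \<open>div (h\<^sup>2/2 \<psi> \<nabla>\<psi> + h/2 \<psi>\<^sup>2 G)\<close> gives \<open>\<integral> (V - \<bar>G\<bar>\<^sup>2/2 + h/2 div G - E) \<psi>\<^sup>2 \<le> 0\<close>. If \<open>G\<close> is a multiple
  \<open>a < 1\<close> of \<open>A (x - m)\<close> near each minimum, then \<open>V - \<bar>G\<bar>\<^sup>2/2\<close> exceeds \<open>min V\<close> away from the minima, and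
  \<open>div G = a \<tau>\<close> at each of them; comparing with the upper bound for \<open>E\<close> at the smallest \<open>\<tau>\<close>, only a small
  fraction of the mass of \<open>\<psi>\<^sup>2\<close> can lie away from the minima with smallest \<open>\<tau>\<close>.
\<close>

subsection \<open>Spectral theorem\<close>

text \<open>The minima compete only through the coefficient of \<open>h\<close> in the energy, so
  the two bounds for \<open>E\<close> have to agree up to o(h), and the Taylor remainder of
  \<open>V\<close> must be absorbed at no cost of order \<open>h\<close>. In the lower bound this is
  what a < 1 is for: with a = 1 the quadratic parts of V and |G|^2/2 cancel at a minimum and the
  remainder decides the sign; a < 1 leaves a definite quadratic form and lowers \<tau> only to a
  \<tau>. In the upper bound a multiplier 1 + e of the term with the Laplacian of f leaves a spare e
  |f'|^2. The upper bound avoids the variational principle: dividing by the positive \<psi> turns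
  the eigenvalue equation into a pointwise inequality modulo a divergence. The lower bound holds for
  every periodic field, so G need not be a gradient and can be glued from local pieces with cutoffs;
  no global solution of a Hamilton-Jacobi equation is required. The flow enters only through \<tau>
  = tr A. Since it is given by a definite description, existence and uniqueness of solutions and
  differentiability at the equilibrium come before any exponent can be computed.\<close>

lemma selfadjoint_eigenvector_exists:
  fixes f :: "'a::euclidean_space \<Rightarrow> 'a"
  assumes lin: "linear f" and sa: "\<And>x y. f x \<bullet> y = x \<bullet> f y"
    and S: "subspace S" "f ` S \<subseteq> S" "S \<noteq> {0}"
  obtains v c where "v \<in> S" "norm v = 1" "f v = c *\<^sub>R v"
proof -
  interpret linear f by (rule lin)
  let ?K = "sphere 0 1 \<inter> S"
  obtain w where w: "w \<in> S" "w \<noteq> 0" using S subspace_0 by blast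
  have "(1 / norm w) *\<^sub>R w \<in> ?K" using w S(1) by (simp add: subspace_scale)
  then have ne: "?K \<noteq> {}" by blast
  have "compact ?K" using closed_subspace[OF S(1)] by (intro compact_Int_closed) auto
  moreover have "continuous_on ?K (\<lambda>x. x \<bullet> f x)"
    using lin by (intro continuous_intros linear_continuous_on) (simp add: linear_conv_bounded_linear)
  ultimately obtain v where v: "v \<in> ?K" and max: "\<And>y. y \<in> ?K \<Longrightarrow> y \<bullet> f y \<le> v \<bullet> f v"
    \<comment> \<open>A maximizer of the quadratic form on the unit sphere of \<open>S\<close> is
      the eigenvector, and the maximum \<open>c\<close> is its eigenvalue.\<close>
    using continuous_attains_sup[OF _ ne] by blast
  define c where "c = v \<bullet> f v"
  have vv: "v \<bullet> v = 1" using v by (simp add: dot_square_norm)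
  have bd: "y \<bullet> f y \<le> c * (y \<bullet> y)" if "y \<in> S" for y
  proof (cases "y = 0")
    case False
    let ?y = "(1 / norm y) *\<^sub>R y"
    have "?y \<in> ?K" using False that S(1) by (simp add: subspace_scale)
    from max[OF this] have "(y \<bullet> f y) / (norm y)\<^sup>2 \<le> c"
      by (simp add: scale c_def power2_eq_square)
    then show ?thesis using False by (simp add: divide_simps dot_square_norm)
  qed (simp add: zero)
  \<comment> \<open>The residual of the eigenvalue equation, used as the direction of variation; it
    stays in \<open>S\<close> by invariance.\<close>
  define u where "u = f v - c *\<^sub>R v"
  have uS: "u \<in> S" using v S unfolding u_def by (auto intro!: subspace_diff subspace_scale)
  define a b where "a = u \<bullet> u" and "b = c * (u \<bullet> u) - u \<bullet> f u"
  \<comment> \<open>Maximality at \<open>v\<close> along \<open>v + t u\<close>. The left side is of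
    first order in \<open>t\<close> and the right side of second order, so \<open>a\<close> must
    vanish; \<open>t = a / b\<close> below makes this quantitative.\<close>
  have q: "2 * t * a \<le> t\<^sup>2 * b" for t
  proof -
    have "v + t *\<^sub>R u \<in> S" using uS v S(1) by (auto intro!: subspace_add subspace_scale)
    from bd[OF this] have "c + 2 * t * (u \<bullet> f v) + t\<^sup>2 * (u \<bullet> f u)
        \<le> c * (1 + 2 * t * (u \<bullet> v) + t\<^sup>2 * (u \<bullet> u))"
      using sa[of v u] vv
      by (simp add: add scale inner_add_left inner_add_right c_def power2_eq_square algebra_simps
          inner_commute[of "f v"] inner_commute[of v u])
    then show ?thesis
      by (simp add: a_def b_def u_def inner_diff_right algebra_simps)
  qed
  have "a = 0"
  proof (rule ccontr)
    assume "a \<noteq> 0"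
    then have a: "a > 0" by (simp add: a_def)
    have b: "b > 0" using q[of 1] a by simp
    have "2 * (a / b) * a \<le> (a / b)\<^sup>2 * b" by (rule q)
    then show False using a b by (simp add: power2_eq_square field_simps)
  qed
  then have "f v = c *\<^sub>R v" by (simp add: a_def u_def)
  then show ?thesis using v that by auto
qed

text \<open>Stated for invariant subspaces so that the induction can split off one eigenvector and
  continue in its orthogonal complement, which self-adjointness keeps invariant.\<close>

lemma selfadjoint_orthonormal_eigenbasis:
  fixes f :: "'a::euclidean_space \<Rightarrow> 'a"
  assumes lin: "linear f" and sa: "\<And>x y. f x \<bullet> y = x \<bullet> f y"
    and "subspace S" "f ` S \<subseteq> S"
  shows "\<exists>B. B \<subseteq> S \<and> finite B \<and> pairwise orthogonal B \<and> (\<forall>b\<in>B. norm b = 1) \<and> span B = S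
    \<and> (\<forall>b\<in>B. \<exists>c. f b = c *\<^sub>R b)"
  using assms(3,4)
proof (induction "dim S" arbitrary: S rule: less_induct)
  case less
  show ?case
  proof (cases "S = {0}")
    case True
    then show ?thesis by (intro exI[of _ "{}"]) auto
  next
    case False
    obtain v c where v: "v \<in> S" "norm v = 1" "f v = c *\<^sub>R v"
      using selfadjoint_eigenvector_exists[OF lin sa less.prems False] by blast
    define S' where "S' = S \<inter> {x. v \<bullet> x = 0}"
    have sub: "subspace S'" unfolding S'_def
      by (intro subspace_inter less.prems subspace_hyperplane)
    have vv: "v \<bullet> v = 1" using v by (simp add: dot_square_norm)
    have "v \<notin> S'" using vv by (simp add: S'_def)
    then have "S' \<noteq> S" using v(1) by metis
    then have "S' \<subset> S" by (auto simp: S'_def)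
    then have "dim S' < dim S"
      by (metis dim_psubset span_eq_iff sub less.prems(1))
    moreover have "f ` S' \<subseteq> S'"
      using less.prems(2) sa[of v] v(3) by (auto simp: S'_def) (metis inner_scaleR_left mult_zero_right)
    ultimately obtain B where B: "B \<subseteq> S'" "finite B" "pairwise orthogonal B" "\<forall>b\<in>B. norm b = 1"
      "span B = S'" "\<forall>b\<in>B. \<exists>c. f b = c *\<^sub>R b"
      using less.hyps[OF _ sub] by blast
    have sp: "span (insert v B) = S"
    proof
      show "span (insert v B) \<subseteq> S"
        using v B(1) by (intro span_minimal less.prems(1)) (auto simp: S'_def)
      show "S \<subseteq> span (insert v B)"
      proof
        fix x assume "x \<in> S"
        then have "x - (v \<bullet> x) *\<^sub>R v \<in> S'"
          using v less.prems(1) vv by (auto simp: S'_def inner_diff_right intro!: subspace_diff subspace_scale)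
        then show "x \<in> span (insert v B)"
          using B(5) by (subst span_insert) auto
      qed
    qed
    have "pairwise orthogonal (insert v B)"
      using B(1,3) by (auto simp: pairwise_insert orthogonal_def S'_def inner_commute)
    then show ?thesis
      using B v sp by (intro exI[of _ "insert v B"]) (auto simp: S'_def)
  qed
qed

subsection \<open>Partial derivatives\<close>

lemma has_derivative_partial_line:
  assumes "f differentiable_on UNIV"
  shows "((\<lambda>t. f (x + t *\<^sub>R axis i 1)) has_real_derivative partial i f (x + t *\<^sub>R axis i 1)) (at t)"
proof -
  let ?y = "x + t *\<^sub>R axis i (1::real)"
  have d: "(f has_derivative frechet_derivative f (at ?y)) (at ?y)"
    using assms frechet_derivative_works by (auto simp: differentiable_on_def)
  have "((\<lambda>t. x + t *\<^sub>R axis i 1) has_derivative (\<lambda>s. s *\<^sub>R axis i 1)) (at t)"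
    by (auto intro!: derivative_eq_intros)
  from has_derivative_compose[OF this d]
  show ?thesis
    using linear_frechet_derivative[of f "at ?y"] assms
    by (simp add: has_field_derivative_def partial_def linear_scale differentiable_on_def mult.commute[of _ "frechet_derivative _ _ _"])
qed

lemma C_class_imp_continuous: "C_class k f \<Longrightarrow> continuous_on UNIV f"
  by (cases k) (auto dest: differentiable_imp_continuous_on)

lemma C_class_SucD: "C_class (Suc k) f \<Longrightarrow> C_class k f"
  by (induction k arbitrary: f) (auto dest: differentiable_imp_continuous_on)

lemma has_derivative_gradient:
  fixes f :: "real ^ 'n::finite \<Rightarrow> real"
  assumes "f differentiable (at x)"
  shows "(f has_derivative (\<lambda>y. gradient f x \<bullet> y)) (at x)"
proof -
  have d: "(f has_derivative frechet_derivative f (at x)) (at x)"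
    using assms frechet_derivative_works by blast
  interpret linear "frechet_derivative f (at x)" using assms by (rule linear_frechet_derivative)
  have "frechet_derivative f (at x) y = gradient f x \<bullet> y" for y
  proof -
    have "frechet_derivative f (at x) y = frechet_derivative f (at x) (\<Sum>i\<in>UNIV. y $ i *\<^sub>R axis i 1)"
      by (simp add: basis_expansion scalar_mult_eq_scaleR[symmetric])
    then show ?thesis
      by (simp add: sum scale inner_vec_def gradient_def partial_def mult.commute)
  qed
  then show ?thesis using d by presburger
qed

text \<open>The mean value theorem is applied twice, in direction \<open>i\<close> to the difference
  of \<open>f\<close> along two parallel lines and then in direction \<open>j\<close> to
  \<open>partial i f\<close>. The left side is symmetric in \<open>i\<close> and \<open>j\<close>,
  the right side is not visibly so; this is the source of \<open>partial_commute\<close>.\<close>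

lemma second_difference_mean_value:
  fixes f :: "real ^ 'n::finite \<Rightarrow> real"
  assumes "C_class 2 f" and s: "s > 0"
  obtains a b where "0 < a" "a < s" "0 < b" "b < s"
    "f (x + s *\<^sub>R axis i 1 + s *\<^sub>R axis j 1) - f (x + s *\<^sub>R axis i 1) - f (x + s *\<^sub>R axis j 1) + f x
      = s\<^sup>2 * partial j (partial i f) (x + a *\<^sub>R axis i 1 + b *\<^sub>R axis j 1)"
proof -
  have d1: "f differentiable_on UNIV" and d2: "partial i f differentiable_on UNIV"
    using assms by (auto simp: numeral_2_eq_2)
  let ?u = "\<lambda>t. f ((x + s *\<^sub>R axis j 1) + t *\<^sub>R axis i 1) - f (x + t *\<^sub>R axis i 1)"
  have "\<exists>a. 0 < a \<and> a < s \<and> ?u s - ?u 0 = (s - 0) * (partial i f ((x + s *\<^sub>R axis j 1) + a *\<^sub>R axis i 1) - partial i f (x + a *\<^sub>R axis i 1))"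
    using s by (intro MVT2 DERIV_diff has_derivative_partial_line d1) auto
  then obtain a where a: "0 < a" "a < s" "?u s - ?u 0 = s * (partial i f ((x + s *\<^sub>R axis j 1) + a *\<^sub>R axis i 1) - partial i f (x + a *\<^sub>R axis i 1))"
    by auto
  let ?v = "\<lambda>t. partial i f ((x + a *\<^sub>R axis i 1) + t *\<^sub>R axis j 1)"
  have "\<exists>b. 0 < b \<and> b < s \<and> ?v s - ?v 0 = (s - 0) * partial j (partial i f) ((x + a *\<^sub>R axis i 1) + b *\<^sub>R axis j 1)"
    using s by (intro MVT2 has_derivative_partial_line d2) auto
  then obtain b where b: "0 < b" "b < s" "?v s - ?v 0 = s * partial j (partial i f) ((x + a *\<^sub>R axis i 1) + b *\<^sub>R axis j 1)"
    by auto
  show ?thesis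
    using a b by (intro that[of a b]) (simp_all add: power2_eq_square algebra_simps)
qed

lemma partial_commute:
  fixes f :: "real ^ 'n::finite \<Rightarrow> real"
  assumes "C_class 2 f"
  shows "partial i (partial j f) x = partial j (partial i f) x"
proof (rule ccontr)
  let ?p = "partial i (partial j f)" and ?q = "partial j (partial i f)"
  assume "?p x \<noteq> ?q x"
  then have e: "dist (?p x) (?q x) / 2 > 0" (is "?e > 0") by simp
  have "continuous_on UNIV ?p" "continuous_on UNIV ?q"
    using assms by (auto simp: numeral_2_eq_2)
  then have "isCont ?p x" "isCont ?q x" by (auto simp: continuous_on_eq_continuous_at)
  then obtain d1 d2 where d: "d1 > 0" "\<And>y. dist y x < d1 \<Longrightarrow> dist (?p y) (?p x) < ?e"
    "d2 > 0" "\<And>y. dist y x < d2 \<Longrightarrow> dist (?q y) (?q x) < ?e"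
    using e unfolding continuous_at_eps_delta by metis
  \<comment> \<open>The intermediate points lie within \<open>2 * s\<close> of \<open>x\<close>; a
    third of the smaller radius makes this strictly smaller than both.\<close>
  define s where "s = min d1 d2 / 3"
  have s: "s > 0" "2 * s < d1" "2 * s < d2" using d(1,3) by (auto simp: s_def min_def)
  have near: "dist (x + a *\<^sub>R axis k (1::real) + b *\<^sub>R axis l 1) x < min d1 d2"
    if "0 < a" "a < s" "0 < b" "b < s" for a b k l
  proof -
    have "norm (a *\<^sub>R axis k (1::real) + b *\<^sub>R axis l 1) \<le> a + b"
      using that by (intro norm_triangle_le) auto
    then show ?thesis using that s by (simp add: dist_norm add.assoc)
  qed
  obtain a b where ab: "0 < a" "a < s" "0 < b" "b < s"
    "f (x + s *\<^sub>R axis i 1 + s *\<^sub>R axis j 1) - f (x + s *\<^sub>R axis i 1) - f (x + s *\<^sub>R axis j 1) + f x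
      = s\<^sup>2 * ?q (x + a *\<^sub>R axis i 1 + b *\<^sub>R axis j 1)"
    by (rule second_difference_mean_value[OF assms s(1), of x i j])
  obtain a' b' where ab': "0 < a'" "a' < s" "0 < b'" "b' < s"
    "f (x + s *\<^sub>R axis j 1 + s *\<^sub>R axis i 1) - f (x + s *\<^sub>R axis j 1) - f (x + s *\<^sub>R axis i 1) + f x
      = s\<^sup>2 * ?p (x + a' *\<^sub>R axis j 1 + b' *\<^sub>R axis i 1)"
    by (rule second_difference_mean_value[OF assms s(1), of x j i])
  have "s\<^sup>2 * ?q (x + a *\<^sub>R axis i 1 + b *\<^sub>R axis j 1) = s\<^sup>2 * ?p (x + a' *\<^sub>R axis j 1 + b' *\<^sub>R axis i 1)"
    unfolding ab(5)[symmetric] ab'(5)[symmetric] by (simp add: algebra_simps)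
  then have eq: "?q (x + a *\<^sub>R axis i 1 + b *\<^sub>R axis j 1) = ?p (x + a' *\<^sub>R axis j 1 + b' *\<^sub>R axis i 1)"
    using s(1) by simp
  have "dist (?q (x + a *\<^sub>R axis i 1 + b *\<^sub>R axis j 1)) (?q x) < ?e"
    using near[OF ab(1-4), of i j] by (intro d) simp
  moreover have "dist (?p (x + a' *\<^sub>R axis j 1 + b' *\<^sub>R axis i 1)) (?p x) < ?e"
    using near[OF ab'(1-4), of j i] by (intro d) simp
  ultimately show False
    using eq dist_triangle_half_r[of _ "?p x" "dist (?p x) (?q x)" "?q x"] by simp
qed

text \<open>Differentiating component \<open>i\<close> of the gradient produces row \<open>i\<close>
  of the transposed matrix, so \<open>partial_commute\<close> is needed to recover
  \<open>hessian\<close> itself.\<close>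

lemma gradient_has_derivative_hessian:
  fixes f :: "real ^ 'n::finite \<Rightarrow> real"
  assumes "C_class 2 f"
  shows "(gradient f has_derivative (\<lambda>y. hessian f x *v y)) (at x)"
proof -
  have "(partial i f has_derivative (\<lambda>y. (hessian f x *v y) $ i)) (at x)" for i
  proof -
    have "partial i f differentiable (at x)"
      using assms by (simp add: numeral_2_eq_2 differentiable_on_def)
    from has_derivative_gradient[OF this] show ?thesis
      by (rule has_derivative_eq_rhs)
         (simp add: fun_eq_iff inner_vec_def matrix_vector_mult_def gradient_def hessian_def partial_commute[OF assms, of i])
  qed
  then show ?thesis
    unfolding gradient_def
    by (subst has_derivative_componentwise_within) (simp add: Basis_vec_def inner_axis)
qed

lemma hessian_symmetric:
  assumes "C_class 2 f"
  shows "(hessian f x *v a) \<bullet> b = a \<bullet> (hessian f x *v b)"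
proof -
  have "transpose (hessian f x) = hessian f x"
    by (simp add: transpose_def hessian_def vec_eq_iff partial_commute[OF assms])
  then show ?thesis by (metis dot_lmul_matrix transpose_matrix_vector)
qed

section \<open>Second-order behaviour at a minimum\<close>

lemma gradient_minimum:
  assumes "f differentiable_on UNIV" and "is_minimum f m"
  shows "gradient f m = 0"
proof -
  have "f differentiable (at m)" using assms(1) by (simp add: differentiable_on_def)
  from differential_zero_maxmin[OF UNIV_I open_UNIV has_derivative_gradient[OF this]]
  have "(\<lambda>y. gradient f m \<bullet> y) = (\<lambda>y. 0)"
    using assms(2) by (auto simp: is_minimum_def)
  then have "gradient f m \<bullet> gradient f m = 0" by meson
  then show ?thesis by simp
qed

text \<open>The remainder has gradient \<open>gradient f (m + z) - hessian f m *v z\<close>, which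
  is o(|z|) because the gradient is differentiable at \<open>m\<close> and vanishes there. The mean
  value inequality on the ball of radius \<open>norm y\<close> gains the second factor
  \<open>norm y\<close>.\<close>

lemma taylor_second_order_minimum:
  fixes f :: "real ^ 'n::finite \<Rightarrow> real"
  assumes C: "C_class 2 f" and m: "is_minimum f m" and e: "e > 0"
  obtains d where "d > 0"
    "\<And>y. norm y < d \<Longrightarrow> \<bar>f (m + y) - f m - (y \<bullet> (hessian f m *v y)) / 2\<bar> \<le> e * (norm y)\<^sup>2"
proof -
  have diff: "f differentiable_on UNIV" using C by (simp add: numeral_2_eq_2)
  have g0: "gradient f m = 0" by (rule gradient_minimum[OF diff m])
  let ?H = "\<lambda>y. hessian f m *v y"
  obtain d where d: "d > 0" "\<And>y. norm (y - m) < d \<Longrightarrow> norm (gradient f y - ?H (y - m)) \<le> e * norm (y - m)"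
    using gradient_has_derivative_hessian[OF C, of m] e unfolding has_derivative_at_alt g0 by fastforce
  show ?thesis
  proof (rule that[OF d(1)])
    fix y :: "real ^ 'n" assume y: "norm y < d"
    let ?R = "\<lambda>z. f (m + z) - f m - (z \<bullet> ?H z) / 2"
    have "norm (?R y - ?R 0) \<le> (e * norm y) * norm (y - 0)"
    proof (rule differentiable_bound)
      show "convex (cball (0 :: real ^ 'n) (norm y))" "y \<in> cball 0 (norm y)" "(0 :: real ^ 'n) \<in> cball 0 (norm y)"
        by (auto intro: convex_cball)
      fix z :: "real ^ 'n" assume z: "z \<in> cball 0 (norm y)"
      have "f differentiable (at (m + z))" using diff by (simp add: differentiable_on_def)
      from has_derivative_gradient[OF this]
      have 1: "((\<lambda>z. f (m + z)) has_derivative (\<lambda>u. gradient f (m + z) \<bullet> u)) (at z)"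
        by (rule has_derivative_compose[OF has_derivative_add[OF has_derivative_const has_derivative_ident], simplified])
      have bl: "bounded_linear ?H" by (simp add: linear_conv_bounded_linear[symmetric])
      have 2: "((\<lambda>z. z \<bullet> ?H z) has_derivative (\<lambda>u. z \<bullet> ?H u + u \<bullet> ?H z)) (at z)"
        by (intro has_derivative_inner has_derivative_ident bounded_linear.has_derivative[OF bl])
      have sym: "(z \<bullet> ?H u + u \<bullet> ?H z) / 2 = ?H z \<bullet> u" for u
        using hessian_symmetric[OF C, of m z u] by (simp add: inner_commute[of u])
      have "(?R has_derivative (\<lambda>u. gradient f (m + z) \<bullet> u - 0 - (z \<bullet> ?H u + u \<bullet> ?H z) / 2)) (at z)"
        by (intro has_derivative_diff 1 has_derivative_const bounded_linear.has_derivative[OF bounded_linear_divide 2])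
      then have "(?R has_derivative (\<lambda>u. (gradient f (m + z) - ?H z) \<bullet> u)) (at z)"
        by (simp only: sym diff_0_right inner_diff_left)
      then show "(?R has_derivative (\<lambda>u. (gradient f (m + z) - ?H z) \<bullet> u)) (at z within cball 0 (norm y))"
        by (rule has_derivative_at_withinI)
      have nz: "norm z \<le> norm y" using z by simp
      have "norm (gradient f (m + z) - ?H z) \<le> e * norm z"
        using d(2)[of "m + z"] nz y by simp
      also have "\<dots> \<le> e * norm y" using nz e by simp
      finally have n: "norm (gradient f (m + z) - ?H z) \<le> e * norm y" .
      show "onorm (\<lambda>u. (gradient f (m + z) - ?H z) \<bullet> u) \<le> e * norm y"
      proof (rule onorm_bound)
        show "norm ((gradient f (m + z) - ?H z) \<bullet> u) \<le> e * norm y * norm u" for u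
          using Cauchy_Schwarz_ineq2[of "gradient f (m + z) - ?H z" u] mult_right_mono[OF n, of "norm u"] by simp
      qed (use e in simp)
    qed
    then show "\<bar>f (m + y) - f m - (y \<bullet> ?H y) / 2\<bar> \<le> e * (norm y)\<^sup>2"
      by (simp add: power2_eq_square mult.assoc)
  qed
qed

text \<open>Along a short multiple of \<open>y\<close> the increment of \<open>f\<close> is
  nonnegative and equals the quadratic form up to an arbitrarily small multiple of |y|^2.\<close>

lemma hessian_minimum_nonneg:
  fixes f :: "real ^ 'n::finite \<Rightarrow> real"
  assumes C: "C_class 2 f" and m: "is_minimum f m"
  shows "0 \<le> y \<bullet> (hessian f m *v y)"
proof (rule field_le_epsilon)
  fix e :: real assume e: "e > 0"
  show "0 \<le> y \<bullet> (hessian f m *v y) + e"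
  proof (cases "y = 0")
    case False
    define e' where "e' = e / (2 * (norm y)\<^sup>2)"
    have e': "e' > 0" using False e by (simp add: e'_def)
    obtain d where d: "d > 0"
      "\<And>y. norm y < d \<Longrightarrow> \<bar>f (m + y) - f m - (y \<bullet> (hessian f m *v y)) / 2\<bar> \<le> e' * (norm y)\<^sup>2"
      using taylor_second_order_minimum[OF C m e'] by blast
    define t where "t = d / (2 * norm y)"
    have t: "t > 0" "norm (t *\<^sub>R y) < d" using False d(1) by (auto simp: t_def)
    have "f m \<le> f (m + t *\<^sub>R y)" using m by (simp add: is_minimum_def)
    then have "0 \<le> t\<^sup>2 * (y \<bullet> (hessian f m *v y)) / 2 + e' * (t\<^sup>2 * (norm y)\<^sup>2)"
      using d(2)[OF t(2)] t(1) by (simp add: matrix_vector_mult_scaleR power2_eq_square ac_simps)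
    then have "0 \<le> t\<^sup>2 * ((y \<bullet> (hessian f m *v y)) / 2 + e' * (norm y)\<^sup>2)" by (simp add: algebra_simps)
    then have "0 \<le> (y \<bullet> (hessian f m *v y)) / 2 + e' * (norm y)\<^sup>2"
      using t(1) by (simp add: zero_le_mult_iff)
    moreover have "e' * (norm y)\<^sup>2 = e / 2" using False by (simp add: e'_def)
    ultimately show ?thesis by linarith
  qed (use e in simp)
qed

text \<open>The eigenvalues are written as squares because their roots \<open>l b\<close> are the
  rates of the linearized flow and the eigenvalues of the matrix A.\<close>

lemma nondegenerate_minimum_eigenbasis:
  fixes f :: "real ^ 'n::finite \<Rightarrow> real"
  assumes C: "C_class 2 f" and m: "is_minimum f m" and inv: "invertible (hessian f m)"
  obtains B l where "finite B" "pairwise orthogonal B" "\<And>b. b \<in> B \<Longrightarrow> norm b = 1" "span B = UNIV"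
    "\<And>b. b \<in> B \<Longrightarrow> l b > (0::real)" "\<And>b. b \<in> B \<Longrightarrow> hessian f m *v b = (l b)\<^sup>2 *\<^sub>R b"
proof -
  let ?H = "\<lambda>y. hessian f m *v y"
  obtain B where B: "finite B" "pairwise orthogonal B" "\<And>b. b \<in> B \<Longrightarrow> norm b = 1" "span B = UNIV"
    and ev: "\<forall>b\<in>B. \<exists>c. ?H b = c *\<^sub>R b"
    using selfadjoint_orthonormal_eigenbasis[of ?H UNIV] hessian_symmetric[OF C, of m]
    by auto
  then obtain c where c: "\<And>b. b \<in> B \<Longrightarrow> ?H b = c b *\<^sub>R b" by metis
  have pos: "c b > 0" if "b \<in> B" for b
  proof -
    have "b \<bullet> ?H b = c b" using c[OF that] B(3)[OF that] by (simp add: dot_square_norm)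
    then have "c b \<ge> 0" using hessian_minimum_nonneg[OF C m, of b] by simp
    moreover have "c b \<noteq> 0"
    proof
      assume "c b = 0"
      then have "?H b = ?H 0" using c[OF that] by simp
      moreover have "inj ?H" using inv by (simp add: inj_matrix_vector_mult)
      ultimately have "b = 0" by (simp add: inj_def)
      then show False using B(3)[OF that] by simp
    qed
    ultimately show ?thesis by simp
  qed
  show ?thesis
    by (rule that[of B "\<lambda>b. sqrt (c b)"]) (use B c pos in \<open>auto simp: less_imp_le\<close>)
qed

subsection \<open>Ordinary differential equations with Lipschitz right-hand side\<close>

text \<open>The squared norm is used because it is differentiable also where \<open>u\<close>
  vanishes. The inhomogeneity enters through 2 |u| e \<le> |u|^2 + e^2, which accounts for the
  \<open>+ 1\<close> in the exponent.\<close>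

lemma gronwall_norm_power2:
  fixes u :: "real \<Rightarrow> 'a::real_inner"
  assumes der: "\<And>t. 0 \<le> t \<Longrightarrow> t \<le> T \<Longrightarrow> (u has_vector_derivative u' t) (at t)"
    and bd: "\<And>t. 0 \<le> t \<Longrightarrow> t \<le> T \<Longrightarrow> norm (u' t) \<le> K * norm (u t) + e"
    and K: "K \<ge> 0" and T: "T \<ge> 0"
  shows "(norm (u T))\<^sup>2 \<le> exp ((2 * K + 1) * T) * ((norm (u 0))\<^sup>2 + e\<^sup>2 * T)"
proof -
  let ?g = "\<lambda>t. exp (- ((2 * K + 1) * t)) * (u t \<bullet> u t) - e\<^sup>2 * t"
  have "?g T \<le> ?g 0"
  proof (rule DERIV_nonpos_imp_nonincreasing[OF T])
    fix t assume t: "0 \<le> t" "t \<le> T"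
    let ?D = "exp (- ((2 * K + 1) * t)) * (2 * (u t \<bullet> u' t)) - (2 * K + 1) * exp (- ((2 * K + 1) * t)) * (u t \<bullet> u t) - e\<^sup>2"
    have du: "((\<lambda>t. u t \<bullet> u t) has_real_derivative 2 * (u t \<bullet> u' t)) (at t)"
      using has_derivative_inner[OF der[OF t, unfolded has_vector_derivative_def] der[OF t, unfolded has_vector_derivative_def]]
      unfolding has_field_derivative_def
      by (rule has_derivative_eq_rhs) (auto simp: fun_eq_iff inner_commute)
    have D: "(?g has_real_derivative ?D) (at t)"
      by (auto intro!: derivative_eq_intros du simp: algebra_simps)
    have "2 * (u t \<bullet> u' t) \<le> 2 * (norm (u t) * norm (u' t))"
      using norm_cauchy_schwarz[of "u t" "u' t"] by simp
    also have "\<dots> \<le> 2 * (norm (u t) * (K * norm (u t) + e))"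
      using bd[OF t] by (simp add: mult_left_mono)
    also have "\<dots> = 2 * K * (u t \<bullet> u t) + 2 * norm (u t) * e"
      by (simp add: dot_square_norm power2_eq_square algebra_simps)
    also have "2 * norm (u t) * e \<le> (u t \<bullet> u t) + e\<^sup>2"
      using sum_squares_bound[of "norm (u t)" e] by (simp add: dot_square_norm)
    finally have "2 * (u t \<bullet> u' t) - (2 * K + 1) * (u t \<bullet> u t) \<le> e\<^sup>2" by (simp add: algebra_simps)
    then have "exp (- ((2 * K + 1) * t)) * (2 * (u t \<bullet> u' t) - (2 * K + 1) * (u t \<bullet> u t)) \<le> exp (- ((2 * K + 1) * t)) * e\<^sup>2"
      by (intro mult_left_mono) auto
    also have "\<dots> \<le> 1 * e\<^sup>2"
      using K t by (intro mult_right_mono) auto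
    finally have "?D \<le> 0" by (simp add: algebra_simps)
    then show "\<exists>y. DERIV ?g t :> y \<and> y \<le> 0" using D by blast
  qed
  then have "exp (- ((2 * K + 1) * T)) * (norm (u T))\<^sup>2 \<le> (norm (u 0))\<^sup>2 + e\<^sup>2 * T"
    by (simp add: dot_square_norm)
  then have "exp ((2 * K + 1) * T) * (exp (- ((2 * K + 1) * T)) * (norm (u T))\<^sup>2) \<le> exp ((2 * K + 1) * T) * ((norm (u 0))\<^sup>2 + e\<^sup>2 * T)"
    by (intro mult_left_mono) auto
  then show ?thesis by (simp add: mult.assoc[symmetric] mult_exp_exp)
qed

lemma has_vector_derivative_reflect:
  assumes "(c has_vector_derivative d) (at (- t))"
  shows "((\<lambda>s. c (- s)) has_vector_derivative - d) (at t)"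
proof -
  have "((\<lambda>s::real. - s) has_vector_derivative - 1) (at t)"
    by (auto intro!: derivative_eq_intros)
  from vector_diff_chain_at[OF this assms] show ?thesis by (simp add: o_def)
qed

lemma lipschitz_ode_dependence:
  fixes f :: "'a::real_inner \<Rightarrow> 'a"
  assumes lip: "\<And>x y. norm (f x - f y) \<le> K * norm (x - y)" and K: "K \<ge> 0"
    and c: "\<And>s. (c has_vector_derivative f (c s)) (at s)"
    and d: "\<And>s. (d has_vector_derivative f (d s)) (at s)" and t: "t \<ge> 0"
  shows "(norm (c t - d t))\<^sup>2 \<le> exp ((2 * K + 1) * t) * (norm (c 0 - d 0))\<^sup>2"
  using gronwall_norm_power2[of t "\<lambda>s. c s - d s" "\<lambda>s. f (c s) - f (d s)" K 0] assms
  by (auto intro!: derivative_eq_intros)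

lemma lipschitz_ode_unique:
  fixes f :: "'a::real_inner \<Rightarrow> 'a"
  assumes lip: "\<And>x y. norm (f x - f y) \<le> K * norm (x - y)" and K: "K \<ge> 0"
    and c: "\<And>s. (c has_vector_derivative f (c s)) (at s)"
    and d: "\<And>s. (d has_vector_derivative f (d s)) (at s)" and eq: "c 0 = d 0"
  shows "c = d"
proof
  fix t
  show "c t = d t"
  proof (cases "t \<ge> 0")
    case True
    then show ?thesis using lipschitz_ode_dependence[OF lip K c d True] eq by simp
  next
    case False
    \<comment> \<open>Negative times follow by time reversal, which turns \<open>f\<close> into
      \<open>- f\<close> and keeps the Lipschitz constant.\<close>
    have "(norm (c (- (- t)) - d (- (- t))))\<^sup>2 \<le> exp ((2 * K + 1) * - t) * (norm (c (- 0) - d (- 0)))\<^sup>2"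
    proof (rule lipschitz_ode_dependence[of "\<lambda>x. - f x" K "\<lambda>s. c (- s)" "\<lambda>s. d (- s)" "- t"])
      show "norm (- f x - - f y) \<le> K * norm (x - y)" for x y
        using lip[of y x] by (simp add: norm_minus_commute)
    qed (use False K c d in \<open>auto intro: has_vector_derivative_reflect\<close>)
    then show ?thesis using eq by simp
  qed
qed

section \<open>Existence of solutions\<close>

lemma antiderivative_zero_exists:
  fixes g :: "real \<Rightarrow> 'a::euclidean_space"
  assumes "continuous_on UNIV g"
  shows "\<exists>G. G 0 = 0 \<and> (\<forall>t. (G has_vector_derivative g t) (at t))"
proof (intro exI[of _ "\<lambda>u. LBINT y=ereal 0..ereal u. g y"] conjI allI)
  show "(LBINT y=ereal 0..ereal 0. g y) = 0" by simp
  fix t :: real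
  let ?a = "- \<bar>t\<bar> - 1" and ?b = "\<bar>t\<bar> + 1"
  have "((\<lambda>u. LBINT y=ereal 0..ereal u. g y) has_vector_derivative g t) (at t within {?a..?b})"
    by (rule interval_integral_FTC2) (use assms in \<open>auto intro: continuous_on_subset\<close>)
  moreover have "at t within {?a..?b} = at t" by (rule at_within_Icc_at) auto
  ultimately show "((\<lambda>u. LBINT y=ereal 0..ereal u. g y) has_vector_derivative g t) (at t)" by simp
qed

text \<open>Integration gains a factor \<open>1 / K\<close> against the weight
  \<open>exp (K * \<bar>t\<bar>)\<close>. This gain makes the Picard operator both bounded and
  contracting in the weighted norm.\<close>

lemma antiderivative_exp_bound:
  fixes c :: "real \<Rightarrow> 'a::real_normed_vector"
  assumes K: "K > 0" and c0: "c 0 = 0" and der: "\<And>s. (c has_vector_derivative g s) (at s)"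
    and bd: "\<And>s. norm (g s) \<le> A * exp (K * \<bar>s\<bar>)"
  shows "norm (c t) \<le> A / K * exp (K * \<bar>t\<bar>)"
proof -
  have A: "A \<ge> 0" using norm_ge_zero[of "g 0"] bd[of 0] by (simp del: norm_ge_zero)
  have pos: "norm (c t) \<le> A / K * exp (K * t)"
    if t: "t \<ge> 0" and c0: "c 0 = 0" and der: "\<And>s. (c has_vector_derivative g s) (at s)"
      and bd: "\<And>s. norm (g s) \<le> A * exp (K * \<bar>s\<bar>)" for c :: "real \<Rightarrow> 'a" and g t
  proof (cases "t = 0")
    case False
    have dc: "isCont c s" for s by (rule has_vector_derivative_continuous[OF der])
    have "norm (c t - c 0) \<le> A / K * exp (K * t) - A / K * exp (K * 0)"
    proof (rule differentiable_bound_general[of 0 t _ _ g "\<lambda>s. A * exp (K * s)"])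
      show "continuous_on {0..t} c" using dc by (simp add: continuous_at_imp_continuous_on)
      show "norm (g s) \<le> A * exp (K * s)" if "0 < s" "s < t" for s
        using bd[of s] that by simp
      show "((\<lambda>s. A / K * exp (K * s)) has_vector_derivative A * exp (K * s)) (at s)" for s
        unfolding has_real_derivative_iff_has_vector_derivative[symmetric]
        using K by (auto intro!: derivative_eq_intros)
    qed (use False t der K in \<open>auto intro!: continuous_intros\<close>)
    also have "\<dots> \<le> A / K * exp (K * t)" using A K by simp
    finally show ?thesis using c0 by simp
  qed (use c0 A K in simp)
  show ?thesis
  proof (cases "t \<ge> 0")
    case True
    then show ?thesis using pos[OF True c0 der bd] by simp
  next
    case False
    have "norm (c (- (- t))) \<le> A / K * exp (K * - t)"
      using False by (intro pos[of "- t" "\<lambda>s. c (- s)" "\<lambda>s. - g (- s)"])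
        (auto simp: c0 bd[of "- _", simplified] intro: has_vector_derivative_reflect der)
    then show ?thesis using False by simp
  qed
qed

text \<open>Solutions are fixed points of the Picard operator, which is a contraction of the space of
  curves with the norm \<open>sup \<bar>c t - z\<bar> exp (- 2 K \<bar>t\<bar>)\<close>.\<close>

lemma lipschitz_ode_exists:
  fixes f :: "'a::euclidean_space \<Rightarrow> 'a"
  assumes lip: "\<And>x y. norm (f x - f y) \<le> K * norm (x - y)" and K: "K > 0"
  shows "\<exists>c. c 0 = z \<and> (\<forall>s. (c has_vector_derivative f (c s)) (at s))"
proof -
  have cf: "continuous_on A f" for A
    using lip K by (intro lipschitz_on_continuous_on[of K]) (auto simp: lipschitz_on_def dist_norm)
  \<comment> \<open>The rate is twice the Lipschitz constant, so the gain \<open>1 / (2 * K)\<close>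
    against \<open>K\<close> gives the contraction factor 1/2 on the whole line at once.\<close>
  define W where "W = (\<lambda>t::real. exp (2 * K * \<bar>t\<bar>))"
  have W: "W t > 0" for t by (simp add: W_def)
  have cW: "continuous_on UNIV W" unfolding W_def by (intro continuous_intros)
  \<comment> \<open>The unknown is the rescaled curve \<open>\<phi> = (c - z) / W\<close>, an
    element of the Banach space of bounded continuous functions; \<open>g\<close> is the right-hand
    side along the curve that \<open>\<phi>\<close> encodes.\<close>
  define g where "g = (\<lambda>(\<phi> :: real \<Rightarrow>\<^sub>C 'a) s. f (z + W s *\<^sub>R apply_bcontfun \<phi> s))"
  have cg: "continuous_on UNIV (g \<phi>)" for \<phi>
    unfolding g_def by (intro continuous_on_compose2[OF cf[of UNIV]] continuous_intros cW) auto
  obtain P where P: "\<And>\<phi>. P \<phi> 0 = 0" "\<And>\<phi> t. (P \<phi> has_vector_derivative g \<phi> t) (at t)"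
    using choice[of "\<lambda>\<phi> G. G 0 = 0 \<and> (\<forall>t. (G has_vector_derivative g \<phi> t) (at t))"]
      antiderivative_zero_exists[OF cg] by blast
  have cP: "continuous_on UNIV (P \<phi>)" for \<phi>
    by (intro continuous_at_imp_continuous_on ballI has_vector_derivative_continuous[OF P(2)])
  define Q where "Q = (\<lambda>\<phi> t. (1 / W t) *\<^sub>R P \<phi> t)"
  have Qb: "Q \<phi> \<in> bcontfun" for \<phi>
  proof (rule bcontfun_normI)
    show "continuous_on UNIV (Q \<phi>)" unfolding Q_def
      using W by (intro continuous_intros cP cW) (auto simp: less_imp_neq[symmetric])
    define A where "A = norm (f z) + K * norm \<phi>"
    fix t
    have "norm (g \<phi> s) \<le> A * exp ((2 * K) * \<bar>s\<bar>)" for s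
    proof -
      have "norm (g \<phi> s) \<le> norm (f z) + norm (g \<phi> s - f z)" by (rule norm_triangle_sub)
      also have "norm (g \<phi> s - f z) \<le> K * norm (W s *\<^sub>R apply_bcontfun \<phi> s)"
        using lip[of "z + W s *\<^sub>R apply_bcontfun \<phi> s" z] by (simp add: g_def)
      also have "\<dots> \<le> K * (W s * norm \<phi>)"
        using K W[of s] norm_bounded[of \<phi> s] by (simp add: mult_left_mono)
      also have "norm (f z) \<le> W s * norm (f z)"
        using K by (simp add: W_def mult_le_cancel_right1)
      finally show ?thesis by (simp add: A_def W_def algebra_simps)
    qed
    from antiderivative_exp_bound[OF _ P(1) P(2) this, of t]
    have "norm (P \<phi> t) \<le> A / (2 * K) * W t" using K by (simp add: W_def)
    then show "norm (Q \<phi> t) \<le> A / (2 * K)" using W[of t] by (simp add: Q_def field_simps)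
  qed
  define F where "F = (\<lambda>\<phi>. Bcontfun (Q \<phi>))"
  have aF: "apply_bcontfun (F \<phi>) = Q \<phi>" for \<phi> by (simp add: F_def Bcontfun_inverse Qb)
  have "\<exists>!\<phi>. F \<phi> = \<phi>"
  proof (rule banach_fix_type[of "1 / 2"])
    show "\<forall>\<phi> \<theta>. dist (F \<phi>) (F \<theta>) \<le> 1 / 2 * dist \<phi> \<theta>"
    proof (intro allI dist_bound)
      fix \<phi> \<theta> t
      have "norm (g \<phi> s - g \<theta> s) \<le> (K * dist \<phi> \<theta>) * exp ((2 * K) * \<bar>s\<bar>)" for s
      proof -
        have "norm (g \<phi> s - g \<theta> s) \<le> K * norm (W s *\<^sub>R apply_bcontfun \<phi> s - W s *\<^sub>R apply_bcontfun \<theta> s)"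
          using lip[of "z + W s *\<^sub>R apply_bcontfun \<phi> s" "z + W s *\<^sub>R apply_bcontfun \<theta> s"] by (simp add: g_def)
        also have "\<dots> = K * (W s * dist (apply_bcontfun \<phi> s) (apply_bcontfun \<theta> s))"
          using W[of s] by (simp add: dist_norm flip: scaleR_diff_right)
        also have "\<dots> \<le> K * (W s * dist \<phi> \<theta>)"
          using K W[of s] dist_bounded[of \<phi> s \<theta>] by (simp add: mult_left_mono)
        finally show ?thesis by (simp add: W_def ac_simps)
      qed
      from antiderivative_exp_bound[OF _ _ _ this, of "\<lambda>t. P \<phi> t - P \<theta> t" t]
      have "norm (P \<phi> t - P \<theta> t) \<le> (K * dist \<phi> \<theta>) / (2 * K) * W t"
        using K by (simp add: W_def P has_vector_derivative_diff)
      then show "dist (apply_bcontfun (F \<phi>) t) (apply_bcontfun (F \<theta>) t) \<le> 1 / 2 * dist \<phi> \<theta>"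
        using K W[of t] unfolding aF Q_def dist_norm scaleR_diff_right[symmetric] norm_scaleR
        by (simp add: divide_simps mult.commute)
    qed
  qed auto
  then obtain \<phi> where "F \<phi> = \<phi>" by blast
  then have "Q \<phi> = apply_bcontfun \<phi>" using aF by metis
  then have Peq: "W t *\<^sub>R apply_bcontfun \<phi> t = P \<phi> t" for t
    using W[of t] by (simp add: Q_def flip: \<open>Q \<phi> = apply_bcontfun \<phi>\<close>)
  have "((\<lambda>t. z + P \<phi> t) has_vector_derivative f (z + P \<phi> t)) (at t)" for t
    using P(2)[of \<phi> t] by (auto simp: g_def Peq intro!: derivative_eq_intros)
  then show ?thesis using P(1) by (intro exI[of _ "\<lambda>t. z + P \<phi> t"]) simp
qed

text \<open>The orbit of \<open>p\<close> is constant, so the variational equation is autonomous and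
  \<open>E\<close> solves it. One Gronwall estimate keeps nearby orbits within
  \<open>M * norm (z - p)\<close> of \<open>p\<close> up to time \<open>T\<close>; there the
  linearization error of \<open>f\<close> is small, and a second one bounds the difference between
  the orbit and its linear approximation.\<close>

lemma flow_derivative_equilibrium:
  fixes f :: "'a::euclidean_space \<Rightarrow> 'a"
  assumes lip: "\<And>x y. norm (f x - f y) \<le> K * norm (x - y)" and K: "K \<ge> 0"
    and LK: "\<And>y. norm (L y) \<le> K * norm y" and fp: "f p = 0" and fL: "(f has_derivative L) (at p)"
    and c0: "\<And>z. c z 0 = z" and c: "\<And>z s. (c z has_vector_derivative f (c z s)) (at s)"
    and E0: "\<And>w. E 0 w = w" and E: "\<And>w s. ((\<lambda>s. E s w) has_vector_derivative L (E s w)) (at s)"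
    and Elin: "\<And>s. linear (E s)" and T: "T \<ge> 0"
  shows "((\<lambda>z. c z T) has_derivative E T) (at p)"
proof -
  have cp: "c p = (\<lambda>_. p)"
    by (rule lipschitz_ode_unique[OF lip K c]) (auto simp: c0 fp)
  have linL: "linear L" using fL has_derivative_linear by blast
  define M where "M = exp ((2 * K + 1) * T)"
  have M: "M \<ge> 1" using K T by (simp add: M_def)
  show ?thesis
    unfolding has_derivative_at_alt
  proof (intro conjI allI impI)
    show "bounded_linear (E T)" using Elin by (simp add: linear_conv_bounded_linear)
    fix e :: real assume e: "e > 0"
    \<comment> \<open>Chosen for the final estimate: the Gronwall factor contributes
      \<open>M\<close>, the squared growth bound \<open>M\<^sup>2\<close>, and the integrated error
      \<open>T\<close>, and M \<epsilon>^2 M^2 T must not exceed e^2.\<close>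
    define \<epsilon> where "\<epsilon> = e / (M\<^sup>2 * (T + 1))"
    have \<epsilon>: "\<epsilon> > 0" using e M T by (simp add: \<epsilon>_def)
    obtain \<delta> where \<delta>: "\<delta> > 0" "\<And>y. norm (y - p) < \<delta> \<Longrightarrow> norm (f y - L (y - p)) \<le> \<epsilon> * norm (y - p)"
      using fL \<epsilon> unfolding has_derivative_at_alt fp by fastforce
    show "\<exists>d>0. \<forall>z. norm (z - p) < d \<longrightarrow> norm (c z T - c p T - E T (z - p)) \<le> e * norm (z - p)"
    proof (intro exI[of _ "\<delta> / M"] conjI allI impI)
      show "\<delta> / M > 0" using \<delta> M by simp
      fix z assume z: "norm (z - p) < \<delta> / M"
      have growth: "norm (c z s - p) \<le> M * norm (z - p)" if s: "0 \<le> s" "s \<le> T" for s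
      proof (rule power2_le_imp_le)
        have "(norm (c z s - p))\<^sup>2 \<le> exp ((2 * K + 1) * s) * (norm (z - p))\<^sup>2"
          using lipschitz_ode_dependence[OF lip K c[of z] c[of p] s(1)] by (simp add: cp c0)
        also have "\<dots> \<le> M\<^sup>2 * (norm (z - p))\<^sup>2"
        proof (rule mult_right_mono)
          have "exp ((2 * K + 1) * s) \<le> M" using s K by (simp add: M_def mult_left_mono)
          also have "\<dots> \<le> M\<^sup>2" using M by (simp add: power2_eq_square)
          finally show "exp ((2 * K + 1) * s) \<le> M\<^sup>2" .
        qed simp
        finally show "(norm (c z s - p))\<^sup>2 \<le> (M * norm (z - p))\<^sup>2" by (simp add: power_mult_distrib)
      qed (use M in simp)
      let ?r = "\<lambda>s. c z s - p - E s (z - p)"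
      have "(norm (?r T))\<^sup>2 \<le> exp ((2 * K + 1) * T) * ((norm (?r 0))\<^sup>2 + (\<epsilon> * (M * norm (z - p)))\<^sup>2 * T)"
      proof (rule gronwall_norm_power2[OF _ _ K T])
        fix s assume s: "0 \<le> s" "s \<le> T"
        show "(?r has_vector_derivative f (c z s) - L (E s (z - p))) (at s)"
          by (auto intro!: derivative_eq_intros c E)
        have "M * norm (z - p) < \<delta>" using z M by (simp add: field_simps)
        then have "norm (c z s - p) < \<delta>" using growth[OF s] by simp
        then have "norm (f (c z s) - L (c z s - p)) \<le> \<epsilon> * norm (c z s - p)" by (rule \<delta>)
        also have "\<dots> \<le> \<epsilon> * (M * norm (z - p))" using growth[OF s] \<epsilon> by simp
        finally have "norm (f (c z s) - L (c z s - p)) \<le> \<epsilon> * (M * norm (z - p))" .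
        then have "norm (L (?r s) + (f (c z s) - L (c z s - p))) \<le> K * norm (?r s) + \<epsilon> * (M * norm (z - p))"
          using LK by (intro norm_triangle_mono)
        also have "L (?r s) + (f (c z s) - L (c z s - p)) = f (c z s) - L (E s (z - p))"
          by (simp add: linear_diff[OF linL])
        finally show "norm (f (c z s) - L (E s (z - p))) \<le> K * norm (?r s) + \<epsilon> * (M * norm (z - p))" .
      qed
      also have "\<dots> = (M * \<epsilon>\<^sup>2 * M\<^sup>2 * T) * (norm (z - p))\<^sup>2"
        by (simp add: c0 E0 power_mult_distrib flip: M_def)
      also have "M * \<epsilon>\<^sup>2 * M\<^sup>2 * T = e\<^sup>2 * (T / (M * (T + 1)\<^sup>2))"
      proof -
          have "M * (e\<^sup>2 / ((M\<^sup>2)\<^sup>2 * X)) * M\<^sup>2 * T = e\<^sup>2 * (T / (M * X))" if "X \<noteq> 0" for X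
            using M that by (simp add: power2_eq_square)
          then show ?thesis using T unfolding \<epsilon>_def power_divide power_mult_distrib by simp
        qed
      also have "T / (M * (T + 1)\<^sup>2) \<le> 1"
      proof -
        have "T \<le> 1 * (T + 1)\<^sup>2" using T by (simp add: power2_eq_square algebra_simps)
        also have "\<dots> \<le> M * (T + 1)\<^sup>2" using M by (intro mult_right_mono) auto
        finally show ?thesis using M T by (simp add: field_simps)
      qed
      finally have "(norm (?r T))\<^sup>2 \<le> (e * norm (z - p))\<^sup>2"
        by (simp add: power_mult_distrib mult_left_mono mult_right_mono)
      from power2_le_imp_le[OF this] show "norm (c z T - c p T - E T (z - p)) \<le> e * norm (z - p)"
        using e by (simp add: cp)
    qed
  qed
qed

subsection \<open>Lyapunov exponents\<close>

context
  fixes \<phi> :: "real \<Rightarrow> 'a::euclidean_space \<Rightarrow> 'a" and p :: 'a and D :: "real \<Rightarrow> 'a \<Rightarrow> 'a"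
    and B :: "'a set" and l :: "'a \<Rightarrow> real"
  assumes fin: "finite B" and ind: "independent B" and sp: "span B = UNIV"
    and der: "\<And>t. t \<ge> 0 \<Longrightarrow> (\<phi> t has_derivative D t) (at p)"
    and eig: "\<And>b t. b \<in> B \<Longrightarrow> t \<ge> 0 \<Longrightarrow> D t b = exp (l b * t) *\<^sub>R b"
begin

private abbreviation "rp \<equiv> representation B"

private lemma linear_rp: "linear (\<lambda>w. rp w b)"
  by (intro linearI) (simp_all add: representation_add[OF ind] representation_scale[OF ind] sp)

private lemma rp_expand: "w = (\<Sum>b\<in>B. rp w b *\<^sub>R b)"
  using sum_representation_eq[OF ind _ fin, of w] sp by simp

private lemma evolve_expand:
  assumes "t \<ge> 0"
  shows "D t w = (\<Sum>b\<in>B. (rp w b * exp (l b * t)) *\<^sub>R b)"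
proof -
  interpret linear "D t" using der[OF assms] by (rule has_derivative_linear)
  have "D t w = D t (\<Sum>b\<in>B. rp w b *\<^sub>R b)" by (simp flip: rp_expand)
  also have "\<dots> = (\<Sum>b\<in>B. rp w b *\<^sub>R D t b)" by (simp add: sum scale)
  also have "\<dots> = (\<Sum>b\<in>B. (rp w b * exp (l b * t)) *\<^sub>R b)"
    using eig[OF _ assms] by (intro sum.cong) auto
  finally show ?thesis .
qed

private lemma rp_evolve:
  assumes "t \<ge> 0" "b \<in> B"
  shows "rp (D t w) b = rp w b * exp (l b * t)"
proof -
  interpret linear "\<lambda>w. rp w b" by (rule linear_rp)
  have "rp (D t w) b = (\<Sum>a\<in>B. (rp w a * exp (l a * t)) * rp a b)"
    unfolding evolve_expand[OF assms(1)] by (simp add: sum scale)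
  also have "\<dots> = (\<Sum>a\<in>B. if b = a then rp w a * exp (l a * t) else 0)"
    using representation_basis[OF ind] by (intro sum.cong) auto
  finally show ?thesis using fin assms(2) by simp
qed

text \<open>The fastest rate among the basis vectors present in \<open>w\<close> determines the
  growth. The triangle inequality bounds it from above; from below, one coefficient with the maximal
  rate suffices, since coordinate functionals are bounded. The limsup is therefore a limit.\<close>

private lemma lyapunov_exponent_eq:
  assumes "w \<noteq> 0"
  shows "{b\<in>B. rp w b \<noteq> 0} \<noteq> {}" "lyapunov_exponent \<phi> p w = ereal (Max (l ` {b\<in>B. rp w b \<noteq> 0}))"
proof -
  let ?W = "{b\<in>B. rp w b \<noteq> 0}"
  show ne: "?W \<noteq> {}"
  proof
    assume "?W = {}"
    then have "(\<Sum>b\<in>B. rp w b *\<^sub>R b) = 0" by (intro sum.neutral) auto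
    then show False using assms by (simp flip: rp_expand)
  qed
  define M where "M = Max (l ` ?W)"
  have "M \<in> l ` ?W" unfolding M_def using ne fin by (intro Max_in) auto
  then obtain a where a: "a \<in> B" "rp w a \<noteq> 0" "l a = M" by auto
  have le: "l b \<le> M" if "b \<in> B" "rp w b \<noteq> 0" for b
    unfolding M_def using that fin by (intro Max_ge) auto
  obtain C where C: "C > 0" "\<And>w. \<bar>rp w a\<bar> \<le> C * norm w"
    using linear_bounded_pos[OF linear_rp[of a]] by auto
  define c1 where "c1 = \<bar>rp w a\<bar> / C"
  define c2 where "c2 = (\<Sum>b\<in>B. \<bar>rp w b\<bar> * norm b)"
  have c1: "c1 > 0" using a C by (simp add: c1_def)
  have lo: "c1 * exp (M * t) \<le> norm (D t w)" if "t \<ge> 0" for t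
  proof -
    have "\<bar>rp w a\<bar> * exp (M * t) \<le> C * norm (D t w)"
      using C(2)[of "D t w"] rp_evolve[OF that a(1)] a(3) by (simp add: abs_mult)
    then show ?thesis using C(1) by (simp add: c1_def field_simps)
  qed
  have hi: "norm (D t w) \<le> c2 * exp (M * t)" if "t \<ge> 0" for t
  proof -
    have "norm (D t w) \<le> (\<Sum>b\<in>B. norm ((rp w b * exp (l b * t)) *\<^sub>R b))"
      unfolding evolve_expand[OF that] by (rule norm_sum)
    also have "\<dots> \<le> (\<Sum>b\<in>B. \<bar>rp w b\<bar> * norm b * exp (M * t))"
    proof (rule sum_mono)
      fix b assume b: "b \<in> B"
      show "norm ((rp w b * exp (l b * t)) *\<^sub>R b) \<le> \<bar>rp w b\<bar> * norm b * exp (M * t)"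
      proof (cases "rp w b = 0")
        case False
        have "exp (l b * t) \<le> exp (M * t)" using le[OF b False] that by (simp add: mult_right_mono)
        then have "(\<bar>rp w b\<bar> * norm b) * exp (l b * t) \<le> (\<bar>rp w b\<bar> * norm b) * exp (M * t)"
          by (intro mult_left_mono) auto
        then show ?thesis by (simp add: abs_mult mult_ac)
      qed simp
    qed
    also have "\<dots> = c2 * exp (M * t)" by (simp add: c2_def sum_distrib_right)
    finally show ?thesis .
  qed
  have c2: "c2 > 0" using lo[of 0] hi[of 0] c1 by simp
  have "((\<lambda>t. ln (norm (D t w)) / t) \<longlongrightarrow> M) at_top"
  proof (rule tendsto_sandwich)
    have ev: "eventually (\<lambda>t::real. t > 0) at_top" by (rule eventually_gt_at_top)
    show "eventually (\<lambda>t. ln c1 / t + M \<le> ln (norm (D t w)) / t) at_top"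
      using ev
    proof eventually_elim
      case (elim t)
      have "ln (c1 * exp (M * t)) \<le> ln (norm (D t w))"
        using lo[of t] elim c1 by (intro ln_mono) auto
      then have "(ln c1 + M * t) / t \<le> ln (norm (D t w)) / t"
        using elim c1 by (intro divide_right_mono) (simp_all add: ln_mult)
      then show ?case using elim by (simp add: add_divide_distrib)
    qed
    show "eventually (\<lambda>t. ln (norm (D t w)) / t \<le> ln c2 / t + M) at_top"
      using ev
    proof eventually_elim
      case (elim t)
      have "0 < c1 * exp (M * t)" using c1 by simp
      then have "ln (norm (D t w)) \<le> ln (c2 * exp (M * t))"
        using lo[of t] hi[of t] elim c2 by (intro ln_mono) auto
      then have "ln (norm (D t w)) / t \<le> (ln c2 + M * t) / t"
        using elim c2 by (intro divide_right_mono) (simp_all add: ln_mult)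
      then show ?case using elim by (simp add: add_divide_distrib)
    qed
    have "((\<lambda>t::real. c / t + M) \<longlongrightarrow> 0 + M) at_top" for c
      by (intro tendsto_intros tendsto_divide_0[OF tendsto_const] filterlim_at_top_imp_at_infinity filterlim_ident)
    then show "((\<lambda>t::real. ln c1 / t + M) \<longlongrightarrow> M) at_top" "((\<lambda>t::real. ln c2 / t + M) \<longlongrightarrow> M) at_top"
      by simp_all
  qed
  then have "((\<lambda>t. ereal (ln (norm (D t w)) / t)) \<longlongrightarrow> ereal M) at_top"
    by simp
  moreover have "eventually (\<lambda>t. ereal (ln (norm (D t w)) / t) =
      ereal (ln (norm (frechet_derivative (\<phi> t) (at p) w)) / t)) at_top"
    using eventually_ge_at_top[of 0] by eventually_elim (simp flip: frechet_derivative_at[OF der])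
  ultimately have "((\<lambda>t. ereal (ln (norm (frechet_derivative (\<phi> t) (at p) w)) / t)) \<longlongrightarrow> ereal M) at_top"
    by (rule Lim_transform_eventually)
  then show "lyapunov_exponent \<phi> p w = ereal (Max (l ` ?W))"
    unfolding lyapunov_exponent_def M_def by (intro lim_imp_Limsup) auto
qed

private lemma mem_span_rp: "w \<in> span {b\<in>B. Q b} \<longleftrightarrow> (\<forall>b\<in>B. rp w b \<noteq> 0 \<longrightarrow> Q b)"
proof
  assume "w \<in> span {b\<in>B. Q b}"
  then have "rp w = representation {b\<in>B. Q b} w"
    by (intro representation_extend[OF ind]) auto
  then show "\<forall>b\<in>B. rp w b \<noteq> 0 \<longrightarrow> Q b"
    using representation_ne_zero[of "{b\<in>B. Q b}" w] by (metis (mono_tags, lifting) mem_Collect_eq)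
next
  assume *: "\<forall>b\<in>B. rp w b \<noteq> 0 \<longrightarrow> Q b"
  have "(\<Sum>b\<in>B. rp w b *\<^sub>R b) \<in> span {b\<in>B. Q b}"
  proof (rule span_sum)
    fix b assume "b \<in> B"
    then show "rp w b *\<^sub>R b \<in> span {b\<in>B. Q b}"
      using * by (cases "rp w b = 0") (auto intro!: span_scale[OF span_base] span_zero)
  qed
  then show "w \<in> span {b\<in>B. Q b}" by (simp flip: rp_expand)
qed

private lemma dim_filtration: "dim (span {b\<in>B. Q b}) = card {b\<in>B. Q b}"
  using independent_mono[OF ind, of "{b\<in>B. Q b}"] by (simp add: dim_eq_card_independent)

text \<open>Every sublevel set of the exponent is spanned by part of the basis, so the jump of
  dimension at \<open>c\<close> counts the basis vectors with rate \<open>c\<close>. Summing over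
  distinct exponents with multiplicity is then the same as summing over the basis.\<close>

lemma sum_nonneg_lyapunov_eigenbasis: "sum_nonneg_lyapunov \<phi> p = (\<Sum>b\<in>B. max 0 (l b))"
proof -
  have le: "{w. w = 0 \<or> lyapunov_exponent \<phi> p w \<le> ereal c} = span {b\<in>B. l b \<le> c}" for c
  proof -
    have "w = 0 \<or> lyapunov_exponent \<phi> p w \<le> ereal c \<longleftrightarrow> w \<in> span {b\<in>B. l b \<le> c}" for w
    proof (cases "w = 0")
      case False
      show ?thesis using False lyapunov_exponent_eq[OF False] fin
        by (auto simp: mem_span_rp)
    qed (simp add: span_zero)
    then show ?thesis by blast
  qed
  have less: "{w. w = 0 \<or> lyapunov_exponent \<phi> p w < ereal c} = span {b\<in>B. l b < c}" for c
  proof -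
    have "w = 0 \<or> lyapunov_exponent \<phi> p w < ereal c \<longleftrightarrow> w \<in> span {b\<in>B. l b < c}" for w
    proof (cases "w = 0")
      case False
      show ?thesis using False lyapunov_exponent_eq[OF False] fin
        by (auto simp: mem_span_rp)
    qed (simp add: span_zero)
    then show ?thesis by blast
  qed
  have mult: "lyapunov_multiplicity \<phi> p c = card {b\<in>B. l b = c}" for c
  proof -
    have "{b\<in>B. l b \<le> c} = {b\<in>B. l b < c} \<union> {b\<in>B. l b = c}" by auto
    then have "card {b\<in>B. l b \<le> c} = card {b\<in>B. l b < c} + card {b\<in>B. l b = c}"
      using fin by (simp add: card_Un_disjoint disjoint_iff)
    then show ?thesis by (simp only: lyapunov_multiplicity_def le less dim_filtration)
  qed
  have spec: "lyapunov_spectrum \<phi> p = l ` B"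
  proof
    show "lyapunov_spectrum \<phi> p \<subseteq> l ` B"
    proof
      fix c assume "c \<in> lyapunov_spectrum \<phi> p"
      then obtain w where w: "w \<noteq> 0" "lyapunov_exponent \<phi> p w = ereal c" by (auto simp: lyapunov_spectrum_def)
      have "Max (l ` {b\<in>B. rp w b \<noteq> 0}) \<in> l ` {b\<in>B. rp w b \<noteq> 0}"
        using lyapunov_exponent_eq[OF w(1)] fin by (intro Max_in) auto
      then show "c \<in> l ` B" using lyapunov_exponent_eq[OF w(1)] w(2) by auto
    qed
    show "l ` B \<subseteq> lyapunov_spectrum \<phi> p"
    proof
      fix c assume "c \<in> l ` B"
      then obtain b where b: "b \<in> B" "c = l b" by auto
      have b0: "b \<noteq> 0" using b ind dependent_zero by blast
      have "{a\<in>B. rp b a \<noteq> 0} = {b}" using representation_basis[OF ind b(1)] b by auto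
      then have "lyapunov_exponent \<phi> p b = ereal c" using lyapunov_exponent_eq[OF b0] b by simp
      then show "c \<in> lyapunov_spectrum \<phi> p" using b0 by (auto simp: lyapunov_spectrum_def)
    qed
  qed
  have "(\<Sum>b\<in>B. max 0 (l b)) = (\<Sum>c\<in>l ` B. \<Sum>b\<in>{b\<in>B. l b = c}. max 0 (l b))"
    by (rule sum.image_gen[OF fin])
  also have "\<dots> = (\<Sum>c\<in>l ` B. real (card {b\<in>B. l b = c}) * max 0 c)"
    by (intro sum.cong) auto
  also have "\<dots> = (\<Sum>c | c \<in> l ` B \<and> 0 \<le> c. real (card {b\<in>B. l b = c}) * c)"
    using fin by (intro sum.mono_neutral_cong_right) auto
  finally show ?thesis by (simp add: sum_nonneg_lyapunov_def spec mult)
qed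

end

subsection \<open>Periodic functions\<close>

definition unit_cell :: "(real ^ 'n) set" where
  "unit_cell = {x. \<forall>i. 0 \<le> x $ i \<and> x $ i < 1}"

lemma unit_cell_representative:
  obtains k :: "real ^ 'n" where "\<And>i. k $ i \<in> \<int>" "x + k \<in> unit_cell"
proof (rule that)
  show "(\<chi> i. - of_int \<lfloor>x $ i\<rfloor>) $ i \<in> (\<int> :: real set)" for i by simp
  show "x + (\<chi> i. - of_int \<lfloor>x $ i\<rfloor>) \<in> unit_cell"
    unfolding unit_cell_def by (simp, intro allI) linarith
qed

lemma unit_cell_subset_cbox: "unit_cell \<subseteq> cbox 0 1"
  by (auto simp: unit_cell_def mem_box_cart less_imp_le)

lemma integer_periodicD: "integer_periodic f \<Longrightarrow> (\<And>i. k $ i \<in> \<int>) \<Longrightarrow> f (x + k) = f x"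
  by (simp add: integer_periodic_def)

lemma integer_periodic_bounded:
  fixes f :: "real ^ 'n::finite \<Rightarrow> real"
  assumes per: "integer_periodic f" and cont: "continuous_on UNIV f"
  obtains M where "M > 0" "\<And>x. \<bar>f x\<bar> \<le> M"
proof -
  have "bounded (f ` cbox 0 1)"
    by (intro compact_imp_bounded compact_continuous_image continuous_on_subset[OF cont]) auto
  then obtain M where M: "M > 0" "\<And>x. x \<in> cbox 0 1 \<Longrightarrow> \<bar>f x\<bar> \<le> M"
    by (auto simp: bounded_pos)
  have "\<bar>f x\<bar> \<le> M" for x
  proof -
    obtain k where k: "\<And>i. k $ i \<in> \<int>" "x + k \<in> unit_cell" using unit_cell_representative[of x] by blast
    then show ?thesis using M(2)[of "x + k"] unit_cell_subset_cbox integer_periodicD[OF per k(1), of x] by auto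
  qed
  then show ?thesis using M that by blast
qed

lemma integer_periodic_partial:
  fixes f :: "real ^ 'n::finite \<Rightarrow> real"
  assumes per: "integer_periodic f" and diff: "f differentiable_on UNIV"
  shows "integer_periodic (partial i f)"
  unfolding integer_periodic_def
proof (intro allI impI)
  fix x k :: "real ^ 'n" assume k: "\<forall>i. k $ i \<in> \<int>"
  have d: "(f has_derivative frechet_derivative f (at (x + k))) (at (x + k))"
    using diff frechet_derivative_works by (auto simp: differentiable_on_def)
  have "((\<lambda>x. x + k) has_derivative (\<lambda>y. y)) (at x)" by (auto intro!: derivative_eq_intros)
  from has_derivative_compose[OF this d]
  have "(f has_derivative frechet_derivative f (at (x + k))) (at x)"
    using k by (simp add: integer_periodicD[OF per])
  then show "partial i f (x + k) = partial i f x"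
    by (simp add: partial_def frechet_derivative_at[symmetric])
qed

subsection \<open>The flow near a minimum\<close>

text \<open>The second partial derivatives are continuous and periodic, hence bounded. The same
  \<open>K\<close> serves for the linearized equation, as \<open>flow_derivative_equilibrium\<close>
  expects.\<close>

lemma gradient_lipschitz:
  fixes V :: "real ^ 'n::finite \<Rightarrow> real"
  assumes per: "integer_periodic V" and C: "C_class 2 V"
  obtains K where "K \<ge> 0" "\<And>x y. norm (gradient V x - gradient V y) \<le> K * norm (x - y)"
    "\<And>x y. norm (hessian V x *v y) \<le> K * norm y"
proof -
  have "\<exists>M. \<forall>x. \<bar>partial i (partial j V) x\<bar> \<le> M" for i j
  proof -
    have "integer_periodic (partial i (partial j V))"
      using C by (intro integer_periodic_partial per) (auto simp: numeral_2_eq_2)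
    moreover have "continuous_on UNIV (partial i (partial j V))" using C by (simp add: numeral_2_eq_2)
    ultimately show ?thesis by (meson integer_periodic_bounded)
  qed
  then obtain M where M: "\<And>i j x. \<bar>partial i (partial j V) x\<bar> \<le> M i j" by metis
  define K where "K = (\<Sum>i\<in>UNIV. \<Sum>j\<in>UNIV. M i j)"
  have M0: "0 \<le> M i j" for i j using M[of i j 0] by linarith
  have K: "K \<ge> 0" unfolding K_def using M0 by (intro sum_nonneg)
  have H: "norm (hessian V x *v y) \<le> K * norm y" for x y
  proof -
    have "norm (hessian V x *v y) \<le> (\<Sum>i\<in>UNIV. \<bar>(hessian V x *v y) $ i\<bar>)" by (rule norm_le_l1_cart)
    also have "\<dots> \<le> (\<Sum>i\<in>UNIV. \<Sum>j\<in>UNIV. M i j * norm y)"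
    proof (rule sum_mono)
      fix i
      have "\<bar>(hessian V x *v y) $ i\<bar> \<le> (\<Sum>j\<in>UNIV. \<bar>hessian V x $ i $ j * y $ j\<bar>)"
        unfolding matrix_vector_mult_def by (simp add: sum_abs)
      also have "\<dots> \<le> (\<Sum>j\<in>UNIV. M i j * norm y)"
        unfolding abs_mult using M M0 by (intro sum_mono mult_mono component_le_norm_cart) (auto simp: hessian_def)
      finally show "\<bar>(hessian V x *v y) $ i\<bar> \<le> (\<Sum>j\<in>UNIV. M i j * norm y)" .
    qed
    finally show ?thesis by (simp add: K_def sum_distrib_right)
  qed
  have "norm (gradient V x - gradient V y) \<le> K * norm (x - y)" for x y
  proof (rule differentiable_bound[of UNIV])
    show "(gradient V has_derivative (\<lambda>y. hessian V x *v y)) (at x within UNIV)" for x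
      using gradient_has_derivative_hessian[OF C] by simp
    show "onorm (\<lambda>y. hessian V x *v y) \<le> K" for x using H by (intro onorm_bound K)
  qed auto
  then show ?thesis using that K H by blast
qed

text \<open>The linearized equation y'' = Hess y decouples in the eigenbasis of the Hessian into
  scalar equations with rates \<open>l b\<close> and \<open>- l b\<close>; only the positive ones
  contribute.\<close>

lemma sum_nonneg_lyapunov_minimum:
  fixes V :: "real ^ 'n::finite \<Rightarrow> real"
  assumes per: "integer_periodic V" and C: "C_class 2 V" and m: "is_minimum V m"
    and B: "finite B" "pairwise orthogonal B" "\<And>b. b \<in> B \<Longrightarrow> norm b = 1" "span B = UNIV"
    and l: "\<And>b. b \<in> B \<Longrightarrow> l b > 0" and H: "\<And>b. b \<in> B \<Longrightarrow> hessian V m *v b = (l b)\<^sup>2 *\<^sub>R b"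
  shows "sum_nonneg_lyapunov (flow V) (m, 0) = sum l B"
proof -
  obtain K0 where K0: "K0 \<ge> 0" "\<And>x y. norm (gradient V x - gradient V y) \<le> K0 * norm (x - y)"
    "\<And>x y. norm (hessian V x *v y) \<le> K0 * norm y"
    using gradient_lipschitz[OF per C] by blast
  define f where "f = (\<lambda>z :: (real ^ 'n) \<times> (real ^ 'n). (snd z, gradient V (fst z)))"
  define L where "L = (\<lambda>z :: (real ^ 'n) \<times> (real ^ 'n). (snd z, hessian V m *v fst z))"
  define K where "K = 1 + K0"
  have K: "K > 0" using K0 by (simp add: K_def)
  have fs: "norm (fst z) \<le> norm z" "norm (snd z) \<le> norm z" for z :: "(real ^ 'n) \<times> (real ^ 'n)"
    using norm_fst_le[of "fst z" "snd z"] norm_snd_le[of "snd z" "fst z"] by simp_all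
  have lip: "norm (f x - f y) \<le> K * norm (x - y)" for x y
  proof -
    have "norm (f x - f y) \<le> norm (snd x - snd y) + norm (gradient V (fst x) - gradient V (fst y))"
      unfolding f_def diff_Pair by (rule norm_Pair_le)
    also have "\<dots> \<le> norm (snd (x - y)) + K0 * norm (fst (x - y))" using K0(2) by simp
    also have "\<dots> \<le> norm (x - y) + K0 * norm (x - y)"
      by (intro add_mono mult_left_mono fs K0)
    finally show ?thesis by (simp add: K_def algebra_simps)
  qed
  have LK: "norm (L y) \<le> K * norm y" for y
  proof -
    have "norm (L y) \<le> norm (snd y) + norm (hessian V m *v fst y)"
      unfolding L_def by (rule norm_Pair_le)
    also have "\<dots> \<le> norm (snd y) + K0 * norm (fst y)" using K0(3) by simp
    also have "\<dots> \<le> norm y + K0 * norm y"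
      by (intro add_mono mult_left_mono fs K0)
    finally show ?thesis by (simp add: K_def algebra_simps)
  qed
  have "V differentiable_on UNIV" using C by (simp add: numeral_2_eq_2)
  then have fp: "f (m, 0) = 0" using gradient_minimum m by (simp add: f_def zero_prod_def)
  have fL: "(f has_derivative L) (at (m, 0))"
    unfolding f_def L_def
    by (intro has_derivative_Pair bounded_linear_imp_has_derivative bounded_linear_snd
        has_derivative_compose[OF bounded_linear_imp_has_derivative[OF bounded_linear_fst]])
       (use gradient_has_derivative_hessian[OF C, of m] in simp)
  have "\<exists>c. c 0 = z \<and> (\<forall>s. (c has_vector_derivative f (c s)) (at s))" for z
    by (rule lipschitz_ode_exists[OF lip K])
  then obtain c where c: "\<And>z. c z 0 = z" "\<And>z s. (c z has_vector_derivative f (c z s)) (at s)"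
    by metis
  have flow: "flow V t z = c z t" for t z
  proof -
    have "(THE c. c 0 = z \<and> (\<forall>s. (c has_vector_derivative (snd (c s), gradient V (fst (c s)))) (at s))) = c z"
      unfolding f_def[symmetric]
    proof (rule the_equality)
      show "c z 0 = z \<and> (\<forall>s. (c z has_vector_derivative (snd (c z s), gradient V (fst (c z s)))) (at s))"
        using c[of z] by (simp add: f_def)
      show "d = c z" if "d 0 = z \<and> (\<forall>s. (d has_vector_derivative (snd (d s), gradient V (fst (d s)))) (at s))" for d
        by (rule lipschitz_ode_unique[OF lip]) (use that c[of z] K in \<open>auto simp: f_def\<close>)
    qed
    then show ?thesis by (simp add: flow_def)
  qed
  have on: "b \<bullet> a = (if b = a then 1 else 0)" if "a \<in> B" "b \<in> B" for a b
    using B(2,3) that by (auto simp: pairwise_def orthogonal_def dot_square_norm)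
  have expand: "(\<Sum>b\<in>B. (b \<bullet> x) *\<^sub>R b) = x" for x
    using orthonormal_basis_expand[OF B(2,3) _ B(1), of x] B(4) by (simp add: inner_commute)
  \<comment> \<open>Position and velocity parts of the fundamental solution of the linearized
    equation, solved separately in each eigendirection.\<close>
  define Ex where "Ex = (\<lambda>t z. \<Sum>b\<in>B. (cosh (l b * t) * (b \<bullet> fst z) + sinh (l b * t) / l b * (b \<bullet> snd z)) *\<^sub>R b)"
  define Ev where "Ev = (\<lambda>t z. \<Sum>b\<in>B. (l b * sinh (l b * t) * (b \<bullet> fst z) + cosh (l b * t) * (b \<bullet> snd z)) *\<^sub>R b)"
  define E where "E = (\<lambda>t z. (Ex t z, Ev t z))"
  have E0: "E 0 w = w" for w by (simp add: E_def Ex_def Ev_def expand)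
  have E: "((\<lambda>s. E s w) has_vector_derivative L (E s w)) (at s)" for s w
  proof -
    have 1: "((\<lambda>s. Ex s w) has_vector_derivative Ev s w) (at s)"
      unfolding Ex_def Ev_def
    proof (intro has_vector_derivative_sum)
      fix b assume b: "b \<in> B"
      have "((\<lambda>s. cosh (l b * s) * (b \<bullet> fst w) + sinh (l b * s) / l b * (b \<bullet> snd w)) has_real_derivative
         (l b * sinh (l b * s) * (b \<bullet> fst w) + cosh (l b * s) * (b \<bullet> snd w))) (at s)"
        using less_imp_neq[OF l[OF b], symmetric] by (auto intro!: derivative_eq_intros)
      from has_vector_derivative_scaleR[OF this has_vector_derivative_const[of b]] show "((\<lambda>s. (cosh (l b * s) * (b \<bullet> fst w) + sinh (l b * s) / l b * (b \<bullet> snd w)) *\<^sub>R b) has_vector_derivative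
         (l b * sinh (l b * s) * (b \<bullet> fst w) + cosh (l b * s) * (b \<bullet> snd w)) *\<^sub>R b) (at s)"
        by simp
    qed
    have HE: "hessian V m *v Ex s w = (\<Sum>b\<in>B. ((l b)\<^sup>2 * (cosh (l b * s) * (b \<bullet> fst w) + sinh (l b * s) / l b * (b \<bullet> snd w))) *\<^sub>R b)"
      unfolding Ex_def using H
      by (auto simp: linear_sum[OF matrix_vector_mul_linear] matrix_vector_mult_scaleR mult.commute intro!: sum.cong)
    have 2: "((\<lambda>s. Ev s w) has_vector_derivative hessian V m *v Ex s w) (at s)"
      unfolding Ev_def HE
    proof (intro has_vector_derivative_sum)
      fix b assume b: "b \<in> B"
      have "((\<lambda>s. l b * sinh (l b * s) * (b \<bullet> fst w) + cosh (l b * s) * (b \<bullet> snd w)) has_real_derivative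
         (l b)\<^sup>2 * (cosh (l b * s) * (b \<bullet> fst w) + sinh (l b * s) / l b * (b \<bullet> snd w))) (at s)"
        using l[OF b] by (auto intro!: derivative_eq_intros simp: power2_eq_square algebra_simps)
      from has_vector_derivative_scaleR[OF this has_vector_derivative_const[of b]] show "((\<lambda>s. (l b * sinh (l b * s) * (b \<bullet> fst w) + cosh (l b * s) * (b \<bullet> snd w)) *\<^sub>R b) has_vector_derivative
         ((l b)\<^sup>2 * (cosh (l b * s) * (b \<bullet> fst w) + sinh (l b * s) / l b * (b \<bullet> snd w))) *\<^sub>R b) (at s)"
        by simp
    qed
    show ?thesis using has_vector_derivative_Pair[OF 1 2] by (simp add: E_def L_def)
  qed
  have Elin: "linear (E s)" for s
    unfolding E_def Ex_def Ev_def
    by (rule linearI)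
       (simp_all add: inner_add_right algebra_simps sum.distrib scaleR_sum_right)
  have der: "(flow V t has_derivative E t) (at (m, 0))" if "t \<ge> 0" for t
  proof -
    have "((\<lambda>z. c z t) has_derivative E t) (at (m, 0))"
      by (rule flow_derivative_equilibrium[OF lip _ LK fp fL c E0 E Elin that]) (use K in simp)
    then show ?thesis by (simp flip: flow)
  qed
  \<comment> \<open>Eigenvectors of the linearization: the velocity is \<open>l b\<close>,
    respectively \<open>- l b\<close>, times the position.\<close>
  define P N where "P = (\<lambda>b. (b, l b *\<^sub>R b))" and "N = (\<lambda>b. (b, (- l b) *\<^sub>R b))"
  \<comment> \<open>\<open>P b\<close> and \<open>N b\<close> share their first component, so the
    sign of the rate is recovered by testing whether the vector is the one produced by
    \<open>P\<close>.\<close>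
  define l' where "l' = (\<lambda>w. if w = P (fst w) then l (fst w) else - l (fst w))"
  have nz: "b \<noteq> 0" if "b \<in> B" for b using B(3)[OF that] by auto
  have ne: "N b \<noteq> P a" if "b \<in> B" for a b
  proof
    assume "N b = P a"
    then have "- (l b *\<^sub>R b) = l b *\<^sub>R b" by (auto simp: P_def N_def)
    then have "(2 * l b) *\<^sub>R b = 0" by (metis add.right_inverse scaleR_2 scaleR_scaleR)
    then show False using nz[OF that] l[OF that] by simp
  qed
  have injP: "inj_on P B" and injN: "inj_on N B" by (auto simp: inj_on_def P_def N_def)
  have lP: "l' (P b) = l b" and lN: "b \<in> B \<Longrightarrow> l' (N b) = - l b" for b
    using ne[of b] by (simp_all add: l'_def P_def N_def)
  let ?B = "P ` B \<union> N ` B"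
  have eig: "E t w = exp (l' w * t) *\<^sub>R w" if "w \<in> ?B" for t w
  proof -
    have collect: "(\<Sum>b\<in>B. (g b * (b \<bullet> a) + h b * (b \<bullet> k *\<^sub>R a)) *\<^sub>R b) = (g a + k * h a) *\<^sub>R a"
      if "a \<in> B" for g h k a
    proof -
      have "(\<Sum>b\<in>B. (g b * (b \<bullet> a) + h b * (b \<bullet> k *\<^sub>R a)) *\<^sub>R b)
          = (\<Sum>b\<in>B. if a = b then (g b + k * h b) *\<^sub>R b else 0)"
        using on[OF that] by (intro sum.cong) auto
      then show ?thesis using B(1) that by simp
    qed
    from that consider b where "b \<in> B" "w = P b" | b where "b \<in> B" "w = N b" by auto
    then show ?thesis
    proof cases
      case 1
      have x1: "Ex t (P b) = (cosh (l b * t) + (l b) * (sinh (l b * t) / l b)) *\<^sub>R b"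
        unfolding Ex_def P_def fst_conv snd_conv by (rule collect[OF 1(1)])
      have x2: "Ev t (P b) = (l b * sinh (l b * t) + (l b) * cosh (l b * t)) *\<^sub>R b"
        unfolding Ev_def P_def fst_conv snd_conv by (rule collect[OF 1(1)])
      have x3: "exp (l' w * t) = cosh (l b * t) + sinh (l b * t)"
        by (simp add: 1(2) lP cosh_plus_sinh)
      show ?thesis
        using l[OF 1(1)] unfolding x3 unfolding E_def 1(2) x1 x2 by (simp add: P_def algebra_simps)
    next
      case 2
      have x1: "Ex t (N b) = (cosh (l b * t) + (- l b) * (sinh (l b * t) / l b)) *\<^sub>R b"
        unfolding Ex_def N_def fst_conv snd_conv by (rule collect[OF 2(1)])
      have x2: "Ev t (N b) = (l b * sinh (l b * t) + (- l b) * cosh (l b * t)) *\<^sub>R b"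
        unfolding Ev_def N_def fst_conv snd_conv by (rule collect[OF 2(1)])
      have x3: "exp (l' w * t) = cosh (l b * t) - sinh (l b * t)"
        by (simp add: 2(2) lN[OF 2(1)] cosh_minus_sinh)
      show ?thesis
        using l[OF 2(1)] unfolding x3 unfolding E_def 2(2) x1 x2 by (simp add: N_def algebra_simps)
    qed
  qed
  have spB: "span ?B = UNIV"
  proof -
    have "w \<in> span ?B" for w
    proof -
      have PN: "P b \<in> span ?B" "N b \<in> span ?B" if "b \<in> B" for b using that by (auto intro: span_base)
      have 1: "(b, 0) \<in> span ?B" if "b \<in> B" for b
      proof -
        have "(b, 0) = (1/2) *\<^sub>R (P b + N b)" by (simp add: P_def N_def flip: scaleR_2)
        then show ?thesis using PN[OF that] by (metis span_add span_scale)
      qed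
      have 2: "(0, b) \<in> span ?B" if "b \<in> B" for b
      proof -
        have "(0, b) = (1 / (2 * l b)) *\<^sub>R (P b - N b)"
          using l[OF that] by (simp add: P_def N_def flip: scaleR_2)
        then show ?thesis using PN[OF that] by (metis span_diff span_scale)
      qed
      have "w = (\<Sum>b\<in>B. (b \<bullet> fst w) *\<^sub>R (b, 0)) + (\<Sum>b\<in>B. (b \<bullet> snd w) *\<^sub>R (0, b))"
        by (rule prod_eqI) (simp_all add: expand fst_sum snd_sum)
      also have "\<dots> \<in> span ?B" by (intro span_add span_sum span_scale 1 2)
      finally show ?thesis .
    qed
    then show ?thesis by blast
  qed
  \<comment> \<open>A spanning family of at most 2d vectors in a space of dimension 2d is
    independent.\<close>
  have indB: "independent ?B"
  proof (rule card_le_dim_spanning[of _ UNIV])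
    have "independent B" using B(2) nz by (intro pairwise_orthogonal_independent) auto
    then have "card B = dim (span B)" by (simp add: dim_eq_card_independent)
    then have "card B = CARD('n)" using B(4) by simp
    then show "card ?B \<le> dim (UNIV :: ((real ^ 'n) \<times> (real ^ 'n)) set)"
      using card_Un_le[of "P ` B" "N ` B"] card_image_le[OF B(1), of P] card_image_le[OF B(1), of N] by simp
  qed (use spB B(1) in auto)
  have "sum_nonneg_lyapunov (flow V) (m, 0) = (\<Sum>w\<in>?B. max 0 (l' w))"
    by (rule sum_nonneg_lyapunov_eigenbasis[OF _ indB spB der eig]) (use B(1) in auto)
  also have "\<dots> = (\<Sum>w\<in>P ` B. max 0 (l' w)) + (\<Sum>w\<in>N ` B. max 0 (l' w))"
    using B(1) ne by (intro sum.union_disjoint) auto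
  also have "(\<Sum>w\<in>P ` B. max 0 (l' w)) = sum l B"
    using l by (auto simp: sum.reindex[OF injP] lP less_imp_le intro!: sum.cong)
  also have "(\<Sum>w\<in>N ` B. max 0 (l' w)) = 0"
    using l by (auto simp: sum.reindex[OF injN] lN less_imp_le intro!: sum.neutral)
  finally show ?thesis by simp
qed

subsection \<open>Integration over the unit cell\<close>

text \<open>Differentiability along one coordinate direction is all that the divergence theorem on
  the torus requires. It is inherited by sums, products and compositions through the one-variable
  rules, without any total derivative of the fields involved.\<close>

definition has_partial :: "'n \<Rightarrow> (real ^ 'n::finite \<Rightarrow> real) \<Rightarrow> (real ^ 'n \<Rightarrow> real) \<Rightarrow> bool" where
  "has_partial i f f' \<longleftrightarrow> (\<forall>x. ((\<lambda>s. f (x + s *\<^sub>R axis i 1)) has_real_derivative f' x) (at 0))"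

lemma has_partial_line:
  assumes "has_partial i f f'"
  shows "((\<lambda>s. f (x + s *\<^sub>R axis i 1)) has_real_derivative f' (x + t *\<^sub>R axis i 1)) (at t)"
proof -
  have "((\<lambda>s. f ((x + t *\<^sub>R axis i 1) + s *\<^sub>R axis i 1)) has_real_derivative f' (x + t *\<^sub>R axis i 1)) (at 0)"
    using assms by (simp add: has_partial_def)
  then have "((\<lambda>s. f (x + (s + t) *\<^sub>R axis i 1)) has_real_derivative f' (x + t *\<^sub>R axis i 1)) (at 0)"
    by (simp add: algebra_simps)
  then show ?thesis using DERIV_shift[of "\<lambda>s. f (x + s *\<^sub>R axis i 1)" _ 0 t] by simp
qed

lemma has_partial_partial: "f differentiable_on UNIV \<Longrightarrow> has_partial i f (partial i f)"
  unfolding has_partial_def using has_derivative_partial_line[of f _ i 0] by simp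

lemma has_partial_eq: "has_partial i f f' \<Longrightarrow> (\<And>x. f' x = g' x) \<Longrightarrow> has_partial i f g'"
  by (simp add: has_partial_def)

lemma has_partial_const: "has_partial i (\<lambda>x. c) (\<lambda>x. 0)"
  by (simp add: has_partial_def)

lemma has_partial_add:
  "has_partial i f f' \<Longrightarrow> has_partial i g g' \<Longrightarrow> has_partial i (\<lambda>x. f x + g x) (\<lambda>x. f' x + g' x)"
  unfolding has_partial_def by (auto intro: DERIV_add)

lemma has_partial_mult:
  assumes "has_partial i f f'" "has_partial i g g'"
  shows "has_partial i (\<lambda>x. f x * g x) (\<lambda>x. f' x * g x + f x * g' x)"
  unfolding has_partial_def
proof
  fix x
  have "((\<lambda>s. f (x + s *\<^sub>R axis i 1)) has_real_derivative f' x) (at 0)"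
    "((\<lambda>s. g (x + s *\<^sub>R axis i 1)) has_real_derivative g' x) (at 0)"
    using assms by (auto simp: has_partial_def)
  from DERIV_mult[OF this]
  show "((\<lambda>s. f (x + s *\<^sub>R axis i 1) * g (x + s *\<^sub>R axis i 1)) has_real_derivative f' x * g x + f x * g' x) (at 0)"
    by (simp add: ac_simps)
qed

lemma has_partial_cmult: "has_partial i f f' \<Longrightarrow> has_partial i (\<lambda>x. c * f x) (\<lambda>x. c * f' x)"
  using has_partial_mult[OF has_partial_const] by fastforce

lemma has_partial_sum:
  "(\<And>b. b \<in> B \<Longrightarrow> has_partial i (f b) (f' b)) \<Longrightarrow> has_partial i (\<lambda>x. \<Sum>b\<in>B. f b x) (\<lambda>x. \<Sum>b\<in>B. f' b x)"
  unfolding has_partial_def by (auto intro!: DERIV_sum)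

lemma has_partial_compose:
  assumes "\<And>y. (g has_real_derivative g' y) (at y)" "has_partial i f f'"
  shows "has_partial i (\<lambda>x. g (f x)) (\<lambda>x. g' (f x) * f' x)"
  unfolding has_partial_def
proof
  fix x
  have "((\<lambda>s. f (x + s *\<^sub>R axis i 1)) has_real_derivative f' x) (at 0)"
    using assms by (auto simp: has_partial_def)
  from DERIV_chain2[OF _ this, of g "g' (f x)"]
  show "((\<lambda>s. g (f (x + s *\<^sub>R axis i 1))) has_real_derivative g' (f x) * f' x) (at 0)"
    using assms(1)[of "f x"] by simp
qed

lemma has_partial_power2: "has_partial i f f' \<Longrightarrow> has_partial i (\<lambda>x. (f x)\<^sup>2) (\<lambda>x. 2 * f x * f' x)"
  unfolding power2_eq_square using has_partial_mult[of i f f' f f'] by (auto intro: has_partial_eq)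

lemma has_partial_periodic:
  fixes f :: "real ^ 'n::finite \<Rightarrow> real"
  assumes "has_partial i f f'" "integer_periodic f"
  shows "integer_periodic f'"
  unfolding integer_periodic_def
proof (intro allI impI)
  fix x k :: "real ^ 'n" assume k: "\<forall>i. k $ i \<in> \<int>"
  have "((\<lambda>s. f ((x + k) + s *\<^sub>R axis i 1)) has_real_derivative f' (x + k)) (at 0)"
    using assms by (simp add: has_partial_def)
  moreover have "f ((x + k) + s *\<^sub>R axis i 1) = f (x + s *\<^sub>R axis i 1)" for s
    using integer_periodicD[OF assms(2), of k "x + s *\<^sub>R axis i 1"] k by (simp add: algebra_simps)
  ultimately have "((\<lambda>s. f (x + s *\<^sub>R axis i 1)) has_real_derivative f' (x + k)) (at 0)" by simp
  moreover have "((\<lambda>s. f (x + s *\<^sub>R axis i 1)) has_real_derivative f' x) (at 0)"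
    using assms by (simp add: has_partial_def)
  ultimately show "f' (x + k) = f' x" by (rule DERIV_unique)
qed

section \<open>Translation invariance and integration of derivatives\<close>

abbreviation cell_lebesgue :: "(real ^ 'n::finite) measure" where
  "cell_lebesgue \<equiv> restrict_space lborel unit_cell"

lemma unit_cell_measurable [measurable]: "(unit_cell :: (real ^ 'n::finite) set) \<in> sets borel"
  unfolding unit_cell_def by measurable

lemma emeasure_unit_cell_finite: "emeasure lborel (unit_cell :: (real ^ 'n::finite) set) < \<infinity>"
  by (rule order_le_less_trans[OF emeasure_mono[OF unit_cell_subset_cbox]])
     (use emeasure_lborel_cbox_finite[of "0 :: real ^ 'n" 1] in auto)

lemma finite_measure_cell: "finite_measure cell_lebesgue"
  using emeasure_unit_cell_finite
  by (intro finite_measureI) (simp add: space_restrict_space emeasure_restrict_space less_top)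

lemma measurable_cell: "continuous_on UNIV f \<Longrightarrow> (f :: real ^ 'n::finite \<Rightarrow> real) \<in> borel_measurable cell_lebesgue"
  by (intro measurable_restrict_space1) (simp add: borel_measurable_continuous_onI)

lemma integrable_cell:
  fixes f :: "real ^ 'n::finite \<Rightarrow> real"
  assumes cont: "continuous_on UNIV f"
  shows "integrable cell_lebesgue f"
proof -
  have "bounded (f ` cbox 0 1)"
    by (intro compact_imp_bounded compact_continuous_image continuous_on_subset[OF cont]) auto
  then obtain M where M: "\<And>x. x \<in> cbox 0 1 \<Longrightarrow> \<bar>f x\<bar> \<le> M"
    by (auto simp: bounded_iff)
  show ?thesis
    by (rule finite_measure.integrable_const_bound[OF finite_measure_cell, of _ M])
       (use M unit_cell_subset_cbox in \<open>auto intro!: AE_I2 measurable_cell cont simp: space_restrict_space\<close>)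
qed

lemma integral_lborel_translate:
  fixes f :: "real ^ 'n::finite \<Rightarrow> real"
  assumes "f \<in> borel_measurable borel"
  shows "(\<integral>x. f (c + x) \<partial>lborel) = (\<integral>x. f x \<partial>lborel)"
proof -
  have "(\<integral>x. f x \<partial>lborel) = (\<integral>x. f x \<partial>distr lborel borel ((+) c))" by (simp add: lborel_distr_plus)
  also have "\<dots> = (\<integral>x. f (c + x) \<partial>lborel)" using assms by (intro integral_distr) auto
  finally show ?thesis by simp
qed

lemma integral_cell_translate:
  fixes f :: "real ^ 'n::finite \<Rightarrow> real"
  assumes per: "integer_periodic f" and cont: "continuous_on UNIV f" and s: "0 \<le> s" "s \<le> 1"
  shows "(\<integral>x. f (x + s *\<^sub>R axis i 1) \<partial>cell_lebesgue) = (\<integral>x. f x \<partial>cell_lebesgue)"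
proof -
  let ?C = "unit_cell :: (real ^ 'n) set" and ?e = "axis i 1 :: real ^ 'n"
  let ?A = "?C \<inter> {x. x $ i < s}"
  have mA [measurable]: "?A \<in> sets borel" by measurable
  have mf [measurable]: "f \<in> borel_measurable borel" using cont by (rule borel_measurable_continuous_onI)
  have C: "?C \<in> sets lborel" by simp
  obtain M where M: "\<And>x. \<bar>f x\<bar> \<le> M" using integer_periodic_bounded[OF per cont] by blast
  have int: "integrable lborel (\<lambda>x. indicator S x *\<^sub>R f x)" if "S \<subseteq> ?C" "S \<in> sets borel" for S
  proof (rule integrableI_bounded_set_indicator)
    show "emeasure lborel S < \<infinity>"
      using emeasure_mono[OF that(1), of lborel] emeasure_unit_cell_finite by (auto intro: order_le_less_trans)
    show "AE x in lborel. x \<in> S \<longrightarrow> norm (f x) \<le> M" using M by auto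
  qed (use that in auto)
  let ?g = "\<lambda>x. indicator ?A x *\<^sub>R f x"
  have shift_eq: "indicator ?A (- ?e + x) *\<^sub>R f x = ?g (- ?e + x)" for x
    using integer_periodicD[OF per, of "?e" "- ?e + x"] by (simp add: axis_def)
  have intA': "integrable lborel (\<lambda>x. indicator ?A (- ?e + x) *\<^sub>R f x)"
    unfolding shift_eq
  proof -
    have "integrable (distr lborel borel ((+) (- ?e))) ?g"
      unfolding lborel_distr_plus by (rule int) auto
    then show "integrable lborel (\<lambda>x. ?g (- ?e + x))"
      by (subst (asm) integrable_distr_eq) auto
  qed
  have eqA': "(\<integral>x. indicator ?A (- ?e + x) *\<^sub>R f x \<partial>lborel) = (\<integral>x. ?g x \<partial>lborel)"
    unfolding shift_eq by (rule integral_lborel_translate) measurable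
  \<comment> \<open>The shifted cell arises from the cell by removing the slab \<open>?A\<close> and
    adding its translate by one period; the half-open faces make this exact. Periodicity gives both
    slabs the same integral.\<close>
  have split: "indicator ?C (- (s *\<^sub>R ?e) + x) *\<^sub>R f x = indicator ?C x *\<^sub>R f x - indicator ?A x *\<^sub>R f x + indicator ?A (- ?e + x) *\<^sub>R f x" for x
  proof -
    let ?O = "\<forall>j. j \<noteq> i \<longrightarrow> 0 \<le> x $ j \<and> x $ j < 1"
    have all: "(\<forall>j. P j) \<longleftrightarrow> P i \<and> (\<forall>j. j \<noteq> i \<longrightarrow> P j)" for P by metis
    have "- (s *\<^sub>R ?e) + x \<in> ?C \<longleftrightarrow> ?O \<and> s \<le> x $ i \<and> x $ i < 1 + s"
      unfolding unit_cell_def by (subst mem_Collect_eq, subst all) (auto simp: axis_def)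
    moreover have "x \<in> ?C \<longleftrightarrow> ?O \<and> 0 \<le> x $ i \<and> x $ i < 1"
      unfolding unit_cell_def by (subst mem_Collect_eq, subst all) auto
    moreover have "- ?e + x \<in> ?C \<longleftrightarrow> ?O \<and> 1 \<le> x $ i \<and> x $ i < 2"
      unfolding unit_cell_def by (subst mem_Collect_eq, subst all) (auto simp: axis_def)
    moreover have "(- ?e + x) $ i = x $ i - 1" by (simp add: axis_def)
    ultimately show ?thesis using s by (auto simp: indicator_def)
  qed
  have "(\<integral>x. f (x + s *\<^sub>R ?e) \<partial>cell_lebesgue) = (\<integral>x. indicator ?C x *\<^sub>R f (x + s *\<^sub>R ?e) \<partial>lborel)"
    by (rule integral_restrict_space) simp
  also have "\<dots> = (\<integral>x. (\<lambda>y. indicator ?C (- (s *\<^sub>R ?e) + y) *\<^sub>R f y) (s *\<^sub>R ?e + x) \<partial>lborel)"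
    by (simp add: add.commute)
  also have "\<dots> = (\<integral>x. indicator ?C (- (s *\<^sub>R ?e) + x) *\<^sub>R f x \<partial>lborel)"
    by (rule integral_lborel_translate) measurable
  also have "\<dots> = (\<integral>x. indicator ?C x *\<^sub>R f x \<partial>lborel)"
  proof -
    have iC: "integrable lborel (\<lambda>x. indicator ?C x *\<^sub>R f x)" and iA: "integrable lborel ?g"
      by (rule int, simp, simp)+
    show ?thesis
      unfolding split Bochner_Integration.integral_add[OF Bochner_Integration.integrable_diff[OF iC iA] intA']
        Bochner_Integration.integral_diff[OF iC iA] eqA' by simp
  qed
  also have "\<dots> = (\<integral>x. f x \<partial>cell_lebesgue)"
    by (rule integral_restrict_space[symmetric]) simp
  finally show ?thesis .
qed

text \<open>The integrals of the difference quotients vanish by translation invariance. The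
  quotients converge to \<open>f'\<close> pointwise, and by the mean value theorem they are
  dominated by a bound of \<open>f'\<close>.\<close>

lemma integral_cell_partial:
  fixes f :: "real ^ 'n::finite \<Rightarrow> real"
  assumes per: "integer_periodic f" and cont: "continuous_on UNIV f"
    and der: "has_partial i f f'" and cont': "continuous_on UNIV f'"
  shows "(\<integral>x. f' x \<partial>cell_lebesgue) = 0"
proof -
  let ?e = "axis i 1 :: real ^ 'n"
  define s where "s = (\<lambda>n. 1 / real (n + 2))"
  have s: "0 < s n" "s n \<le> 1" for n by (simp_all add: s_def)
  have s0: "s \<longlonglongrightarrow> 0" unfolding s_def by (rule LIMSEQ_ignore_initial_segment[OF lim_1_over_n])
  define q where "q = (\<lambda>n x. (f (x + s n *\<^sub>R ?e) - f x) / s n)"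
  obtain M where M: "\<And>x. \<bar>f' x\<bar> \<le> M"
    using integer_periodic_bounded[OF has_partial_periodic[OF der per] cont'] by blast
  have cs: "continuous_on UNIV (\<lambda>x. f (x + s n *\<^sub>R ?e))" for n
    by (intro continuous_on_compose2[OF cont] continuous_intros) auto
  have cq: "continuous_on UNIV (q n)" for n
    unfolding q_def using s[of n] by (intro continuous_intros cs cont) auto
  have "(\<lambda>n. \<integral>x. q n x \<partial>cell_lebesgue) \<longlonglongrightarrow> (\<integral>x. f' x \<partial>cell_lebesgue)"
  proof (rule integral_dominated_convergence)
    show "f' \<in> borel_measurable cell_lebesgue" "q n \<in> borel_measurable cell_lebesgue" for n
      using cq cont' by (auto intro: measurable_cell)
    show "integrable cell_lebesgue (\<lambda>x :: real ^ 'n. M)" by (intro integrable_cell continuous_intros)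
    show "AE x in cell_lebesgue. (\<lambda>n. q n x) \<longlonglongrightarrow> f' x"
    proof (rule AE_I2)
      fix x
      have "((\<lambda>h. (f (x + (0 + h) *\<^sub>R ?e) - f (x + 0 *\<^sub>R ?e)) / h) \<longlongrightarrow> f' x) (at 0)"
        using der unfolding has_partial_def DERIV_def by blast
      moreover have "filterlim s (at 0) sequentially"
        using s0 s(1) by (auto simp: filterlim_at less_imp_neq[symmetric])
      ultimately have "((\<lambda>n. (f (x + (0 + s n) *\<^sub>R ?e) - f (x + 0 *\<^sub>R ?e)) / s n) \<longlongrightarrow> f' x) sequentially"
        by (rule filterlim_compose)
      then show "(\<lambda>n. q n x) \<longlonglongrightarrow> f' x" by (simp add: q_def)
    qed
    show "AE x in cell_lebesgue. norm (q n x) \<le> M" for n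
    proof (rule AE_I2)
      fix x
      have "\<exists>z. 0 < z \<and> z < s n \<and> f (x + s n *\<^sub>R ?e) - f (x + 0 *\<^sub>R ?e) = (s n - 0) * f' (x + z *\<^sub>R ?e)"
        using s by (intro MVT2 has_partial_line der) auto
      then obtain z where "f (x + s n *\<^sub>R ?e) - f x = s n * f' (x + z *\<^sub>R ?e)" by auto
      then have "q n x = f' (x + z *\<^sub>R ?e)" using s(1)[of n] by (simp add: q_def)
      then show "norm (q n x) \<le> M" using M by simp
    qed
  qed
  moreover have "(\<integral>x. q n x \<partial>cell_lebesgue) = 0" for n
  proof -
    have "(\<integral>x. q n x \<partial>cell_lebesgue) = ((\<integral>x. f (x + s n *\<^sub>R ?e) \<partial>cell_lebesgue) - (\<integral>x. f x \<partial>cell_lebesgue)) / s n"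
      unfolding q_def by (simp add: integrable_cell cs cont)
    then show ?thesis using s[of n] by (simp add: integral_cell_translate[OF per cont])
  qed
  ultimately show ?thesis by (simp add: LIMSEQ_const_iff)
qed

subsection \<open>Bounds for the ground state energy\<close>

lemma integral_cell_nonpos_of_divergence_le:
  fixes \<Phi> :: "'n \<Rightarrow> real ^ 'n::finite \<Rightarrow> real"
  assumes "\<And>i. integer_periodic (\<Phi> i)" "\<And>i. continuous_on UNIV (\<Phi> i)"
    and "\<And>i. has_partial i (\<Phi> i) (\<Phi>' i)" and c: "\<And>i. continuous_on UNIV (\<Phi>' i)"
    and cg: "continuous_on UNIV g" and le: "\<And>x. g x \<le> (\<Sum>i\<in>UNIV. \<Phi>' i x)"
  shows "(\<integral>x. g x \<partial>cell_lebesgue) \<le> 0"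
proof -
  have "(\<integral>x. g x \<partial>cell_lebesgue) \<le> (\<integral>x. (\<Sum>i\<in>UNIV. \<Phi>' i x) \<partial>cell_lebesgue)"
    by (intro integral_mono integrable_cell continuous_intros cg c le)
  also have "\<dots> = (\<Sum>i\<in>UNIV. \<integral>x. \<Phi>' i x \<partial>cell_lebesgue)"
    by (intro Bochner_Integration.integral_sum integrable_cell c)
  also have "\<dots> = 0" using integral_cell_partial assms by (intro sum.neutral) blast
  finally show ?thesis .
qed

context
  fixes V :: "real ^ 'n::finite \<Rightarrow> real" and \<psi> :: "real ^ 'n \<Rightarrow> real" and h E :: real
  assumes contV: "continuous_on UNIV V" and ef: "is_eigenfunction h V E \<psi>" and h: "h > 0"
begin

private abbreviation "p i \<equiv> partial i \<psi>"
private abbreviation "q i \<equiv> partial i (partial i \<psi>)"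

private lemma eigenfunction_regularity:
  shows "integer_periodic \<psi>" "integer_periodic (p i)" "continuous_on UNIV \<psi>" "continuous_on UNIV (p i)"
    "continuous_on UNIV (q i)" "has_partial i \<psi> (p i)" "has_partial i (p i) (q i)"
proof -
  have C: "C_class 2 \<psi>" and per: "integer_periodic \<psi>" using ef by (auto simp: is_eigenfunction_def)
  then have d: "\<psi> differentiable_on UNIV" "p i differentiable_on UNIV" "continuous_on UNIV (q i)"
    by (auto simp: numeral_2_eq_2)
  then show "integer_periodic \<psi>" "integer_periodic (p i)" "continuous_on UNIV \<psi>" "continuous_on UNIV (p i)"
    "continuous_on UNIV (q i)" "has_partial i \<psi> (p i)" "has_partial i (p i) (q i)"
    using per by (auto intro: integer_periodic_partial has_partial_partial differentiable_imp_continuous_on)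
qed

private lemma eigenfunction_equation: "h\<^sup>2 / 2 * (\<Sum>i\<in>UNIV. q i x) = (V x - E) * \<psi> x"
proof -
  have "schroedinger h V \<psi> x = E * \<psi> x" using ef by (auto simp: is_eigenfunction_def)
  then show ?thesis by (simp add: schroedinger_def laplacian_def algebra_simps)
qed

text \<open>The integrand differs from a divergence by \<open>\<bar>h \<nabla>\<psi> + \<psi> G\<bar>\<^sup>2 / 2\<close>.\<close>

lemma energy_lower_bound:
  fixes G D :: "'n \<Rightarrow> real ^ 'n \<Rightarrow> real"
  assumes G: "\<And>i. integer_periodic (G i)" "\<And>i. continuous_on UNIV (G i)"
    "\<And>i. has_partial i (G i) (D i)" "\<And>i. continuous_on UNIV (D i)"
  shows "(\<integral>x. (V x - (\<Sum>i\<in>UNIV. (G i x)\<^sup>2) / 2 + h / 2 * (\<Sum>i\<in>UNIV. D i x) - E) * (\<psi> x)\<^sup>2 \<partial>cell_lebesgue) \<le> 0"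
proof (rule integral_cell_nonpos_of_divergence_le)
  let ?\<Phi> = "\<lambda>i x. h\<^sup>2 / 2 * (\<psi> x * p i x) + h / 2 * (G i x * (\<psi> x)\<^sup>2)"
  let ?\<Phi>' = "\<lambda>i x. h\<^sup>2 / 2 * (p i x * p i x + \<psi> x * q i x) + h / 2 * (D i x * (\<psi> x)\<^sup>2 + G i x * (2 * \<psi> x * p i x))"
  note r = eigenfunction_regularity
  show "integer_periodic (?\<Phi> i)" for i
    using r(1) r(2)[of i] G(1)[of i] by (simp add: integer_periodic_def)
  show "continuous_on UNIV (?\<Phi> i)" "continuous_on UNIV (?\<Phi>' i)" for i by (intro continuous_intros r G)+
  show "has_partial i (?\<Phi> i) (?\<Phi>' i)" for i
    by (intro has_partial_add has_partial_cmult has_partial_mult has_partial_power2 r G)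
  show "continuous_on UNIV (\<lambda>x. (V x - (\<Sum>i\<in>UNIV. (G i x)\<^sup>2) / 2 + h / 2 * (\<Sum>i\<in>UNIV. D i x) - E) * (\<psi> x)\<^sup>2)"
    by (intro continuous_intros r G contV) auto
  fix x
  have "(\<Sum>i\<in>UNIV. ?\<Phi>' i x) = \<psi> x * (h\<^sup>2 / 2 * (\<Sum>i\<in>UNIV. q i x)) + h / 2 * (\<Sum>i\<in>UNIV. D i x) * (\<psi> x)\<^sup>2
      + (\<Sum>i\<in>UNIV. h\<^sup>2 / 2 * (p i x * p i x) + h / 2 * (G i x * (2 * \<psi> x * p i x)))"
    by (simp add: sum.distrib sum_distrib_left sum_distrib_right algebra_simps)
  \<comment> \<open>Completing the square in h \<nabla>\<psi> + \<psi> G; the correction -|G|^2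
    \<psi>^2 / 2 is the price of the free choice of \<open>G\<close>.\<close>
  also have "(\<Sum>i\<in>UNIV. h\<^sup>2 / 2 * (p i x * p i x) + h / 2 * (G i x * (2 * \<psi> x * p i x)))
      = (\<Sum>i\<in>UNIV. (h * p i x + G i x * \<psi> x)\<^sup>2 / 2 - (G i x)\<^sup>2 * (\<psi> x)\<^sup>2 / 2)"
    by (intro sum.cong) (auto simp: power2_eq_square field_simps)
  also have "\<dots> = (\<Sum>i\<in>UNIV. (h * p i x + G i x * \<psi> x)\<^sup>2 / 2) - (\<Sum>i\<in>UNIV. (G i x)\<^sup>2) / 2 * (\<psi> x)\<^sup>2"
    by (simp add: sum_subtractf sum_distrib_right sum_divide_distrib)
  finally have "(\<Sum>i\<in>UNIV. ?\<Phi>' i x) = (V x - (\<Sum>i\<in>UNIV. (G i x)\<^sup>2) / 2 + h / 2 * (\<Sum>i\<in>UNIV. D i x) - E) * (\<psi> x)\<^sup>2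
      + (\<Sum>i\<in>UNIV. (h * p i x + G i x * \<psi> x)\<^sup>2 / 2)"
    unfolding eigenfunction_equation by (simp add: power2_eq_square algebra_simps)
  moreover have "0 \<le> (\<Sum>i\<in>UNIV. (h * p i x + G i x * \<psi> x)\<^sup>2 / 2)" by (intro sum_nonneg) auto
  ultimately show "(V x - (\<Sum>i\<in>UNIV. (G i x)\<^sup>2) / 2 + h / 2 * (\<Sum>i\<in>UNIV. D i x) - E) * (\<psi> x)\<^sup>2 \<le> (\<Sum>i\<in>UNIV. ?\<Phi>' i x)"
    by linarith
qed

text \<open>With \<open>w = exp (- 2 f / h)\<close> and \<open>F = \<nabla>\<psi> / \<psi>\<close>, the integrand is the divergence of
  \<open>- h\<^sup>2/2 w F - \<mu> h/2 w \<nabla>f\<close> minus \<open>w \<bar>h F + \<nabla>f\<bar>\<^sup>2 / 2\<close>.\<close>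

lemma energy_upper_bound:
  fixes f :: "real ^ 'n \<Rightarrow> real" and f1 f2 :: "'n \<Rightarrow> real ^ 'n \<Rightarrow> real"
  assumes pos: "\<And>x. \<psi> x > 0" and f: "integer_periodic f" "continuous_on UNIV f"
    and f1: "\<And>i. has_partial i f (f1 i)" "\<And>i. continuous_on UNIV (f1 i)"
    and f2: "\<And>i. has_partial i (f1 i) (f2 i)" "\<And>i. continuous_on UNIV (f2 i)"
  shows "(\<integral>x. (E - V x + (\<mu> - 1 / 2) * (\<Sum>i\<in>UNIV. (f1 i x)\<^sup>2) - \<mu> * h / 2 * (\<Sum>i\<in>UNIV. f2 i x))
    * exp (- 2 / h * f x) \<partial>cell_lebesgue) \<le> 0"
proof -
  note reg = eigenfunction_regularity
  \<comment> \<open>Positivity of the eigenfunction permits this division, which takes the place of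
    a variational characterization of \<open>E\<close>.\<close>
  define R where "R = (\<lambda>x. inverse (\<psi> x))"
  have n0: "\<psi> x \<noteq> 0" for x using pos[of x] by simp
  have cR: "continuous_on UNIV R" unfolding R_def using n0 by (intro continuous_intros reg) auto
  have per1: "integer_periodic (f1 i)" for i using has_partial_periodic f1 f by blast
  let ?w = "\<lambda>x. exp (- 2 / h * f x)"
  let ?w' = "\<lambda>i x. ?w x * (- 2 / h * f1 i x)"
  let ?r' = "\<lambda>i x. - (R x * p i x * R x)"
  \<comment> \<open>The second summand is a divergence on its own, so \<open>\<mu>\<close> is free.
    For \<open>\<mu> = 0\<close> the result is the Rayleigh bound with the trial function
    \<open>exp (- f / h)\<close>; for \<open>\<mu> = 1\<close> the gradient and potential terms
    cancel when V = |\<nabla>f|^2 / 2, leaving h/2 times the Laplacian of \<open>f\<close>.\<close>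
  let ?\<Phi> = "\<lambda>i x. - (h\<^sup>2 / 2) * (?w x * (p i x * R x)) + (- (\<mu> * h / 2)) * (?w x * f1 i x)"
  let ?\<Phi>' = "\<lambda>i x. - (h\<^sup>2 / 2) * (?w' i x * (p i x * R x) + ?w x * (q i x * R x + p i x * ?r' i x))
    + (- (\<mu> * h / 2)) * (?w' i x * f1 i x + ?w x * f2 i x)"
  show ?thesis
  proof (rule integral_cell_nonpos_of_divergence_le)
    show "integer_periodic (?\<Phi> i)" for i
      using reg(1) reg(2)[of i] f(1) per1[of i] by (simp add: integer_periodic_def R_def)
    show "continuous_on UNIV (?\<Phi> i)" "continuous_on UNIV (?\<Phi>' i)" for i
      by (intro continuous_intros reg f f1 f2 cR)+
    have w': "has_partial i ?w (?w' i)" for i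
      by (intro has_partial_compose[of exp exp] has_partial_cmult f1 DERIV_exp)
    have r': "has_partial i R (?r' i)" for i
      unfolding has_partial_def
    proof
      fix x
      have "((\<lambda>s. \<psi> (x + s *\<^sub>R axis i 1)) has_real_derivative p i x) (at 0)"
        using reg(6) by (auto simp: has_partial_def)
      from DERIV_inverse'[OF this] show "((\<lambda>s. R (x + s *\<^sub>R axis i 1)) has_real_derivative ?r' i x) (at 0)"
        using n0[of x] by (simp add: R_def)
    qed
    show "has_partial i (?\<Phi> i) (?\<Phi>' i)" for i
      by (intro has_partial_add has_partial_cmult has_partial_mult reg r' w' f1 f2)
    show "continuous_on UNIV (\<lambda>x. (E - V x + (\<mu> - 1 / 2) * (\<Sum>i\<in>UNIV. (f1 i x)\<^sup>2) - \<mu> * h / 2 * (\<Sum>i\<in>UNIV. f2 i x)) * ?w x)"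
      by (intro continuous_intros f f1 f2 contV) auto
    fix x
    have "(\<Sum>i\<in>UNIV. ?\<Phi>' i x) = (\<Sum>i\<in>UNIV. - (?w x * R x) * (h\<^sup>2 / 2 * q i x) - \<mu> * h / 2 * ?w x * f2 i x
        + (\<mu> - 1 / 2) * ?w x * (f1 i x)\<^sup>2 + ?w x * (h * p i x * R x + f1 i x)\<^sup>2 / 2)"
    proof (intro sum.cong refl)
      fix i
      have alg: "- (h\<^sup>2 / 2) * (w * K * (P * R) + w * (Q * R + P * (- (R * P * R)))) + (- (\<mu> * h / 2)) * (w * K * F + w * F')
          = - (w * R) * (h\<^sup>2 / 2 * Q) - \<mu> * h / 2 * w * F' + (\<mu> - 1 / 2) * w * F\<^sup>2 + w * (h * P * R + F)\<^sup>2 / 2"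
        if "h * K = - 2 * F" for w K P R Q F F'
        using that by algebra
      show "?\<Phi>' i x = - (?w x * R x) * (h\<^sup>2 / 2 * q i x) - \<mu> * h / 2 * ?w x * f2 i x
        + (\<mu> - 1 / 2) * ?w x * (f1 i x)\<^sup>2 + ?w x * (h * p i x * R x + f1 i x)\<^sup>2 / 2"
        using h by (intro alg) simp
    qed
    also have "\<dots> = - (?w x * R x) * (h\<^sup>2 / 2 * (\<Sum>i\<in>UNIV. q i x)) - \<mu> * h / 2 * ?w x * (\<Sum>i\<in>UNIV. f2 i x)
        + (\<mu> - 1 / 2) * ?w x * (\<Sum>i\<in>UNIV. (f1 i x)\<^sup>2) + (\<Sum>i\<in>UNIV. ?w x * (h * p i x * R x + f1 i x)\<^sup>2 / 2)"
      by (simp add: sum.distrib sum_subtractf sum_distrib_left sum_negf)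
    also have "h\<^sup>2 / 2 * (\<Sum>i\<in>UNIV. q i x) = (V x - E) * \<psi> x" by (rule eigenfunction_equation)
    also have "- (?w x * R x) * ((V x - E) * \<psi> x) = (E - V x) * ?w x"
    proof -
      have "R x * \<psi> x = 1" using n0[of x] by (simp add: R_def)
      then show ?thesis by algebra
    qed
    finally have "(\<Sum>i\<in>UNIV. ?\<Phi>' i x) = (E - V x + (\<mu> - 1 / 2) * (\<Sum>i\<in>UNIV. (f1 i x)\<^sup>2) - \<mu> * h / 2 * (\<Sum>i\<in>UNIV. f2 i x)) * ?w x
        + (\<Sum>i\<in>UNIV. ?w x * (h * p i x * R x + f1 i x)\<^sup>2 / 2)"
      by (simp add: algebra_simps)
    moreover have "0 \<le> (\<Sum>i\<in>UNIV. ?w x * (h * p i x * R x + f1 i x)\<^sup>2 / 2)" by (intro sum_nonneg) auto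
    ultimately show "(E - V x + (\<mu> - 1 / 2) * (\<Sum>i\<in>UNIV. (f1 i x)\<^sup>2) - \<mu> * h / 2 * (\<Sum>i\<in>UNIV. f2 i x)) * ?w x \<le> (\<Sum>i\<in>UNIV. ?\<Phi>' i x)"
      by linarith
  qed
qed

end

subsection \<open>Periodic coordinates near a minimum\<close>

text \<open>Integer-periodic substitutes for the coordinates and, up to the factor \<open>\<pi>\<^sup>2\<close>, for the squared
  distance to the integer lattice.\<close>

definition sine_coords :: "real ^ 'n::finite \<Rightarrow> real ^ 'n" where
  "sine_coords y = (\<chi> i. sin (2 * pi * y $ i) / (2 * pi))"

definition lattice_gap :: "real ^ 'n::finite \<Rightarrow> real" where
  "lattice_gap y = (\<Sum>i\<in>UNIV. (sin (pi * y $ i))\<^sup>2)"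

lemma sine_coords_periodic: "integer_periodic sine_coords"
  unfolding integer_periodic_def
proof (intro allI impI)
  fix x k :: "real ^ 'n" assume k: "\<forall>i. k $ i \<in> \<int>"
  have "sin (2 * pi * (x + k) $ i) = sin (2 * pi * x $ i)" for i
    using k by (simp add: distrib_left sin_add sin_integer_2pi cos_integer_2pi)
  then show "sine_coords (x + k) = sine_coords x" by (simp add: sine_coords_def)
qed

lemma lattice_gap_periodic: "integer_periodic lattice_gap"
  unfolding integer_periodic_def
proof (intro allI impI)
  fix x k :: "real ^ 'n" assume k: "\<forall>i. k $ i \<in> \<int>"
  have "(sin (pi * (x + k) $ i))\<^sup>2 = (sin (pi * x $ i))\<^sup>2" for i
  proof -
    have s: "sin (pi * k $ i) = 0" using k by (auto simp: sin_zero_iff_int2 Ints_def mult.commute[of pi])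
    then have "(cos (pi * k $ i))\<^sup>2 = 1" using sin_cos_squared_add[of "pi * k $ i"] by simp
    then show ?thesis using s by (simp add: distrib_left sin_add power_mult_distrib)
  qed
  then show "lattice_gap (x + k) = lattice_gap x" by (simp add: lattice_gap_def)
qed

lemma lattice_gap_nonneg: "0 \<le> lattice_gap y"
  unfolding lattice_gap_def by (intro sum_nonneg) auto

lemma lattice_gap_0 [simp]: "lattice_gap 0 = 0" and sine_coords_0 [simp]: "sine_coords 0 = 0"
  by (simp_all add: lattice_gap_def sine_coords_def vec_eq_iff)

lemma lattice_gap_eq_0_iff: "lattice_gap y = 0 \<longleftrightarrow> (\<forall>i. y $ i \<in> \<int>)"
proof -
  have "lattice_gap y = 0 \<longleftrightarrow> (\<forall>i. sin (pi * y $ i) = 0)"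
    unfolding lattice_gap_def by (subst sum_nonneg_eq_0_iff) auto
  also have "\<dots> \<longleftrightarrow> (\<forall>i. y $ i \<in> \<int>)"
    by (auto simp: sin_zero_iff_int2 Ints_def mult.commute[of pi])
  finally show ?thesis .
qed

lemma continuous_on_lattice_gap: "continuous_on A lattice_gap"
  unfolding lattice_gap_def by (intro continuous_intros)

lemma continuous_on_sine_coords: "continuous_on A sine_coords"
  unfolding sine_coords_def by (intro continuous_intros) auto

lemma compact_positive_lower_bound:
  fixes f :: "'a::topological_space \<Rightarrow> real"
  assumes "compact K" "continuous_on K f" "\<And>x. x \<in> K \<Longrightarrow> f x > 0"
  obtains c where "c > 0" "\<And>x. x \<in> K \<Longrightarrow> c \<le> f x"
proof (cases "K = {}")
  case False
  then obtain z where "z \<in> K" "\<forall>x\<in>K. f z \<le> f x"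
    using continuous_attains_inf[OF assms(1) _ assms(2)] by blast
  then show ?thesis using that[of "f z"] assms(3) by blast
qed (use that[of 1] in auto)

text \<open>Turns local statements at the origin into periodic ones. On the centred cube of side 1
  the origin is the only lattice point, so off a small ball \<open>lattice_gap\<close> has a
  positive minimum there; a smaller value forces the reduced point into the ball.\<close>

lemma lattice_gap_local:
  assumes per: "\<And>y k. (\<And>i. k $ i \<in> \<int>) \<Longrightarrow> Q (y + k) = Q (y :: real ^ 'n::finite)"
    and \<delta>: "\<delta> > 0" "\<And>y. norm y < \<delta> \<Longrightarrow> Q y"
  obtains d where "d > 0" "\<And>y. lattice_gap y < d \<Longrightarrow> Q y"
proof -
  let ?K = "cbox (\<chi> i. - 1 / 2) (\<chi> i. 1 / 2) - ball 0 \<delta> :: (real ^ 'n) set"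
  have "compact ?K" by (intro compact_diff) auto
  moreover have "lattice_gap y > 0" if "y \<in> ?K" for y
  proof -
    have "y \<noteq> 0" using that \<delta>(1) by auto
    then obtain i where i: "y $ i \<noteq> 0" by (auto simp: vec_eq_iff)
    have "\<bar>y $ i\<bar> < 1" using that by (auto simp: mem_box_cart dest!: spec[of _ i])
    then have "y $ i \<notin> \<int>" using i by (auto elim!: Ints_cases)
    then have "lattice_gap y \<noteq> 0" by (auto simp: lattice_gap_eq_0_iff)
    then show ?thesis using lattice_gap_nonneg[of y] by simp
  qed
  ultimately obtain d where d: "d > 0" "\<And>y. y \<in> ?K \<Longrightarrow> d \<le> lattice_gap y"
    using compact_positive_lower_bound continuous_on_lattice_gap by blast
  have "Q y" if "lattice_gap y < d" for y
  proof -
    \<comment> \<open>Rounding every coordinate to the nearest integer moves \<open>y\<close> into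
      the centred cube.\<close>
    define k where "k = (\<chi> i. - real_of_int (round (y $ i)))"
    have k: "k $ i \<in> \<int>" for i by (simp add: k_def)
    have "- 1 / 2 \<le> (y + k) $ i \<and> (y + k) $ i \<le> 1 / 2" for i
    proof -
      have "\<bar>real_of_int (round (y $ i)) - y $ i\<bar> \<le> 1 / 2" by (rule of_int_round_abs_le)
      then have "real_of_int (round (y $ i)) - y $ i \<le> 1 / 2 \<and> y $ i - real_of_int (round (y $ i)) \<le> 1 / 2"
        by linarith
      then show ?thesis by (auto simp: k_def)
    qed
    then have "y + k \<in> cbox (\<chi> i. - 1 / 2) (\<chi> i. 1 / 2)" by (simp add: mem_box_cart)
    moreover have "lattice_gap (y + k) < d" using that integer_periodicD[OF lattice_gap_periodic k] by simp
    ultimately have "norm (y + k) < \<delta>" using d(2)[of "y + k"] by force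
    then show ?thesis using \<delta>(2) per[OF k] by blast
  qed
  then show ?thesis using that d(1) by blast
qed

lemma has_partial_component:
  assumes "\<And>t. (g has_real_derivative g' t) (at t)"
  shows "has_partial i (\<lambda>x. g (x $ j)) (\<lambda>x. if j = i then g' (x $ j) else 0)"
proof -
  have "has_partial i (\<lambda>x. x $ j) (\<lambda>x. if j = i then 1 else 0)"
    unfolding has_partial_def by (auto simp: axis_def intro!: derivative_eq_intros)
  from has_partial_compose[OF assms this] show ?thesis
    by (rule has_partial_eq) auto
qed

lemma has_partial_sine_coords:
  "has_partial i (\<lambda>y. a \<bullet> sine_coords y) (\<lambda>y. a $ i * cos (2 * pi * y $ i))"
proof -
  have d: "((\<lambda>t. sin (2 * pi * t) / (2 * pi)) has_real_derivative cos (2 * pi * t)) (at t)" for t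
    by (auto intro!: derivative_eq_intros)
  have "has_partial i (\<lambda>y. \<Sum>j\<in>UNIV. a $ j * (sin (2 * pi * y $ j) / (2 * pi)))
      (\<lambda>y. \<Sum>j\<in>UNIV. a $ j * (if j = i then cos (2 * pi * y $ j) else 0))"
    by (intro has_partial_sum has_partial_cmult has_partial_component d)
  moreover have "(\<Sum>j\<in>UNIV. a $ j * (sin (2 * pi * y $ j) / (2 * pi))) = a \<bullet> sine_coords y" for y
    by (simp add: inner_vec_def sine_coords_def)
  ultimately show ?thesis by (auto intro: has_partial_eq simp: if_distrib cong: if_cong)
qed

lemma has_partial_lattice_gap:
  "has_partial i lattice_gap (\<lambda>y. pi * sin (2 * pi * y $ i))"
proof -
  have d: "((\<lambda>t. (sin (pi * t))\<^sup>2) has_real_derivative pi * sin (2 * pi * t)) (at t)" for t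
    using sin_double[of "pi * t"] by (auto intro!: derivative_eq_intros simp: mult_ac)
  have "has_partial i (\<lambda>y. \<Sum>j\<in>UNIV. (sin (pi * y $ j))\<^sup>2)
      (\<lambda>y. \<Sum>j\<in>UNIV. if j = i then pi * sin (2 * pi * y $ j) else 0)"
    by (intro has_partial_sum has_partial_component d)
  then show ?thesis unfolding lattice_gap_def by (rule has_partial_eq) simp
qed

lemma has_partial_translate: "has_partial i f f' \<Longrightarrow> has_partial i (\<lambda>x. f (x - m)) (\<lambda>x. f' (x - m))"
  unfolding has_partial_def by (simp add: diff_add_eq[symmetric])

lemma integer_periodic_translate: "integer_periodic f \<Longrightarrow> integer_periodic (\<lambda>x. f (x - m))"
  unfolding integer_periodic_def by (simp add: diff_add_eq[symmetric])

text \<open>The difference of squares factors into a difference of norms, o(|y|) by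
  differentiability, and a sum of norms, O(|y|).\<close>

lemma norm_power2_linearization:
  fixes F :: "real ^ 'n::finite \<Rightarrow> real ^ 'n" and A :: "real ^ 'n ^ 'n"
  assumes F: "(F has_derivative (\<lambda>y. A *v y)) (at 0)" "F 0 = 0" and e: "e > 0"
  obtains d where "d > 0" "\<And>y. norm y < d \<Longrightarrow> \<bar>(norm (F y))\<^sup>2 - (norm (A *v y))\<^sup>2\<bar> \<le> e * (norm y)\<^sup>2"
proof -
  obtain K where K: "K > 0" "\<And>y. norm (A *v y) \<le> K * norm y"
    using linear_bounded_pos[of "\<lambda>y. A *v y"] by auto
  \<comment> \<open>The cap 1 bounds \<open>norm (F y)\<close> by \<open>(K + 1) * norm y\<close>,
    so that the sum of the norms is at most \<open>(2 * K + 1) * norm y\<close>.\<close>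
  define e' where "e' = min 1 (e / (2 * K + 1))"
  have e': "e' > 0" "e' \<le> 1" "e' * (2 * K + 1) \<le> e"
    using e K pos_le_divide_eq[of "2 * K + 1" e' e] by (auto simp: e'_def)
  obtain d where d: "d > 0" "\<And>y. norm y < d \<Longrightarrow> norm (F y - A *v y) \<le> e' * norm y"
    using F e'(1) unfolding has_derivative_at_alt by fastforce
  show ?thesis
  proof (rule that[OF d(1)])
    fix y :: "real ^ 'n" assume y: "norm y < d"
    have 1: "\<bar>norm (F y) - norm (A *v y)\<bar> \<le> e' * norm y"
      using norm_triangle_ineq3[of "F y" "A *v y"] d(2)[OF y] by linarith
    have "e' * norm y \<le> norm y" using e' by (simp add: mult_left_le_one_le)
    then have 2: "norm (F y) + norm (A *v y) \<le> (2 * K + 1) * norm y"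
      using 1 K(2)[of y] by (simp add: algebra_simps)
    have "\<bar>(norm (F y))\<^sup>2 - (norm (A *v y))\<^sup>2\<bar> = \<bar>norm (F y) - norm (A *v y)\<bar> * (norm (F y) + norm (A *v y))"
      unfolding square_diff_square_factored power2_eq_square abs_mult by (simp add: mult.commute)
    also have "\<dots> \<le> (e' * norm y) * ((2 * K + 1) * norm y)"
      using 1 2 by (intro mult_mono) auto
    also have "\<dots> = e' * (2 * K + 1) * (norm y)\<^sup>2" by (simp add: power2_eq_square)
    also have "\<dots> \<le> e * (norm y)\<^sup>2" using e' by (intro mult_right_mono) auto
    finally show "\<bar>(norm (F y))\<^sup>2 - (norm (A *v y))\<^sup>2\<bar> \<le> e * (norm y)\<^sup>2" .
  qed
qed

text \<open>Collects what is used of the positive square root of the Hessian. The relation A^2 =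
  Hess is recorded through quadratic forms, the shape in which Taylor expansion supplies it; the
  trace condition is the only link to the flow.\<close>

definition hessian_root :: "(real ^ 'n::finite \<Rightarrow> real) \<Rightarrow> real ^ 'n \<Rightarrow> real ^ 'n ^ 'n \<Rightarrow> bool" where
  "hessian_root V m A \<longleftrightarrow> (\<forall>i j. A $ i $ j = A $ j $ i) \<and> (\<forall>y. 0 \<le> y \<bullet> (A *v y)) \<and>
    (\<forall>y. (norm (A *v y))\<^sup>2 = y \<bullet> (hessian V m *v y)) \<and> (\<exists>c>0. \<forall>y. c * norm y \<le> norm (A *v y)) \<and>
    (\<Sum>i\<in>UNIV. A $ i $ i) = sum_nonneg_lyapunov (flow V) (m, 0)"

text \<open>The root is assembled from the orthonormal eigenbasis as the sum of the rank-one
  matrices \<open>l b * (b $ i * b $ j)\<close>. Each of these has trace \<open>l b\<close>, so the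
  trace is the sum of the rates.\<close>

lemma hessian_root_exists:
  fixes V :: "real ^ 'n::finite \<Rightarrow> real"
  assumes per: "integer_periodic V" and C: "C_class 2 V" and m: "is_minimum V m"
    and inv: "invertible (hessian V m)"
  shows "\<exists>A. hessian_root V m A"
proof -
  let ?H = "\<lambda>y. hessian V m *v y"
  obtain B l where B: "finite B" "pairwise orthogonal B" "\<And>b. b \<in> B \<Longrightarrow> norm b = 1" "span B = UNIV"
    and l: "\<And>b. b \<in> B \<Longrightarrow> l b > (0::real)" and H: "\<And>b. b \<in> B \<Longrightarrow> ?H b = (l b)\<^sup>2 *\<^sub>R b"
    by (rule nondegenerate_minimum_eigenbasis[OF C m inv]) blast
  define A :: "real ^ 'n ^ 'n" where "A = (\<chi> i j. \<Sum>b\<in>B. l b * (b $ i * b $ j))"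
  have Av: "A *v y = (\<Sum>b\<in>B. (l b * (b \<bullet> y)) *\<^sub>R b)" for y
  proof -
    have "(A *v y) $ i = (\<Sum>b\<in>B. (l b * (b \<bullet> y)) *\<^sub>R b) $ i" for i
    proof -
      have "(A *v y) $ i = (\<Sum>j\<in>UNIV. \<Sum>b\<in>B. l b * (b $ i * b $ j) * y $ j)"
        by (simp add: matrix_vector_mult_def A_def sum_distrib_right)
      also have "\<dots> = (\<Sum>b\<in>B. \<Sum>j\<in>UNIV. l b * (b $ i * b $ j) * y $ j)" by (rule sum.swap)
      also have "\<dots> = (\<Sum>b\<in>B. (l b * (b \<bullet> y)) * b $ i)"
        by (simp add: inner_vec_def sum_distrib_left sum_distrib_right mult_ac)
      finally show ?thesis by simp
    qed
    then show ?thesis by (simp add: vec_eq_iff)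
  qed
  have Ab: "A *v b = l b *\<^sub>R b" if b: "b \<in> B" for b
  proof -
    have "A *v b = (\<Sum>a\<in>B. if a = b then l a *\<^sub>R a else 0)"
      unfolding Av using B(2,3) b
      by (intro sum.cong) (auto simp: pairwise_def orthogonal_def dot_square_norm)
    then show ?thesis using B(1) b by simp
  qed
  have AA: "A *v (A *v y) = ?H y" for y
  proof (rule linear_eq_on[where f = "\<lambda>y. A *v (A *v y)" and g = ?H and B = B])
    show "linear (\<lambda>y. A *v (A *v y))"
      using linear_compose[of "\<lambda>y. A *v y" "\<lambda>y. A *v y"] by (simp add: o_def)
    show "y \<in> span B" using B(4) by simp
    show "A *v (A *v b) = ?H b" if "b \<in> B" for b
      using Ab[OF that] H[OF that] by (simp add: matrix_vector_mult_scaleR power2_eq_square)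
  qed auto
  have sym: "A $ i $ j = A $ j $ i" for i j by (simp add: A_def mult.commute[of "_ $ i"])
  have sa: "(A *v x) \<bullet> y = x \<bullet> (A *v y)" for x y
    unfolding Av inner_sum_left inner_sum_right by (intro sum.cong) (auto simp: inner_commute)
  have pos: "0 \<le> y \<bullet> (A *v y)" for y
  proof -
    have "y \<bullet> (A *v y) = (\<Sum>b\<in>B. l b * (b \<bullet> y)\<^sup>2)"
      unfolding Av inner_sum_right by (intro sum.cong) (auto simp: inner_commute power2_eq_square)
    also have "\<dots> \<ge> 0" using l by (intro sum_nonneg) (simp add: less_imp_le)
    finally show ?thesis .
  qed
  have nrm: "(norm (A *v y))\<^sup>2 = y \<bullet> ?H y" for y
    using sa[of y "A *v y"] by (simp add: AA dot_square_norm)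
  have "inj (\<lambda>y. A *v y)"
  proof (rule injI)
    fix x y assume "A *v x = A *v y"
    then have "?H x = ?H y" by (simp flip: AA)
    then show "x = y" using inv by (simp add: inj_matrix_vector_mult inj_eq)
  qed
  then obtain c where c: "c > 0" "\<And>y. c * norm y \<le> norm (A *v y)"
    using linear_inj_bounded_below_pos[of "\<lambda>y. A *v y"] by auto
  have "(\<Sum>i\<in>UNIV. A $ i $ i) = (\<Sum>b\<in>B. l b * (norm b)\<^sup>2)"
    unfolding A_def power2_norm_eq_inner inner_vec_def
    by (simp add: sum_distrib_left) (rule sum.swap)
  also have "\<dots> = sum l B" using B(3) by simp
  also have "\<dots> = sum_nonneg_lyapunov (flow V) (m, 0)"
    using sum_nonneg_lyapunov_minimum[OF per C m B l H] by simp
  finally show ?thesis using sym pos nrm c unfolding hessian_root_def by blast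
qed

lemma sine_coords_has_derivative: "(sine_coords has_derivative (\<lambda>y. y)) (at 0)"
proof -
  have "((\<lambda>y. sin (2 * pi * y $ i) / (2 * pi)) has_derivative (\<lambda>y. y $ i)) (at (0 :: real ^ 'n))" for i
    by (auto intro!: derivative_eq_intros bounded_linear_imp_has_derivative bounded_linear_vec_nth)
  then show ?thesis
    unfolding sine_coords_def
    by (subst has_derivative_componentwise_within) (auto simp: Basis_vec_def inner_axis)
qed

text \<open>The phase function of the Gaussian trial state at \<open>m\<close>, in terms of \<open>y = x - m\<close>, and its
  first two derivatives in a coordinate direction. The square of \<^const>\<open>lattice_gap\<close> makes it
  vanish on the lattice only.\<close>

definition phase :: "real ^ 'n ^ 'n \<Rightarrow> real ^ 'n::finite \<Rightarrow> real" where
  "phase A y = sine_coords y \<bullet> (A *v sine_coords y) / 2 + (lattice_gap y)\<^sup>2"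

definition phase1 :: "real ^ 'n ^ 'n \<Rightarrow> 'n \<Rightarrow> real ^ 'n::finite \<Rightarrow> real" where
  "phase1 A i y = (A $ i \<bullet> sine_coords y) * cos (2 * pi * y $ i)
     + 2 * lattice_gap y * (pi * sin (2 * pi * y $ i))"

definition phase2 :: "real ^ 'n ^ 'n \<Rightarrow> 'n \<Rightarrow> real ^ 'n::finite \<Rightarrow> real" where
  "phase2 A i y = (A $ i $ i * cos (2 * pi * y $ i)) * cos (2 * pi * y $ i)
     + (A $ i \<bullet> sine_coords y) * (- (2 * pi) * sin (2 * pi * y $ i))
     + (2 * (pi * sin (2 * pi * y $ i)) * (pi * sin (2 * pi * y $ i))
       + 2 * lattice_gap y * (pi * (2 * pi * cos (2 * pi * y $ i))))"

text \<open>The quadratic form is expanded as a sum of products of the shape covered by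
  \<open>has_partial_sine_coords\<close>. Symmetry of \<open>A\<close> makes the two halves of the
  product rule equal, cancelling the factor 1/2.\<close>

lemma has_partial_phase:
  assumes sym: "\<And>i j. A $ i $ j = A $ j $ i"
  shows "has_partial i (phase A) (phase1 A i)"
proof -
  have "has_partial i (\<lambda>y. 1 / 2 * (\<Sum>j\<in>UNIV. (axis j 1 \<bullet> sine_coords y) * (A $ j \<bullet> sine_coords y)) + (lattice_gap y)\<^sup>2)
     (\<lambda>y. 1 / 2 * (\<Sum>j\<in>UNIV. (axis j 1 $ i * cos (2 * pi * y $ i)) * (A $ j \<bullet> sine_coords y)
       + (axis j 1 \<bullet> sine_coords y) * (A $ j $ i * cos (2 * pi * y $ i))) + 2 * lattice_gap y * (pi * sin (2 * pi * y $ i)))"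
    by (intro has_partial_add has_partial_cmult has_partial_sum has_partial_mult has_partial_sine_coords
        has_partial_power2 has_partial_lattice_gap)
  moreover have "(\<lambda>y. 1 / 2 * (\<Sum>j\<in>UNIV. (axis j 1 \<bullet> sine_coords y) * (A $ j \<bullet> sine_coords y)) + (lattice_gap y)\<^sup>2) = phase A"
    by (simp add: fun_eq_iff phase_def inner_vec_def[of "sine_coords _" "A *v _"] matrix_vector_mul_component inner_axis')
  moreover have "1 / 2 * (\<Sum>j\<in>UNIV. (axis j 1 $ i * cos (2 * pi * y $ i)) * (A $ j \<bullet> sine_coords y)
       + (axis j 1 \<bullet> sine_coords y) * (A $ j $ i * cos (2 * pi * y $ i))) = (A $ i \<bullet> sine_coords y) * cos (2 * pi * y $ i)" for y
  proof -
    have "(\<Sum>j\<in>UNIV. (axis j 1 $ i * cos (2 * pi * y $ i)) * (A $ j \<bullet> sine_coords y))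
      = (\<Sum>j\<in>UNIV. if j = i then cos (2 * pi * y $ i) * (A $ j \<bullet> sine_coords y) else 0)"
      by (intro sum.cong) (auto simp: axis_def)
    moreover have "(\<Sum>j\<in>UNIV. (axis j 1 \<bullet> sine_coords y) * (A $ j $ i * cos (2 * pi * y $ i)))
      = (A $ i \<bullet> sine_coords y) * cos (2 * pi * y $ i)"
      unfolding inner_vec_def[of "A $ i"] sum_distrib_right
      by (intro sum.cong) (simp_all add: sym[of i] inner_axis')
    ultimately show ?thesis by (simp add: sum.distrib mult.commute)
  qed
  ultimately show ?thesis by (auto intro: has_partial_eq simp: phase1_def)
qed

lemma has_partial_phase1: "has_partial i (phase1 A i) (phase2 A i)"
proof -
  have c: "((\<lambda>t. cos (2 * pi * t)) has_real_derivative - (2 * pi) * sin (2 * pi * t)) (at t)"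
    and s: "((\<lambda>t. pi * sin (2 * pi * t)) has_real_derivative pi * (2 * pi * cos (2 * pi * t))) (at t)" for t
    by (auto intro!: derivative_eq_intros)
  have c': "has_partial i (\<lambda>y. cos (2 * pi * y $ i)) (\<lambda>y. - (2 * pi) * sin (2 * pi * y $ i))"
    by (rule has_partial_eq[OF has_partial_component[OF c]]) simp
  have s': "has_partial i (\<lambda>y. pi * sin (2 * pi * y $ i)) (\<lambda>y. pi * (2 * pi * cos (2 * pi * y $ i)))"
    by (rule has_partial_eq[OF has_partial_component[OF s]]) simp
  show ?thesis
    unfolding phase1_def phase2_def
    by (intro has_partial_add has_partial_mult has_partial_cmult has_partial_sine_coords has_partial_lattice_gap c' s')
qed

lemma continuous_on_phase: "continuous_on S (phase A)" "continuous_on S (phase1 A i)" "continuous_on S (phase2 A i)"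
proof -
  have "continuous_on UNIV ((*v) A)" by (simp add: linear_continuous_on linear_conv_bounded_linear[symmetric])
  then show "continuous_on S (phase A)"
    unfolding phase_def
    by (intro continuous_intros continuous_on_sine_coords continuous_on_lattice_gap continuous_on_compose2[of UNIV "(*v) A"]) auto
  show "continuous_on S (phase1 A i)" "continuous_on S (phase2 A i)"
    unfolding phase1_def phase2_def
    by (intro continuous_intros continuous_on_sine_coords continuous_on_lattice_gap)+
qed

lemma phase_periodic: "integer_periodic (phase A)"
  by (simp add: integer_periodic_def phase_def integer_periodicD[OF sine_coords_periodic] integer_periodicD[OF lattice_gap_periodic])

text \<open>At the origin the gradient of the phase behaves like that of the pure quadratic form:
  the term from \<open>lattice_gap\<close> is a product of two factors vanishing there, and the
  cosine is stationary.\<close>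

lemma phase1_has_derivative:
  fixes A :: "real ^ 'n::finite ^ 'n"
  shows
  "((\<lambda>y. \<chi> i. phase1 A i y) has_derivative (\<lambda>y. A *v y)) (at 0)"
proof -
  have "(phase1 A i has_derivative (\<lambda>y. (A *v y) $ i)) (at 0)" for i
  proof -
    have S: "((\<lambda>y. A $ i \<bullet> sine_coords y) has_derivative (\<lambda>y. A $ i \<bullet> y)) (at 0)"
      by (intro has_derivative_inner_right sine_coords_has_derivative)
    have "((\<lambda>y. cos (2 * pi * y $ i)) has_derivative (\<lambda>y. 0)) (at (0 :: real ^ 'n))"
      by (auto intro!: derivative_eq_intros bounded_linear_imp_has_derivative bounded_linear_vec_nth)
    from has_derivative_mult[OF S this]
    have 1: "((\<lambda>y. (A $ i \<bullet> sine_coords y) * cos (2 * pi * y $ i)) has_derivative (\<lambda>y. A $ i \<bullet> y)) (at 0)"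
      by simp
    have g: "((\<lambda>y. lattice_gap y) has_derivative (\<lambda>y. 0)) (at (0 :: real ^ 'n))"
      unfolding lattice_gap_def
      by (auto intro!: derivative_eq_intros bounded_linear_imp_has_derivative bounded_linear_vec_nth)
    have s: "((\<lambda>y. 2 * (pi * sin (2 * pi * y $ i))) has_derivative (\<lambda>y. 2 * (pi * (2 * pi * y $ i)))) (at (0 :: real ^ 'n))"
      by (auto intro!: derivative_eq_intros bounded_linear_imp_has_derivative bounded_linear_vec_nth)
    from has_derivative_mult[OF g s]
    have 2: "((\<lambda>y. lattice_gap y * (2 * (pi * sin (2 * pi * y $ i)))) has_derivative (\<lambda>y. 0)) (at (0 :: real ^ 'n))"
      by simp
    from has_derivative_add[OF 1 2] show ?thesis
      by (simp add: phase1_def[abs_def] matrix_vector_mul_component mult_ac)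
  qed
  then show ?thesis
    by (subst has_derivative_componentwise_within) (auto simp: Basis_vec_def inner_axis)
qed

section \<open>Comparison of the potential with its quadratic model\<close>

context
  fixes V :: "real ^ 'n::finite \<Rightarrow> real" and m :: "real ^ 'n" and A :: "real ^ 'n ^ 'n"
  assumes per: "integer_periodic V" and C: "C_class 2 V" and m: "is_minimum V m" and A: "hessian_root V m A"
begin

private lemma coercive: obtains c where "c > 0" "\<And>y. c * (norm y)\<^sup>2 \<le> (norm (A *v y))\<^sup>2"
proof -
  obtain c where c: "c > 0" "\<And>y. c * norm y \<le> norm (A *v y)" using A unfolding hessian_root_def by blast
  have "c\<^sup>2 * (norm y)\<^sup>2 \<le> (norm (A *v y))\<^sup>2" for y
    using power_mono[OF c(2)[of y], of 2] c(1) by (simp add: power_mult_distrib)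
  then show ?thesis using that[of "c\<^sup>2"] c(1) by simp
qed

private lemma taylor:
  assumes "e > 0"
  obtains d where "d > 0" "\<And>y. norm y < d \<Longrightarrow> \<bar>V (m + y) - V m - (norm (A *v y))\<^sup>2 / 2\<bar> \<le> e * (norm y)\<^sup>2"
  using taylor_second_order_minimum[OF C m assms] A unfolding hessian_root_def by auto

private lemma shift: "(\<And>i. k $ i \<in> \<int>) \<Longrightarrow> V (m + (y + k)) = V (m + y)"
  using integer_periodicD[OF per, of k "m + y"] by (simp add: add.assoc)

text \<open>The deficit \<open>1 - k\<close> leaves a definite quadratic term that dominates both
  the Taylor remainder and the error of \<open>sine_coords\<close>, with strict inequality off the
  lattice. It is used with k = a^2 for the vector field and with k = 0 to isolate the
  minima.\<close>

lemma potential_local_lower: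
  assumes k: "0 \<le> k" "k < 1"
  obtains d where "d > 0" "\<And>y. lattice_gap y < d \<Longrightarrow> k * (norm (A *v sine_coords y))\<^sup>2 / 2 \<le> V (m + y) - V m"
    "\<And>y. lattice_gap y < d \<Longrightarrow> lattice_gap y \<noteq> 0 \<Longrightarrow> k * (norm (A *v sine_coords y))\<^sup>2 / 2 < V (m + y) - V m"
proof -
  obtain c where c: "c > 0" "\<And>y. c * (norm y)\<^sup>2 \<le> (norm (A *v y))\<^sup>2" using coercive by blast
  \<comment> \<open>The errors add up to at most 3/2 e |y|^2, while coercivity provides (1 - k) c
    |y|^2 / 2 = 4 e |y|^2.\<close>
  define e where "e = (1 - k) * c / 8"
  have e: "e > 0" using c k by (simp add: e_def)
  obtain d1 where d1: "d1 > 0" "\<And>y. norm y < d1 \<Longrightarrow> \<bar>V (m + y) - V m - (norm (A *v y))\<^sup>2 / 2\<bar> \<le> e * (norm y)\<^sup>2"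
    using taylor[OF e] by blast
  have "((\<lambda>y. A *v sine_coords y) has_derivative (\<lambda>y. A *v y)) (at 0)"
    by (rule bounded_linear.has_derivative[OF _ sine_coords_has_derivative]) (simp flip: linear_conv_bounded_linear)
  then obtain d2 where d2: "d2 > 0"
    "\<And>y. norm y < d2 \<Longrightarrow> \<bar>(norm (A *v sine_coords y))\<^sup>2 - (norm (A *v y))\<^sup>2\<bar> \<le> e * (norm y)\<^sup>2"
    using norm_power2_linearization[OF _ _ e, of "\<lambda>y. A *v sine_coords y" A] by auto
  let ?Q = "\<lambda>y. k * (norm (A *v sine_coords y))\<^sup>2 / 2 \<le> V (m + y) - V m
    \<and> (lattice_gap y \<noteq> 0 \<longrightarrow> k * (norm (A *v sine_coords y))\<^sup>2 / 2 < V (m + y) - V m)"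
  have loc: "?Q y" if y: "norm y < min d1 d2" for y
  proof (cases "y = 0")
    case False
    let ?a = "(norm (A *v y))\<^sup>2" and ?n = "(norm y)\<^sup>2"
    have n: "?n > 0" using False by simp
    have "k * (norm (A *v sine_coords y))\<^sup>2 \<le> k * (?a + e * ?n)"
      using d2(2)[of y] y k(1) by (intro mult_left_mono) auto
    moreover have "k * (e * ?n) \<le> e * ?n" using k e n by (intro mult_left_le_one_le) auto
    moreover have "V (m + y) - V m \<ge> ?a / 2 - e * ?n" using d1(2)[of y] y by auto
    moreover have "4 * (e * ?n) \<le> (1 - k) * ?a / 2"
    proof -
      have "8 * (e * ?n) = (1 - k) * (c * ?n)" by (simp add: e_def)
      also have "\<dots> \<le> (1 - k) * ?a" using c(2)[of y] k by (intro mult_left_mono) auto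
      finally show ?thesis by simp
    qed
    moreover have "e * ?n > 0" using e n by simp
    ultimately have "k * (norm (A *v sine_coords y))\<^sup>2 / 2 < V (m + y) - V m"
      by (simp add: algebra_simps)
    then show ?thesis by simp
  qed simp
  have inv: "?Q (y + k') = ?Q y" if "\<And>i. k' $ i \<in> \<int>" for y k'
    using that
    by (simp add: integer_periodicD[OF sine_coords_periodic] integer_periodicD[OF lattice_gap_periodic] shift)
  obtain d where "d > 0" "\<And>y. lattice_gap y < d \<Longrightarrow> ?Q y"
  proof (rule lattice_gap_local[of ?Q "min d1 d2"])
    show "min d1 d2 > 0" using d1(1) d2(1) by simp
    show "?Q y" if "norm y < min d1 d2" for y using that by (rule loc)
    show "?Q (y + k') = ?Q y" if "\<And>i. k' $ i \<in> \<int>" for y k' using that by (rule inv)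
  qed blast
  then show ?thesis using that by blast
qed

text \<open>Here the slack is on the other side: the surplus \<open>\<epsilon>\<close> on the
  squared gradient of the phase absorbs the errors. The Laplacian of the phase is continuous and
  equals the trace of \<open>A\<close> at the origin.\<close>

lemma potential_local_upper:
  assumes \<epsilon>: "\<epsilon> > 0"
  obtains d where "d > 0"
    "\<And>y. lattice_gap y < d \<Longrightarrow> V (m + y) - V m \<le> (1 / 2 + \<epsilon>) * (\<Sum>i\<in>UNIV. (phase1 A i y)\<^sup>2)"
    "\<And>y. lattice_gap y < d \<Longrightarrow> (\<Sum>i\<in>UNIV. phase2 A i y) \<le> sum_nonneg_lyapunov (flow V) (m, 0) + \<epsilon>"
proof -
  let ?\<tau> = "sum_nonneg_lyapunov (flow V) (m, 0)"
  obtain c where c: "c > 0" "\<And>y. c * (norm y)\<^sup>2 \<le> (norm (A *v y))\<^sup>2" using coercive by blast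
  \<comment> \<open>Solves \<open>(2 + \<epsilon>) * e = \<epsilon> * c\<close>, enough for a/2 + e
    n \<le> (1/2 + \<epsilon>) (a - e n) whenever c n \<le> a.\<close>
  define e where "e = \<epsilon> * c / (2 + \<epsilon>)"
  have e: "e > 0" "(2 + \<epsilon>) * e = \<epsilon> * c" using c \<epsilon> by (simp_all add: e_def)
  obtain d1 where d1: "d1 > 0" "\<And>y. norm y < d1 \<Longrightarrow> \<bar>V (m + y) - V m - (norm (A *v y))\<^sup>2 / 2\<bar> \<le> e * (norm y)\<^sup>2"
    using taylor[OF e(1)] by blast
  have "(\<chi> i. phase1 A i 0) = 0" by (simp add: phase1_def vec_eq_iff)
  then obtain d2 where d2: "d2 > 0"
    "\<And>y. norm y < d2 \<Longrightarrow> \<bar>(norm (\<chi> i. phase1 A i y))\<^sup>2 - (norm (A *v y))\<^sup>2\<bar> \<le> e * (norm y)\<^sup>2"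
    using norm_power2_linearization[OF phase1_has_derivative _ e(1), of A] by auto
  have nrm: "(norm (\<chi> i. phase1 A i y))\<^sup>2 = (\<Sum>i\<in>UNIV. (phase1 A i y)\<^sup>2)" for y
    unfolding power2_norm_eq_inner inner_vec_def by (simp add: power2_eq_square)
  have "isCont (\<lambda>y. \<Sum>i\<in>UNIV. phase2 A i y) 0"
    using continuous_on_phase(3)[of UNIV A] by (intro continuous_intros) (auto simp: continuous_on_eq_continuous_at)
  moreover have at0: "(\<Sum>i\<in>UNIV. phase2 A i 0) = ?\<tau>"
    using A by (simp add: phase2_def hessian_root_def)
  ultimately obtain d3 where d3: "d3 > 0" "\<And>y. norm y < d3 \<Longrightarrow> \<bar>(\<Sum>i\<in>UNIV. phase2 A i y) - ?\<tau>\<bar> < \<epsilon>"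
    using \<epsilon> unfolding continuous_at_eps_delta dist_norm by fastforce
  let ?Q = "\<lambda>y. V (m + y) - V m \<le> (1 / 2 + \<epsilon>) * (\<Sum>i\<in>UNIV. (phase1 A i y)\<^sup>2)
    \<and> (\<Sum>i\<in>UNIV. phase2 A i y) \<le> ?\<tau> + \<epsilon>"
  have loc: "?Q y" if y: "norm y < min d1 (min d2 d3)" for y
  proof -
    let ?a = "(norm (A *v y))\<^sup>2" and ?n = "(norm y)\<^sup>2"
    have "V (m + y) - V m \<le> ?a / 2 + e * ?n" using d1(2)[of y] y by auto
    also have "\<dots> \<le> (1 / 2 + \<epsilon>) * (?a - e * ?n)"
    proof -
      have "(2 + \<epsilon>) * e * ?n \<le> \<epsilon> * ?a"
        using mult_left_mono[OF c(2)[of y], of \<epsilon>] \<epsilon> unfolding e(2) by (simp add: mult_ac)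
      moreover have "0 \<le> e * ?n" using e by simp
      ultimately show ?thesis by (simp add: algebra_simps)
    qed
    also have "\<dots> \<le> (1 / 2 + \<epsilon>) * (\<Sum>i\<in>UNIV. (phase1 A i y)\<^sup>2)"
      using d2(2)[of y] y \<epsilon> unfolding nrm by (intro mult_left_mono) auto
    finally show ?thesis using d3(2)[of y] y by auto
  qed
  have inv: "?Q (y + k) = ?Q y" if "\<And>i. k $ i \<in> \<int>" for y k
  proof -
    have "phase1 A i (y + k) = phase1 A i y" "phase2 A i (y + k) = phase2 A i y" for i
    proof -
      have sc: "sin (2 * pi * (y + k) $ i) = sin (2 * pi * y $ i)" "cos (2 * pi * (y + k) $ i) = cos (2 * pi * y $ i)"
        using that[of i] by (simp_all add: distrib_left sin_add cos_add sin_integer_2pi cos_integer_2pi)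
      then show "phase1 A i (y + k) = phase1 A i y" "phase2 A i (y + k) = phase2 A i y"
        unfolding phase1_def phase2_def sc
        using integer_periodicD[OF sine_coords_periodic that] integer_periodicD[OF lattice_gap_periodic that] by simp_all
    qed
    then show ?thesis using shift[OF that] by simp
  qed
  obtain d where "d > 0" "\<And>y. lattice_gap y < d \<Longrightarrow> ?Q y"
  proof (rule lattice_gap_local[of ?Q "min d1 (min d2 d3)"])
    show "min d1 (min d2 d3) > 0" using d1(1) d2(1) d3(1) by simp
    show "?Q y" if "norm y < min d1 (min d2 d3)" for y using that by (rule loc)
    show "?Q (y + k) = ?Q y" if "\<And>i. k $ i \<in> \<int>" for y k using that by (rule inv)
  qed blast
  then show ?thesis using that by blast
qed

end

text \<open>The representative of \<open>x\<close> may lie on the boundary of the cube, but an open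
  set meeting the closed cube also meets its interior, where open sets have positive
  measure.\<close>

lemma open_periodic_measure_pos:
  fixes S :: "(real ^ 'n::finite) set"
  assumes S: "open S" "x \<in> S" and per: "\<And>k. (\<And>i. k $ i \<in> \<int>) \<Longrightarrow> x + k \<in> S"
  shows "(\<integral>y. indicat_real S y \<partial>cell_lebesgue) > 0"
proof -
  obtain k where k: "\<And>i. k $ i \<in> \<int>" "x + k \<in> unit_cell" using unit_cell_representative[of x] by blast
  have "x + k \<in> S \<inter> cbox 0 1" using per[OF k(1)] k(2) unit_cell_subset_cbox by blast
  moreover have "(\<chi> i. 1 / 2) \<in> box 0 (1 :: real ^ 'n)" by (simp add: mem_box_cart)
  then have "box 0 1 \<noteq> ({} :: (real ^ 'n) set)" by blast
  ultimately have T: "S \<inter> box 0 1 \<noteq> {}"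
    using open_Int_closure_eq_empty[OF S(1), of "box 0 1"] by (auto simp: closure_box)
  have sub: "box 0 1 \<subseteq> (unit_cell :: (real ^ 'n) set)" by (auto simp: unit_cell_def mem_box_cart less_imp_le)
  have "open (S \<inter> box 0 1)" using S(1) by (intro open_Int open_box)
  then have "\<not> negligible (S \<inter> box 0 1)" using T by (rule open_not_negligible)
  then have "S \<inter> box 0 1 \<notin> null_sets lborel" by (metis negligible_iff_null_sets null_sets_completionI)
  then have "emeasure lborel (S \<inter> box 0 1) \<noteq> 0" using S(1) by auto
  moreover have "emeasure lborel (S \<inter> box 0 1) \<le> emeasure lborel (S \<inter> unit_cell)"
    using S(1) sub by (intro emeasure_mono) auto
  ultimately have "emeasure lborel (S \<inter> unit_cell) \<noteq> 0" by auto
  moreover have "emeasure lborel (S \<inter> unit_cell) < \<infinity>"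
    by (rule order_le_less_trans[OF emeasure_mono emeasure_unit_cell_finite]) auto
  ultimately have "measure lborel (S \<inter> unit_cell) > 0"
    by (simp add: measure_def enn2real_positive_iff less_top zero_less_iff_neq_zero)
  moreover have "(\<integral>y. indicat_real S y \<partial>cell_lebesgue) = measure lborel (S \<inter> unit_cell)"
  proof -
    have "(\<integral>y. indicat_real S y \<partial>cell_lebesgue) = (\<integral>y. indicator unit_cell y *\<^sub>R indicat_real S y \<partial>lborel)"
      by (rule integral_restrict_space) simp
    also have "(\<lambda>y. indicator unit_cell y *\<^sub>R indicat_real S y) = indicat_real (S \<inter> unit_cell)"
      by (simp add: fun_eq_iff indicator_inter_arith mult.commute)
    finally have "(\<integral>y. indicat_real S y \<partial>cell_lebesgue) = (\<integral>y. indicat_real (S \<inter> unit_cell) y \<partial>lborel)" .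
    then show ?thesis using S(1) by simp
  qed
  ultimately show ?thesis by simp
qed

lemma phase_nonneg_bound:
  assumes "hessian_root V m A"
  shows "(lattice_gap y)\<^sup>2 \<le> phase A y"
  using assms by (simp add: phase_def hessian_root_def)

lemma sum_nonneg_lyapunov_root_nonneg:
  assumes "hessian_root V m A"
  shows "0 \<le> sum_nonneg_lyapunov (flow V) (m, 0)"
proof -
  have "0 \<le> axis i 1 \<bullet> (A *v axis i 1)" for i using assms by (auto simp: hessian_root_def)
  then have "0 \<le> A $ i $ i" for i by (simp add: inner_axis' matrix_vector_mul_component inner_axis)
  then have "0 \<le> (\<Sum>i\<in>UNIV. A $ i $ i)" by (intro sum_nonneg) auto
  then show ?thesis using assms by (simp add: hessian_root_def)
qed

text \<open>Harmonic approximation from above, with the trial state \<open>exp (- f / h)\<close>, \<open>f\<close> the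
  \<^const>\<open>phase\<close> function at \<open>m\<close>.\<close>

lemma ground_energy_upper:
  fixes V :: "real ^ 'n::finite \<Rightarrow> real"
  assumes per: "integer_periodic V" and C: "C_class 2 V" and m: "is_minimum V m" and A: "hessian_root V m A"
    and \<epsilon>: "\<epsilon> > 0"
  defines "\<tau> \<equiv> sum_nonneg_lyapunov (flow V) (m, 0)"
  obtains h0 where "h0 > 0"
    "\<And>h E \<psi>. 0 < h \<Longrightarrow> h < h0 \<Longrightarrow> is_eigenfunction h V E \<psi> \<Longrightarrow> \<forall>x. \<psi> x > 0 \<Longrightarrow> E \<le> V m + h / 2 * (\<tau> + \<epsilon>)"
proof -
  have \<tau>: "\<tau> \<ge> 0" unfolding \<tau>_def by (rule sum_nonneg_lyapunov_root_nonneg[OF A])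
  \<comment> \<open>Makes (1 + e)(\<tau> + e) \<le> \<tau> + \<epsilon>/2; the other half of
    \<epsilon> is reserved for the mass of the trial density far from the minimum.\<close>
  define e where "e = min 1 (\<epsilon> / (2 * (\<tau> + 2)))"
  have e: "e > 0" "e \<le> 1" using \<epsilon> \<tau> by (auto simp: e_def)
  have "e * (\<tau> + 2) \<le> \<epsilon> / 2"
  proof -
    have "e \<le> (\<epsilon> / 2) / (\<tau> + 2)" by (simp add: e_def min_le_iff_disj)
    then show ?thesis using \<tau> by (subst (asm) pos_le_divide_eq) auto
  qed
  moreover have "(1 + e) * (\<tau> + e) = \<tau> + e * (\<tau> + 1 + e)" by (simp add: algebra_simps)
  moreover have "e * (\<tau> + 1 + e) \<le> e * (\<tau> + 2)" using e by (intro mult_left_mono) auto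
  ultimately have e\<tau>: "(1 + e) * (\<tau> + e) \<le> \<tau> + \<epsilon> / 2" by linarith
  have contV: "continuous_on UNIV V" using C by (rule C_class_imp_continuous)
  obtain d where d: "d > 0"
    "\<And>y. lattice_gap y < d \<Longrightarrow> V (m + y) - V m \<le> (1 / 2 + e) * (\<Sum>i\<in>UNIV. (phase1 A i y)\<^sup>2)"
    "\<And>y. lattice_gap y < d \<Longrightarrow> (\<Sum>i\<in>UNIV. phase2 A i y) \<le> \<tau> + e"
    using potential_local_upper[OF per C m A e(1)] unfolding \<tau>_def by blast
  have sym: "\<And>i j. A $ i $ j = A $ j $ i" using A by (simp add: hessian_root_def)
  define f where "f = (\<lambda>x. phase A (x - m))"
  define f1 where "f1 = (\<lambda>i x. phase1 A i (x - m))"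
  define f2 where "f2 = (\<lambda>i x. phase2 A i (x - m))"
  have perf: "integer_periodic f" unfolding f_def by (intro integer_periodic_translate phase_periodic)
  have hp1: "has_partial i f (f1 i)" for i
    unfolding f_def f1_def by (intro has_partial_translate has_partial_phase sym)
  have hp2: "has_partial i (f1 i) (f2 i)" for i
    unfolding f1_def f2_def by (intro has_partial_translate has_partial_phase1)
  have cf: "continuous_on UNIV f" "continuous_on UNIV (f1 i)" "continuous_on UNIV (f2 i)" for i
    unfolding f_def f1_def f2_def by (intro continuous_on_compose2[OF continuous_on_phase(1)[of UNIV A]]
      continuous_on_compose2[OF continuous_on_phase(2)[of UNIV A]] continuous_on_compose2[OF continuous_on_phase(3)[of UNIV A]]
      continuous_intros; simp)+
  have per2: "integer_periodic (f2 i)" for i using has_partial_periodic hp1 hp2 perf by blast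
  obtain M where M: "\<And>x. \<bar>V x\<bar> \<le> M" using integer_periodic_bounded[OF per contV] by blast
  obtain M2 where M2: "M2 > 0" "\<And>x. \<bar>\<Sum>i\<in>UNIV. f2 i x\<bar> \<le> M2"
  proof (rule integer_periodic_bounded[of "\<lambda>x. \<Sum>i\<in>UNIV. f2 i x"])
    show "integer_periodic (\<lambda>x. \<Sum>i\<in>UNIV. f2 i x)" using per2 by (simp add: integer_periodic_def)
  qed (use cf in \<open>auto intro!: continuous_intros\<close>)
  \<comment> \<open>Bounds how far the integrand can drop below \<open>X\<close> away from the
    minimum: \<open>2 * M\<close> for the oscillation of \<open>V\<close>, \<open>M2\<close> for the
    Laplacian of \<open>f\<close>, whose coefficient is at most 1.\<close>
  define K where "K = 2 * M + M2"
  have K: "K \<ge> 0" using M[of 0] M2(1) by (simp add: K_def)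
  define v where "v = (\<integral>x. (1 :: real) \<partial>(cell_lebesgue :: (real ^ 'n) measure))"
  \<comment> \<open>On this set the weight is at least exp (- d^2 / h), whereas it is at most exp (-
    2 d^2 / h) where \<open>lattice_gap\<close> is at least \<open>d\<close>. The two levels differ
    in order to leave a factor exp (- d^2 / h).\<close>
  let ?S = "{x. f x < d\<^sup>2 / 2}"
  define v0 where "v0 = (\<integral>x. indicat_real ?S x \<partial>cell_lebesgue)"
  have openS: "open ?S" by (intro open_Collect_less cf continuous_intros)
  have fm: "f m = 0" by (simp add: f_def phase_def)
  have v0: "v0 > 0"
    unfolding v0_def using openS
  proof (rule open_periodic_measure_pos)
    show "m \<in> ?S" using d(1) by (simp add: fm)
    show "m + k \<in> ?S" if "\<And>i. k $ i \<in> \<int>" for k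
      using d(1) integer_periodicD[OF perf that, of m] by (simp add: fm)
  qed
  have v: "v \<ge> 0" unfolding v_def by (intro integral_nonneg_AE) auto
  define C where "C = 2 * (K * v / v0) / d ^ 4"
  have C: "C \<ge> 0" using K v v0 d(1) by (simp add: C_def)
  define h0 where "h0 = min 1 (\<epsilon> / (4 * C + 1))"
  have h0: "h0 > 0" using \<epsilon> C by (simp add: h0_def)
  show ?thesis
  proof (rule that[OF h0])
    fix h E \<psi> assume h: "0 < h" "h < h0" and ef: "is_eigenfunction h V E \<psi>" and pos: "\<forall>x. \<psi> x > 0"
    have h1: "h \<le> 1" using h by (simp add: h0_def)
    \<comment> \<open>The excess of \<open>E\<close> over the harmonic value with
      \<open>\<mu> = 1 + e\<close>. It bounds the integrand from below near the minimum, so only the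
      far region can make it positive.\<close>
    define X where "X = E - V m - (1 + e) * h / 2 * (\<tau> + e)"
    let ?w = "\<lambda>x. exp (- 2 / h * f x)"
    let ?J = "\<lambda>x. E - V x + ((1 + e) - 1 / 2) * (\<Sum>i\<in>UNIV. (f1 i x)\<^sup>2) - (1 + e) * h / 2 * (\<Sum>i\<in>UNIV. f2 i x)"
    have cw: "continuous_on UNIV ?w" by (intro continuous_intros cf)
    have up: "(\<integral>x. ?J x * ?w x \<partial>cell_lebesgue) \<le> 0"
      by (rule energy_upper_bound[OF contV ef h(1) pos[rule_format] perf cf(1) hp1 cf(2) hp2 cf(3)])
    have lower: "X * ?w x - K * exp (- 2 * d\<^sup>2 / h) \<le> ?J x * ?w x" for x
    proof (cases "lattice_gap (x - m) < d")
      case True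
      have "V x - V m \<le> (1 / 2 + e) * (\<Sum>i\<in>UNIV. (f1 i x)\<^sup>2)"
        using d(2)[OF True] by (simp add: f1_def)
      moreover have "(1 + e) * h / 2 * (\<Sum>i\<in>UNIV. f2 i x) \<le> (1 + e) * h / 2 * (\<tau> + e)"
        using d(3)[OF True] e h by (intro mult_left_mono) (auto simp: f2_def)
      moreover have coef: "(1 + e) - 1 / 2 = 1 / 2 + e" by simp
      ultimately have "X \<le> ?J x" unfolding X_def coef by linarith
      then have "X * ?w x \<le> ?J x * ?w x" by (intro mult_right_mono) auto
      moreover have "0 \<le> K * exp (- 2 * d\<^sup>2 / h)" using K by simp
      ultimately show ?thesis by linarith
    next
      case False
      have "d\<^sup>2 \<le> (lattice_gap (x - m))\<^sup>2" using False d(1) by (intro power_mono) auto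
      then have "d\<^sup>2 \<le> f x" using phase_nonneg_bound[OF A, of "x - m"] by (simp add: f_def)
      then have "?w x \<le> exp (- 2 * d\<^sup>2 / h)" using h(1) by (simp add: field_simps)
      then have Kw: "K * ?w x \<le> K * exp (- 2 * d\<^sup>2 / h)" using K by (intro mult_left_mono)
      have "X - K \<le> ?J x"
      proof -
        have "0 \<le> (1 / 2 + e) * (\<Sum>i\<in>UNIV. (f1 i x)\<^sup>2)" using e by (intro mult_nonneg_nonneg sum_nonneg) auto
        moreover have "(1 + e) * h / 2 * (\<Sum>i\<in>UNIV. f2 i x) \<le> 1 * M2"
        proof -
          have "(1 + e) * h \<le> 2 * 1" using e h h1 by (intro mult_mono) auto
          then have "(1 + e) * h / 2 * M2 \<le> 1 * M2" using M2(1) by (intro mult_right_mono) auto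
          moreover have "(1 + e) * h / 2 * (\<Sum>i\<in>UNIV. f2 i x) \<le> (1 + e) * h / 2 * M2"
            using abs_le_D1[OF M2(2)[of x]] e h by (intro mult_left_mono) auto
          ultimately show ?thesis by linarith
        qed
        moreover have "0 \<le> (1 + e) * h / 2 * (\<tau> + e)" using e h \<tau> by simp
        moreover have coef: "(1 + e) - 1 / 2 = 1 / 2 + e" by simp
        ultimately show ?thesis using M[of x] M[of m] unfolding X_def K_def coef by linarith
      qed
      then have "(X - K) * ?w x \<le> ?J x * ?w x" by (intro mult_right_mono) auto
      then show ?thesis using Kw by (simp add: algebra_simps)
    qed
    have iw: "integrable cell_lebesgue ?w" using cw by (rule integrable_cell)
    have i1: "integrable cell_lebesgue (\<lambda>x :: real ^ 'n. c)" for c :: real by (intro integrable_cell continuous_intros)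
    have "X * (\<integral>x. ?w x \<partial>cell_lebesgue) - K * exp (- 2 * d\<^sup>2 / h) * v
        = (\<integral>x. X * ?w x - K * exp (- 2 * d\<^sup>2 / h) \<partial>cell_lebesgue)"
      unfolding v_def using iw i1 by (subst Bochner_Integration.integral_diff) auto
    also have "\<dots> \<le> (\<integral>x. ?J x * ?w x \<partial>cell_lebesgue)"
      using lower by (intro integral_mono integrable_cell continuous_intros cf contV) auto
    also have "\<dots> \<le> 0" by (rule up)
    finally have Xw: "X * (\<integral>x. ?w x \<partial>cell_lebesgue) \<le> K * exp (- 2 * d\<^sup>2 / h) * v" by simp
    have "X \<le> h * \<epsilon> / 4"
    proof (cases "X \<le> 0")
      case True
      also have "0 \<le> h * \<epsilon> / 4" using h \<epsilon> by simp
      finally show ?thesis .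
    next
      case False
      have mS: "?S \<in> sets borel" using openS by simp
      have "exp (- d\<^sup>2 / h) * v0 = (\<integral>x. exp (- d\<^sup>2 / h) * indicat_real ?S x \<partial>cell_lebesgue)"
        by (simp add: v0_def)
      also have "\<dots> \<le> (\<integral>x. ?w x \<partial>cell_lebesgue)"
      proof (rule integral_mono)
        have "integrable cell_lebesgue (indicat_real ?S)"
          by (rule finite_measure.integrable_const_bound[OF finite_measure_cell, of _ 1])
             (use mS in \<open>auto intro!: AE_I2 measurable_restrict_space1 simp: indicator_def\<close>)
        then show "integrable cell_lebesgue (\<lambda>x. exp (- d\<^sup>2 / h) * indicat_real ?S x)" by simp
        show "exp (- d\<^sup>2 / h) * indicat_real ?S x \<le> ?w x" for x
          using h(1) by (auto simp: indicator_def field_simps)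
      qed (rule iw)
      finally have "X * (exp (- d\<^sup>2 / h) * v0) \<le> X * (\<integral>x. ?w x \<partial>cell_lebesgue)"
        using False by (intro mult_left_mono) auto
      also have "\<dots> \<le> K * exp (- 2 * d\<^sup>2 / h) * v" by (rule Xw)
      also have "exp (- 2 * d\<^sup>2 / h) = exp (- d\<^sup>2 / h) * exp (- d\<^sup>2 / h)" by (simp flip: exp_add)
      finally have "exp (- d\<^sup>2 / h) * (X * v0) \<le> exp (- d\<^sup>2 / h) * (K * v * exp (- d\<^sup>2 / h))"
        by (simp add: mult_ac)
      then have "X * v0 \<le> K * v * exp (- d\<^sup>2 / h)" by simp
      then have "X \<le> K * v / v0 * exp (- d\<^sup>2 / h)" using v0 by (simp add: field_simps)
      \<comment> \<open>Any bound o(h) is enough; the quadratic Taylor estimate of the exponential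
        gives order h^2, and this fixes the constant \<open>C\<close>.\<close>
      also have "\<dots> \<le> K * v / v0 * (2 * h\<^sup>2 / d ^ 4)"
      proof (rule mult_left_mono)
        have "(d\<^sup>2 / h)\<^sup>2 / 2 \<le> exp (d\<^sup>2 / h)"
        proof -
          have "0 \<le> d\<^sup>2 / h" using h(1) by simp
          then show ?thesis using exp_lower_Taylor_quadratic[of "d\<^sup>2 / h"] by linarith
        qed
        then have "inverse (exp (d\<^sup>2 / h)) \<le> inverse ((d\<^sup>2 / h)\<^sup>2 / 2)"
          using h(1) d(1) by (intro le_imp_inverse_le) auto
        then show "exp (- d\<^sup>2 / h) \<le> 2 * h\<^sup>2 / d ^ 4"
          by (simp add: exp_minus power_divide mult.commute[of "h\<^sup>2"] flip: power_mult)
      qed (use K v v0 in simp)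
      also have "\<dots> = h * (C * h)" by (simp add: C_def power2_eq_square)
      also have "\<dots> \<le> h * (\<epsilon> / 4)"
      proof (rule mult_left_mono)
        have "h \<le> \<epsilon> / (4 * C + 1)" using h(2) by (simp add: h0_def)
        then have "h * (4 * C + 1) \<le> \<epsilon>" using C by (subst (asm) pos_le_divide_eq) auto
        then show "C * h \<le> \<epsilon> / 4" using h(1) by (simp add: algebra_simps)
      qed (use h in simp)
      finally show ?thesis by simp
    qed
    moreover have "(1 + e) * h / 2 * (\<tau> + e) \<le> h / 2 * (\<tau> + \<epsilon> / 2)"
      using mult_left_mono[OF e\<tau>, of "h / 2"] h(1) by (simp add: mult_ac)
    moreover have "h / 2 * (\<tau> + \<epsilon> / 2) + h * \<epsilon> / 4 = h / 2 * (\<tau> + \<epsilon>)" by (simp add: algebra_simps)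
    ultimately show "E \<le> V m + h / 2 * (\<tau> + \<epsilon>)" unfolding X_def by linarith
  qed
qed

subsection \<open>A vector field adapted to all minima\<close>

text \<open>Squaring the positive part makes the cutoff continuously differentiable. It has no
  plateau: the divergence matters only at the minima themselves, where the value is 1 and the
  derivative term is multiplied by \<open>sine_coords\<close>, which vanishes.\<close>

definition cutoff :: "real \<Rightarrow> real \<Rightarrow> real" where
  "cutoff d r = (max 0 (1 - r / d))\<^sup>2"

definition cutoff' :: "real \<Rightarrow> real \<Rightarrow> real" where
  "cutoff' d r = - 2 / d * max 0 (1 - r / d)"

lemma DERIV_max_0_power2: "((\<lambda>t::real. (max 0 t)\<^sup>2) has_real_derivative 2 * max 0 t) (at t)"
proof -
  consider "t < 0" | "t = 0" | "t > 0" by linarith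
  then show ?thesis
  proof cases
    case 1
    have "eventually (\<lambda>x. (max 0 x)\<^sup>2 = 0) (nhds t)"
      using eventually_nhds_in_open[of "{..<0}" t] 1 by (auto elim!: eventually_mono)
    from DERIV_cong_ev[OF refl this refl, of "2 * max 0 t"] show ?thesis using 1 by simp
  next
    case 2
    have "((\<lambda>h. (max 0 h)\<^sup>2 / h) \<longlongrightarrow> (0::real)) (at 0)"
    proof (rule Lim_null_comparison)
      show "eventually (\<lambda>h. norm ((max 0 h)\<^sup>2 / h) \<le> \<bar>h\<bar>) (at (0::real))"
        by (intro always_eventually) (auto simp: max_def power2_eq_square)
      show "((\<lambda>h. \<bar>h\<bar>) \<longlongrightarrow> (0::real)) (at 0)" by (rule tendsto_rabs_zero) (rule tendsto_ident_at)
    qed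
    then show ?thesis using 2 by (simp add: DERIV_def)
  next
    case 3
    have "eventually (\<lambda>x. (max 0 x)\<^sup>2 = x\<^sup>2) (nhds t)"
      using eventually_nhds_in_open[of "{0<..}" t] 3 by (auto elim!: eventually_mono)
    moreover have "((\<lambda>x. x\<^sup>2) has_real_derivative 2 * max 0 t) (at t)"
      using 3 by (auto intro!: derivative_eq_intros)
    ultimately show ?thesis by (subst DERIV_cong_ev[OF refl _ refl])
  qed
qed

lemma DERIV_cutoff:
  assumes "d > 0"
  shows "(cutoff d has_real_derivative cutoff' d r) (at r)"
proof -
  have "((\<lambda>r. 1 - r / d) has_real_derivative - 1 / d) (at r)"
    using assms by (auto intro!: derivative_eq_intros)
  from DERIV_chain2[OF DERIV_max_0_power2 this] show ?thesis
    by (simp add: cutoff_def[abs_def] cutoff'_def)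
qed

lemma cutoff_props:
  assumes "d > 0"
  shows "cutoff d 0 = 1" "0 \<le> cutoff d r" "0 \<le> r \<Longrightarrow> cutoff d r \<le> 1" "d \<le> r \<Longrightarrow> cutoff d r = 0"
  using assms by (auto simp: cutoff_def power_le_one)

lemma finite_positive_lower_bound:
  fixes g :: "'a \<Rightarrow> real"
  assumes "finite S" "\<And>x. x \<in> S \<Longrightarrow> g x > 0"
  obtains c where "c > 0" "\<And>x. x \<in> S \<Longrightarrow> c \<le> g x"
proof (rule that)
  show "Min (insert 1 (g ` S)) > 0" using assms by simp
  show "Min (insert 1 (g ` S)) \<le> g x" if "x \<in> S" for x using assms(1) that by simp
qed

text \<open>Component \<open>i\<close> of the periodized linear field. The cutoff destroys any
  gradient structure, which \<open>energy_lower_bound\<close> does not ask for.\<close>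

definition lattice_field :: "real \<Rightarrow> real ^ 'n ^ 'n \<Rightarrow> 'n \<Rightarrow> real ^ 'n::finite \<Rightarrow> real" where
  "lattice_field d A i y = cutoff d (lattice_gap y) * (A $ i \<bullet> sine_coords y)"

definition lattice_field' :: "real \<Rightarrow> real ^ 'n ^ 'n \<Rightarrow> 'n \<Rightarrow> real ^ 'n::finite \<Rightarrow> real" where
  "lattice_field' d A i y = (cutoff' d (lattice_gap y) * (pi * sin (2 * pi * y $ i))) * (A $ i \<bullet> sine_coords y)
     + cutoff d (lattice_gap y) * (A $ i $ i * cos (2 * pi * y $ i))"

lemma has_partial_lattice_field:
  "d > 0 \<Longrightarrow> has_partial i (lattice_field d A i) (lattice_field' d A i)"
  unfolding lattice_field_def lattice_field'_def
  by (intro has_partial_mult has_partial_compose[OF DERIV_cutoff] has_partial_lattice_gap has_partial_sine_coords)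

lemma lattice_field_periodic: "integer_periodic (lattice_field d A i)"
  by (simp add: integer_periodic_def lattice_field_def integer_periodicD[OF sine_coords_periodic]
      integer_periodicD[OF lattice_gap_periodic])

lemma continuous_on_lattice_field:
  assumes "d > 0"
  shows "continuous_on S (lattice_field d A i)" "continuous_on S (lattice_field' d A i)"
  unfolding lattice_field_def lattice_field'_def cutoff_def cutoff'_def using assms
  by (intro continuous_intros continuous_on_lattice_gap continuous_on_sine_coords; simp)+

section \<open>Minima modulo the lattice\<close>

lemma minimum_translate:
  assumes "integer_periodic V" "\<And>i. k $ i \<in> \<int>"
  shows "is_minimum V (m + k) \<longleftrightarrow> is_minimum V m"
  using assms by (simp add: is_minimum_def integer_periodicD)

text \<open>The exponents at a minimum are determined by the Hessian, which is periodic. Hence the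
  sum, defined through the lifted flow, is a function on the torus.\<close>

lemma sum_nonneg_lyapunov_translate:
  fixes V :: "real ^ 'n::finite \<Rightarrow> real"
  assumes per: "integer_periodic V" and C: "C_class 2 V" and m: "is_minimum V m"
    and inv: "invertible (hessian V m)" and k: "\<And>i. k $ i \<in> \<int>"
  shows "sum_nonneg_lyapunov (flow V) (m + k, 0) = sum_nonneg_lyapunov (flow V) (m, 0)"
proof -
  obtain B l where B: "finite B" "pairwise orthogonal B" "\<And>b. b \<in> B \<Longrightarrow> norm b = 1" "span B = UNIV"
    and l: "\<And>b. b \<in> B \<Longrightarrow> l b > (0::real)" and H: "\<And>b. b \<in> B \<Longrightarrow> hessian V m *v b = (l b)\<^sup>2 *\<^sub>R b"
    by (rule nondegenerate_minimum_eigenbasis[OF C m inv]) blast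
  have "partial i (partial j V) (m + k) = partial i (partial j V) m" for i j
    using C by (intro integer_periodicD[OF _ k] integer_periodic_partial per) (auto simp: numeral_2_eq_2)
  then have "hessian V (m + k) = hessian V m" by (simp add: hessian_def)
  then have H': "\<And>b. b \<in> B \<Longrightarrow> hessian V (m + k) *v b = (l b)\<^sup>2 *\<^sub>R b" using H by simp
  have m': "is_minimum V (m + k)" using minimum_translate[OF per k] m by simp
  show ?thesis
    using sum_nonneg_lyapunov_minimum[OF per C m B l H] sum_nonneg_lyapunov_minimum[OF per C m' B l H'] by simp
qed

lemma periodic_attains_minimum:
  fixes V :: "real ^ 'n::finite \<Rightarrow> real"
  assumes per: "integer_periodic V" and cont: "continuous_on UNIV V"
  shows "\<exists>m\<in>unit_cell. is_minimum V m"
proof -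
  have "(0 :: real ^ 'n) \<in> cbox 0 1" by (simp add: mem_box_cart)
  then have "\<exists>m\<in>cbox 0 1. \<forall>y\<in>cbox 0 1. V m \<le> V y"
    by (intro continuous_attains_inf continuous_on_subset[OF cont]) auto
  then obtain m where m: "\<And>y. y \<in> cbox 0 1 \<Longrightarrow> V m \<le> V y" by blast
  have "V m \<le> V y" for y
  proof -
    obtain k where k: "\<And>i. k $ i \<in> \<int>" "y + k \<in> unit_cell" using unit_cell_representative[of y] by blast
    then show ?thesis using m[of "y + k"] unit_cell_subset_cbox integer_periodicD[OF per k(1), of y] by auto
  qed
  then have m': "is_minimum V m" by (simp add: is_minimum_def)
  obtain k where "\<And>i. k $ i \<in> \<int>" "m + k \<in> unit_cell" using unit_cell_representative[of m] by blast
  then show ?thesis using minimum_translate[OF per] m' by blast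
qed

lemma unit_cell_lattice_gap_eq_0:
  assumes "p \<in> unit_cell" "q \<in> unit_cell" "lattice_gap (p - q) = 0"
  shows "p = q"
proof -
  have "p $ i = q $ i" for i
  proof -
    have "(p - q) $ i \<in> \<int>" using assms(3) by (simp add: lattice_gap_eq_0_iff)
    then obtain n where n: "p $ i - q $ i = of_int n" by (auto elim: Ints_cases)
    have "\<bar>p $ i - q $ i\<bar> < 1" using assms(1,2) unfolding unit_cell_def by (smt (verit) mem_Collect_eq)
    then have "n = 0" unfolding n by linarith
    then show ?thesis using n by simp
  qed
  then show ?thesis by (simp add: vec_eq_iff)
qed

text \<open>An accumulation point would itself be a minimum, and by
  \<open>potential_local_lower\<close> with k = 0 the potential is strictly larger near it except at
  lattice translates.\<close>

lemma finite_minima: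
  fixes V :: "real ^ 'n::finite \<Rightarrow> real"
  assumes per: "integer_periodic V" and C: "C_class 2 V"
    and nd: "\<And>x. is_minimum V x \<Longrightarrow> invertible (hessian V x)"
  shows "finite {p \<in> unit_cell. is_minimum V p}"
proof (rule ccontr)
  let ?P = "{p \<in> unit_cell. is_minimum V p}"
  assume "infinite ?P"
  moreover have "?P \<subseteq> cbox 0 1" using unit_cell_subset_cbox by auto
  ultimately obtain z where z: "z islimpt ?P"
    using Heine_Borel_imp_Bolzano_Weierstrass[OF compact_cbox] by metis
  have "z \<in> closure {p. is_minimum V p}"
    using z islimpt_subset[of z ?P "{p. is_minimum V p}"] by (auto simp: closure_def)
  moreover have "closed {p. is_minimum V p}"
    unfolding is_minimum_def using C_class_imp_continuous[OF C]
    by (intro closed_Collect_all closed_Collect_le continuous_intros)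
  ultimately have mz: "is_minimum V z" by simp
  obtain A where A: "hessian_root V z A" using hessian_root_exists[OF per C mz nd[OF mz]] by blast
  obtain d where d: "d > 0" "\<And>y. lattice_gap y < d \<Longrightarrow> lattice_gap y \<noteq> 0 \<Longrightarrow> 0 * (norm (A *v sine_coords y))\<^sup>2 / 2 < V (z + y) - V z"
    by (rule potential_local_lower[OF per C mz A order_refl zero_less_one], rule that)
  have "isCont lattice_gap (0 :: real ^ 'n)" using continuous_on_lattice_gap[of UNIV] by (auto simp: continuous_on_eq_continuous_at)
  then obtain r where r: "r > 0" "\<And>y :: real ^ 'n. norm y < r \<Longrightarrow> \<bar>lattice_gap y\<bar> < d"
    using d(1) unfolding continuous_at_eps_delta dist_norm by fastforce
  \<comment> \<open>Distance below 1 rules out nonzero lattice translates of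
    \<open>z\<close>.\<close>
  have "min r 1 > 0" using r(1) by simp
  then obtain p where p: "p \<in> ?P" "p \<noteq> z" "dist p z < min r 1"
    using z unfolding islimpt_approachable by blast
  have "V z = V p" using mz p(1) by (auto simp: is_minimum_def intro: order_antisym)
  moreover have "\<bar>lattice_gap (p - z)\<bar> < d" using p(3) by (intro r(2)) (simp add: dist_norm)
  ultimately have "lattice_gap (p - z) = 0" using d(2)[of "p - z"] by force
  then have Z: "(p - z) $ i \<in> \<int>" for i by (simp add: lattice_gap_eq_0_iff)
  have "(p - z) $ i = 0" for i
  proof -
    have "\<bar>(p - z) $ i\<bar> < 1"
      using component_le_norm_cart[of "p - z" i] p(3) by (simp add: dist_norm)
    moreover obtain n where n: "(p - z) $ i = of_int n" using Z[of i] by (auto elim: Ints_cases)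
    ultimately have "n = 0" unfolding n by linarith
    then show ?thesis using n by simp
  qed
  then show False using p(2) by (simp add: vec_eq_iff)
qed

text \<open>The field is a sum of \<open>lattice_field\<close>s, one for each minimum in the cell,
  with disjoint supports. Near a minimum \<open>potential_local_lower\<close> applies with k = a^2,
  and cutting off only shortens the field; away from all minima it vanishes. Equality therefore
  holds only at minima, where the divergence is a times the trace.\<close>

lemma adapted_field_exists:
  fixes V :: "real ^ 'n::finite \<Rightarrow> real"
  assumes per: "integer_periodic V" and C: "C_class 2 V"
    and nd: "\<And>x. is_minimum V x \<Longrightarrow> invertible (hessian V x)" and a: "0 < a" "a < 1"
  defines "P \<equiv> {p \<in> unit_cell. is_minimum V p}"
  obtains G D where "\<And>i. integer_periodic (G i)" "\<And>i. continuous_on UNIV (G i)"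
    "\<And>i. has_partial i (G i) (D i)" "\<And>i. continuous_on UNIV (D i)"
    "\<And>x p. p \<in> P \<Longrightarrow> (\<Sum>i\<in>UNIV. (G i x)\<^sup>2) / 2 \<le> V x - V p"
    "\<And>x p. p \<in> P \<Longrightarrow> (\<Sum>i\<in>UNIV. (G i x)\<^sup>2) / 2 = V x - V p \<Longrightarrow>
      \<exists>q\<in>P. lattice_gap (x - q) = 0 \<and> (\<Sum>i\<in>UNIV. D i x) = a * sum_nonneg_lyapunov (flow V) (q, 0)"
proof -
  have fP: "finite P" unfolding P_def by (rule finite_minima[OF per C nd])
  have minP: "is_minimum V p" if "p \<in> P" for p using that by (simp add: P_def)
  have "\<forall>p\<in>P. \<exists>A. hessian_root V p A" using hessian_root_exists[OF per C] minP nd by blast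
  then obtain A where A: "\<And>p. p \<in> P \<Longrightarrow> hessian_root V p (A p)" by metis
  have "\<exists>d>0. \<forall>y. lattice_gap y < d \<longrightarrow> a\<^sup>2 * (norm (A p *v sine_coords y))\<^sup>2 / 2 \<le> V (p + y) - V p \<and>
      (lattice_gap y \<noteq> 0 \<longrightarrow> a\<^sup>2 * (norm (A p *v sine_coords y))\<^sup>2 / 2 < V (p + y) - V p)" if p: "p \<in> P" for p
    using potential_local_lower[OF per C minP[OF p] A[OF p], of "a\<^sup>2"] a by (simp add: power_less_one_iff) metis
  then obtain dl where dl: "\<And>p. p \<in> P \<Longrightarrow> dl p > 0"
    "\<And>p y. p \<in> P \<Longrightarrow> lattice_gap y < dl p \<Longrightarrow> a\<^sup>2 * (norm (A p *v sine_coords y))\<^sup>2 / 2 \<le> V (p + y) - V p"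
    "\<And>p y. p \<in> P \<Longrightarrow> lattice_gap y < dl p \<Longrightarrow> lattice_gap y \<noteq> 0 \<Longrightarrow> a\<^sup>2 * (norm (A p *v sine_coords y))\<^sup>2 / 2 < V (p + y) - V p"
    by metis
  \<comment> \<open>Distinct points of the half-open cell are not congruent modulo the lattice, so
    no \<open>x\<close> has both gaps zero; compactness and periodicity make this uniform.\<close>
  have "\<exists>c>0. \<forall>x. c \<le> lattice_gap (x - p) + lattice_gap (x - q)" if pq: "p \<in> P" "q \<in> P" "p \<noteq> q" for p q
  proof -
    let ?g = "\<lambda>x. lattice_gap (x - p) + lattice_gap (x - q)"
    have cg: "continuous_on S ?g" for S
      by (intro continuous_intros continuous_on_compose2[OF continuous_on_lattice_gap[of UNIV]]) auto
    have "?g x > 0" for x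
    proof (rule ccontr)
      assume "\<not> ?g x > 0"
      then have "lattice_gap (x - p) = 0" "lattice_gap (x - q) = 0"
        using lattice_gap_nonneg[of "x - p"] lattice_gap_nonneg[of "x - q"] by linarith+
      then have "(x - q) $ i - (x - p) $ i \<in> \<int>" for i
        using lattice_gap_eq_0_iff Ints_diff by blast
      then have "lattice_gap (p - q) = 0" by (simp add: lattice_gap_eq_0_iff)
      then show False using unit_cell_lattice_gap_eq_0[of p q] pq by (simp add: P_def)
    qed
    then obtain c where c: "c > 0" "\<And>x. x \<in> cbox 0 1 \<Longrightarrow> c \<le> ?g x"
      using compact_positive_lower_bound[of "cbox 0 1" ?g] cg compact_cbox by blast
    have "c \<le> ?g x" for x
    proof -
      obtain k where k: "\<And>i. k $ i \<in> \<int>" "x + k \<in> unit_cell" using unit_cell_representative[of x] by blast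
      then have "c \<le> ?g (x + k)" using c(2) unit_cell_subset_cbox by blast
      then show ?thesis
        using integer_periodicD[OF lattice_gap_periodic k(1), of "x - p"]
          integer_periodicD[OF lattice_gap_periodic k(1), of "x - q"] by (simp add: algebra_simps)
    qed
    then show ?thesis using c(1) by blast
  qed
  then obtain cs where cs: "\<And>p q. p \<in> P \<Longrightarrow> q \<in> P \<Longrightarrow> p \<noteq> q \<Longrightarrow> cs p q > 0"
    "\<And>p q x. p \<in> P \<Longrightarrow> q \<in> P \<Longrightarrow> p \<noteq> q \<Longrightarrow> cs p q \<le> lattice_gap (x - p) + lattice_gap (x - q)"
    by metis
  obtain d1 where d1: "d1 > 0" "\<And>p. p \<in> P \<Longrightarrow> d1 \<le> dl p"
    using finite_positive_lower_bound[of P dl, OF fP dl(1)] by blast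
  obtain d2 where d2: "d2 > 0" "\<And>pq. pq \<in> {pq \<in> P \<times> P. fst pq \<noteq> snd pq} \<Longrightarrow> d2 \<le> cs (fst pq) (snd pq)"
  proof (rule finite_positive_lower_bound)
    show "finite {pq \<in> P \<times> P. fst pq \<noteq> snd pq}" using fP by simp
    show "cs (fst pq) (snd pq) > 0" if "pq \<in> {pq \<in> P \<times> P. fst pq \<noteq> snd pq}" for pq
      using cs(1) that by auto
  qed blast
  \<comment> \<open>Below \<open>d1\<close> the local comparison is valid at every minimum, and half
    of the separation \<open>d2\<close> keeps the supports disjoint.\<close>
  define d where "d = min d1 (d2 / 2)"
  have d: "d > 0" "d \<le> d1" "2 * d \<le> d2" using d1 d2 by (auto simp: d_def)
  have unique: "q = p" if "p \<in> P" "q \<in> P" "lattice_gap (x - p) < d" "lattice_gap (x - q) < d" for p q x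
  proof (rule ccontr)
    assume "q \<noteq> p"
    then show False using d2(2)[of "(p, q)"] cs(2)[of p q x] that d(3) by auto
  qed
  define G where "G = (\<lambda>i x. \<Sum>p\<in>P. a * lattice_field d (A p) i (x - p))"
  define D where "D = (\<lambda>i x. \<Sum>p\<in>P. a * lattice_field' d (A p) i (x - p))"
  have far: "lattice_field d (A p) i (x - p) = 0" "lattice_field' d (A p) i (x - p) = 0" if "\<not> lattice_gap (x - p) < d" for p i x
  proof -
    have "cutoff d (lattice_gap (x - p)) = 0" using that cutoff_props(4)[OF d(1)] by simp
    moreover have "cutoff' d (lattice_gap (x - p)) = 0" using that d(1) by (simp add: cutoff'_def)
    ultimately show "lattice_field d (A p) i (x - p) = 0" "lattice_field' d (A p) i (x - p) = 0"
      by (simp_all add: lattice_field_def lattice_field'_def)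
  qed
  have near: "G i x = a * lattice_field d (A p) i (x - p)" "D i x = a * lattice_field' d (A p) i (x - p)"
    if p: "p \<in> P" "lattice_gap (x - p) < d" for p i x
  proof -
    have z: "\<not> lattice_gap (x - q) < d" if "q \<in> P - {p}" for q
      using unique[OF p(1) _ p(2), of q] that by blast
    have "G i x = (\<Sum>q\<in>{p}. a * lattice_field d (A q) i (x - q))"
      unfolding G_def by (rule sum.mono_neutral_right[OF fP]) (use p(1) far(1)[OF z] in auto)
    moreover have "D i x = (\<Sum>q\<in>{p}. a * lattice_field' d (A q) i (x - q))"
      unfolding D_def by (rule sum.mono_neutral_right[OF fP]) (use p(1) far(2)[OF z] in auto)
    ultimately show "G i x = a * lattice_field d (A p) i (x - p)" "D i x = a * lattice_field' d (A p) i (x - p)" by simp_all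
  qed
  have Veq: "V p = V q" if "p \<in> P" "q \<in> P" for p q
    using minP[OF that(1)] minP[OF that(2)] by (auto simp: is_minimum_def intro: order_antisym)
  have zero: "\<exists>q\<in>P. lattice_gap (x - q) = 0" if "is_minimum V x" for x
  proof -
    obtain k where k: "\<And>i. k $ i \<in> \<int>" "x + k \<in> unit_cell" using unit_cell_representative[of x] by blast
    then have "x + k \<in> P" using minimum_translate[OF per k(1)] that by (simp add: P_def)
    moreover have "lattice_gap (x - (x + k)) = 0" using k(1) by (simp add: lattice_gap_eq_0_iff)
    ultimately show ?thesis by blast
  qed
  have key: "(\<Sum>i\<in>UNIV. (G i x)\<^sup>2) / 2 \<le> V x - V p \<and> ((\<Sum>i\<in>UNIV. (G i x)\<^sup>2) / 2 = V x - V p \<longrightarrow>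
      (\<exists>q\<in>P. lattice_gap (x - q) = 0 \<and> (\<Sum>i\<in>UNIV. D i x) = a * sum_nonneg_lyapunov (flow V) (q, 0)))"
    if p: "p \<in> P" for x p
  proof (cases "\<exists>q\<in>P. lattice_gap (x - q) < d")
    case True
    then obtain q where q: "q \<in> P" "lattice_gap (x - q) < d" by blast
    let ?y = "x - q"
    let ?c = "cutoff d (lattice_gap ?y)"
    have "(G i x)\<^sup>2 \<le> a\<^sup>2 * ((A q *v sine_coords ?y) $ i)\<^sup>2" for i
    proof -
      have "(G i x)\<^sup>2 = ?c\<^sup>2 * (a\<^sup>2 * ((A q *v sine_coords ?y) $ i)\<^sup>2)"
        by (simp add: near[OF q] lattice_field_def power_mult_distrib matrix_vector_mul_component mult_ac)
      also have "\<dots> \<le> 1 * (a\<^sup>2 * ((A q *v sine_coords ?y) $ i)\<^sup>2)"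
        using cutoff_props(2,3)[OF d(1)] lattice_gap_nonneg[of ?y] by (intro mult_right_mono) (auto simp: power_le_one)
      finally show ?thesis by simp
    qed
    then have "(\<Sum>i\<in>UNIV. (G i x)\<^sup>2) \<le> (\<Sum>i\<in>UNIV. a\<^sup>2 * ((A q *v sine_coords ?y) $ i)\<^sup>2)" by (intro sum_mono)
    also have "\<dots> = a\<^sup>2 * (norm (A q *v sine_coords ?y))\<^sup>2"
      unfolding power2_norm_eq_inner inner_vec_def by (simp add: sum_distrib_left power2_eq_square)
    finally have G2: "(\<Sum>i\<in>UNIV. (G i x)\<^sup>2) / 2 \<le> a\<^sup>2 * (norm (A q *v sine_coords ?y))\<^sup>2 / 2" by simp
    have lt: "lattice_gap ?y < dl q" using q(2) d(2) d1(2)[OF q(1)] by linarith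
    have le: "(\<Sum>i\<in>UNIV. (G i x)\<^sup>2) / 2 \<le> V x - V p"
      using G2 dl(2)[OF q(1) lt] Veq[OF p q(1)] by simp
    show ?thesis
    proof (intro conjI impI le)
      assume eq: "(\<Sum>i\<in>UNIV. (G i x)\<^sup>2) / 2 = V x - V p"
      have 0: "lattice_gap ?y = 0"
        using G2 dl(3)[OF q(1) lt] Veq[OF p q(1)] eq by force
      then have Z: "?y $ i \<in> \<int>" for i by (simp add: lattice_gap_eq_0_iff)
      have S0: "sine_coords ?y = 0"
        using Z by (simp add: sine_coords_def vec_eq_iff sin_integer_2pi del: vector_minus_component)
      \<comment> \<open>The derivative of the cutoff is multiplied by
        \<open>sine_coords ?y = 0\<close>; what remains is the diagonal entry of the matrix.\<close>
      have "D i x = a * (A q $ i $ i)" for i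
        using Z[of i] cutoff_props(1)[OF d(1)]
        by (simp add: near[OF q] lattice_field'_def S0 0 cos_integer_2pi del: vector_minus_component)
      then have "(\<Sum>i\<in>UNIV. D i x) = a * sum_nonneg_lyapunov (flow V) (q, 0)"
        using A[OF q(1)] by (simp add: hessian_root_def sum_distrib_left[symmetric])
      then show "\<exists>q\<in>P. lattice_gap (x - q) = 0 \<and> (\<Sum>i\<in>UNIV. D i x) = a * sum_nonneg_lyapunov (flow V) (q, 0)"
        using q(1) 0 by blast
    qed
  next
    case False
    then have "G i x = 0" for i using far by (simp add: G_def)
    moreover have "V p \<le> V x" using minP[OF p] by (simp add: is_minimum_def)
    moreover have "V x \<noteq> V p"
    proof
      assume "V x = V p"
      then have "is_minimum V x" using minP[OF p] by (simp add: is_minimum_def)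
      then show False using zero False d(1) by fastforce
    qed
    ultimately show ?thesis by simp
  qed
  show ?thesis
  proof (rule that)
    show "integer_periodic (G i)" for i
      by (simp add: G_def integer_periodic_def integer_periodicD[OF integer_periodic_translate[OF lattice_field_periodic]])
    show "continuous_on UNIV (G i)" "continuous_on UNIV (D i)" for i
      unfolding G_def D_def
      by (intro continuous_intros continuous_on_compose2[OF continuous_on_lattice_field(1)[OF d(1), of UNIV]]
        continuous_on_compose2[OF continuous_on_lattice_field(2)[OF d(1), of UNIV]]; simp)+
    show "has_partial i (G i) (D i)" for i
      unfolding G_def D_def
      by (intro has_partial_sum has_partial_cmult has_partial_translate has_partial_lattice_field d)
  qed (use key in blast)+
qed

text \<open>Where D exceeds t, nonnegativity of W is enough. The remaining part of K is compact and
  avoids the zeros of W, so W is at least some c > 0 there and outweighs a deficit of order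
  h.\<close>

lemma eventually_field_bound:
  fixes W D :: "'a::metric_space \<Rightarrow> real"
  assumes K: "compact K" and W: "continuous_on K W" and D: "continuous_on K D"
    and nonneg: "\<And>x. x \<in> K \<Longrightarrow> 0 \<le> W x" and zero: "\<And>x. x \<in> K \<Longrightarrow> W x = 0 \<Longrightarrow> t < D x"
  obtains h0 where "h0 > 0" "\<And>h x. 0 < h \<Longrightarrow> h < h0 \<Longrightarrow> x \<in> K \<Longrightarrow> h / 2 * t \<le> W x + h / 2 * D x"
proof -
  have "compact (K \<inter> D -` {..t})"
    using continuous_closed_preimage[OF D compact_imp_closed[OF K] closed_atMost] K
    by (metis compact_Int_closed inf_left_idem)
  then obtain c where c: "c > 0" "\<And>x. x \<in> K \<inter> D -` {..t} \<Longrightarrow> c \<le> W x"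
    using compact_positive_lower_bound[of "K \<inter> D -` {..t}" W] continuous_on_subset[OF W] nonneg zero
    by (metis (no_types, lifting) Int_iff atMost_iff inf_le1 leD order_le_less vimage_eq)
  have "bounded (D ` K)" by (intro compact_imp_bounded compact_continuous_image D K)
  then obtain M where M: "M > 0" "\<And>x. x \<in> K \<Longrightarrow> \<bar>D x\<bar> \<le> M" by (auto simp: bounded_pos)
  define h0 where "h0 = c / (\<bar>t\<bar> + M)"
  have h0: "h0 > 0" using c M by (simp add: h0_def add_nonneg_pos)
  show ?thesis
  proof (rule that[OF h0])
    fix h x assume h: "0 < h" "h < h0" and x: "x \<in> K"
    show "h / 2 * t \<le> W x + h / 2 * D x"
    proof (cases "D x \<le> t")
      case True
      have "h * (\<bar>t\<bar> + M) < c" using h(2) M(1) by (simp add: h0_def pos_less_divide_eq add_nonneg_pos)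
      moreover have "c \<le> W x" using c(2) x True by simp
      moreover have "h * (t - D x) \<le> h * (\<bar>t\<bar> + M)" using M(2)[OF x] h(1) by (intro mult_left_mono) auto
      moreover have "0 < h * (\<bar>t\<bar> + M)" using h M by (simp add: add_nonneg_pos)
      ultimately show ?thesis by (simp add: algebra_simps)
    next
      case False
      then have "h / 2 * t \<le> h / 2 * D x" using h by (intro mult_left_mono) auto
      then show ?thesis using nonneg[OF x] by linarith
    qed
  qed
qed

subsection \<open>Concentration\<close>

lemma integrable_cell_indicator:
  fixes f :: "real ^ 'n::finite \<Rightarrow> real"
  assumes S: "S \<in> sets borel" and cont: "continuous_on UNIV f"
  shows "integrable cell_lebesgue (\<lambda>x. indicat_real S x * f x)"
proof (rule Bochner_Integration.integrable_bound[OF integrable_cell[OF cont]])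
  have "indicat_real S \<in> borel_measurable cell_lebesgue"
    using S by (intro measurable_restrict_space1) simp
  then show "(\<lambda>x. indicat_real S x * f x) \<in> borel_measurable cell_lebesgue"
    using measurable_cell[OF cont] by (rule borel_measurable_times)
qed (auto simp: indicator_def)

text \<open>Pulls the torus measure back to the unit cell, where the energy estimates live. The
  product form lets the normalizing integral be cancelled at the very end.\<close>

lemma measure_squared_measure:
  fixes \<psi> :: "real ^ 'n::finite \<Rightarrow> real"
  assumes per: "integer_periodic \<psi>" and cont: "continuous_on UNIV \<psi>" and pos: "\<And>x. \<psi> x > 0" and U: "open U"
  shows "measure (squared_measure \<psi>) (- U) * (\<integral>x. (\<psi> x)\<^sup>2 \<partial>cell_lebesgue)
    = (\<integral>x. indicat_real (- (to_torus -` U)) x * (\<psi> x)\<^sup>2 \<partial>cell_lebesgue)"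
    and "0 < (\<integral>x. (\<psi> x)\<^sup>2 \<partial>cell_lebesgue)"
proof -
  let ?T = "torus_lebesgue :: 'n torus measure"
  let ?g = "\<lambda>p. (\<psi> (rep_torus p))\<^sup>2"
  let ?I = "\<integral>x. (\<psi> x)\<^sup>2 \<partial>cell_lebesgue"
  have T: "?T = distr cell_lebesgue borel to_torus" by (simp add: torus_lebesgue_def unit_cell_def)
  have rep: "\<psi> (rep_torus (to_torus x)) = \<psi> x" for x by (rule integer_periodic_rep_torus[OF per])
  have "continuous_on UNIV ?g"
    unfolding continuous_on_open_vimage[OF open_UNIV]
  proof (intro allI impI)
    fix B :: "real set" assume "open B"
    have "to_torus -` (?g -` B) = (\<lambda>x. (\<psi> x)\<^sup>2) -` B" by (auto simp: rep)
    moreover have "open ((\<lambda>x. (\<psi> x)\<^sup>2) -` B)"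
      using cont \<open>open B\<close> by (intro open_vimage) (auto intro!: continuous_intros)
    ultimately show "open (?g -` B \<inter> UNIV)" by (simp add: open_torus_def)
  qed
  then have mg: "?g \<in> borel_measurable borel" by (rule borel_measurable_continuous_onI)
  have mt: "to_torus \<in> measurable cell_lebesgue (borel :: 'n torus measure)"
    by (rule measurable_restrict_space1) simp
  have I: "(\<integral>q. ?g q \<partial>?T) = ?I"
    unfolding T by (subst integral_distr[OF mt mg]) (simp add: rep)
  have int: "integrable cell_lebesgue (\<lambda>x. (\<psi> x)\<^sup>2)"
    by (intro integrable_cell continuous_intros cont)
  have "(\<integral>y. indicat_real UNIV y \<partial>(cell_lebesgue :: (real ^ 'n) measure)) > 0"
    by (rule open_periodic_measure_pos) auto
  then have c1: "measure (cell_lebesgue :: (real ^ 'n) measure) (space cell_lebesgue) \<noteq> 0" by auto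
  show Ipos: "0 < ?I"
  proof (rule ccontr)
    assume "\<not> 0 < ?I"
    moreover have "0 \<le> ?I" by simp
    ultimately have "?I = 0" by linarith
    then have "AE x in cell_lebesgue. (\<psi> x)\<^sup>2 = 0"
      by (subst (asm) integral_nonneg_eq_0_iff_AE[OF int]) auto
    then have "AE x in (cell_lebesgue :: (real ^ 'n) measure). False"
      using pos by (auto simp: less_imp_neq[symmetric])
    then show False using c1 by (simp add: eventually_False ae_filter_eq_bot_iff measure_def)
  qed
  have mU: "- U \<in> sets borel" using U by simp
  have mU': "- (to_torus -` U) \<in> sets (borel :: (real ^ 'n) measure)"
    using U by (intro borel_comp borel_open) (simp add: open_torus_def)
  have intU: "integrable cell_lebesgue (\<lambda>x. indicat_real (- (to_torus -` U)) x * (\<psi> x)\<^sup>2)"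
    by (intro integrable_cell_indicator continuous_intros cont mU')
  have "emeasure (squared_measure \<psi>) (- U) = (\<integral>\<^sup>+p. ennreal (?g p / ?I) * indicator (- U) p \<partial>?T)"
    unfolding squared_measure_def I
    by (rule emeasure_density) (use mg mU in \<open>auto simp: torus_lebesgue_def\<close>)
  also have "\<dots> = (\<integral>\<^sup>+x. ennreal (?g (to_torus x) / ?I) * indicator (- U) (to_torus x) \<partial>cell_lebesgue)"
    unfolding T by (rule nn_integral_distr[OF mt]) (use mg mU in measurable)
  also have "\<dots> = (\<integral>\<^sup>+x. ennreal ((indicat_real (- (to_torus -` U)) x * (\<psi> x)\<^sup>2) / ?I) \<partial>cell_lebesgue)"
    by (intro nn_integral_cong) (auto simp: rep indicator_def)
  also have "\<dots> = ennreal (\<integral>x. (indicat_real (- (to_torus -` U)) x * (\<psi> x)\<^sup>2) / ?I \<partial>cell_lebesgue)"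
    by (rule nn_integral_eq_integral) (use intU Ipos in \<open>auto intro!: integrable_divide AE_I2\<close>)
  also have "\<dots> = ennreal ((\<integral>x. indicat_real (- (to_torus -` U)) x * (\<psi> x)\<^sup>2 \<partial>cell_lebesgue) / ?I)"
    by simp
  finally have "measure (squared_measure \<psi>) (- U) = (\<integral>x. indicat_real (- (to_torus -` U)) x * (\<psi> x)\<^sup>2 \<partial>cell_lebesgue) / ?I"
    using Ipos by (simp add: measure_def integral_nonneg_AE)
  then show "measure (squared_measure \<psi>) (- U) * ?I = (\<integral>x. indicat_real (- (to_torus -` U)) x * (\<psi> x)\<^sup>2 \<partial>cell_lebesgue)"
    using Ipos by simp
qed

text \<open>Here \<open>v\<close> plays the minimum of V and \<open>t\<close> the smallest \<tau>.
  The coefficient of \<psi>^2 in \<open>energy_lower_bound\<close> is at least h/2 (- 2 \<eta>)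
  everywhere and at least h/2 (g - \<eta>) outside \<open>U\<close>, while the integral is at most
  0. The common factor h/2 cancels, so the bound does not depend on \<open>h\<close>.\<close>

lemma mass_bound_of_field:
  fixes \<psi> V :: "real ^ 'n::finite \<Rightarrow> real"
  assumes contV: "continuous_on UNIV V" and ef: "is_eigenfunction h V E \<psi>" and h: "h > 0" and pos: "\<And>x. \<psi> x > 0"
    and U: "open U"
    and G: "\<And>i. integer_periodic (G i)" "\<And>i. continuous_on UNIV (G i)"
      "\<And>i. has_partial i (G i) (D i)" "\<And>i. continuous_on UNIV (D i)"
    and \<eta>: "\<eta> > 0" "2 * \<eta> \<le> g"
    and all: "\<And>x. x \<in> unit_cell \<Longrightarrow> h / 2 * (t - \<eta>) \<le> V x - v - (\<Sum>i\<in>UNIV. (G i x)\<^sup>2) / 2 + h / 2 * (\<Sum>i\<in>UNIV. D i x)"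
    and out: "\<And>x. x \<in> unit_cell \<Longrightarrow> to_torus x \<notin> U \<Longrightarrow>
      h / 2 * (t + g) \<le> V x - v - (\<Sum>i\<in>UNIV. (G i x)\<^sup>2) / 2 + h / 2 * (\<Sum>i\<in>UNIV. D i x)"
    and E: "E \<le> v + h / 2 * (t + \<eta>)"
  shows "measure (squared_measure \<psi>) (- U) \<le> 4 * \<eta> / g"
proof -
  let ?u = "\<lambda>x. indicat_real (- (to_torus -` U)) x"
  let ?I = "\<integral>x. (\<psi> x)\<^sup>2 \<partial>cell_lebesgue"
  let ?F = "\<lambda>x. V x - (\<Sum>i\<in>UNIV. (G i x)\<^sup>2) / 2 + h / 2 * (\<Sum>i\<in>UNIV. D i x) - E"
  have per: "integer_periodic \<psi>" and cont: "continuous_on UNIV \<psi>"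
    using ef C_class_imp_continuous by (auto simp: is_eigenfunction_def)
  note sm = measure_squared_measure[OF per cont pos U]
  have int: "integrable cell_lebesgue (\<lambda>x. (\<psi> x)\<^sup>2)"
    by (intro integrable_cell continuous_intros cont)
  have mU: "- (to_torus -` U) \<in> sets (borel :: (real ^ 'n) measure)"
    using U by (intro borel_comp borel_open) (simp add: open_torus_def)
  have intU: "integrable cell_lebesgue (\<lambda>x. ?u x * (\<psi> x)\<^sup>2)"
    by (intro integrable_cell_indicator continuous_intros cont mU)
  have pw: "h / 2 * (- 2 * \<eta> * (\<psi> x)\<^sup>2 + g / 2 * (?u x * (\<psi> x)\<^sup>2)) \<le> ?F x * (\<psi> x)\<^sup>2"
    if x: "x \<in> unit_cell" for x
  proof -
    have "h / 2 * (- 2 * \<eta> + g / 2 * ?u x) \<le> ?F x"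
    proof (cases "to_torus x \<in> U")
      case True
      have "h / 2 * (t - \<eta>) - h / 2 * (t + \<eta>) = h / 2 * (- 2 * \<eta>)" by (simp add: algebra_simps)
      then have "h / 2 * (- 2 * \<eta>) \<le> ?F x" using all[OF x] E by linarith
      then show ?thesis using True by simp
    next
      case False
      have "h / 2 * (- 2 * \<eta> + g / 2) \<le> h / 2 * (g - \<eta>)"
        using h \<eta> by (intro mult_left_mono) auto
      also have "h / 2 * (g - \<eta>) = h / 2 * (t + g) - h / 2 * (t + \<eta>)" by (simp add: field_simps)
      also have "\<dots> \<le> ?F x" using out[OF x False] E by linarith
      finally show ?thesis using False by simp
    qed
    then have "h / 2 * (- 2 * \<eta> + g / 2 * ?u x) * (\<psi> x)\<^sup>2 \<le> ?F x * (\<psi> x)\<^sup>2"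
      by (intro mult_right_mono) auto
    then show ?thesis by (simp add: algebra_simps)
  qed
  have "h / 2 * (- 2 * \<eta> * ?I + g / 2 * (\<integral>x. ?u x * (\<psi> x)\<^sup>2 \<partial>cell_lebesgue))
      = (\<integral>x. h / 2 * (- 2 * \<eta> * (\<psi> x)\<^sup>2 + g / 2 * (?u x * (\<psi> x)\<^sup>2)) \<partial>cell_lebesgue)"
    using int intU by (simp only: Bochner_Integration.integral_add integral_mult_right_zero integrable_mult_right)
  also have "\<dots> \<le> (\<integral>x. ?F x * (\<psi> x)\<^sup>2 \<partial>cell_lebesgue)"
  proof (rule integral_mono)
    show "integrable cell_lebesgue (\<lambda>x. h / 2 * (- 2 * \<eta> * (\<psi> x)\<^sup>2 + g / 2 * (?u x * (\<psi> x)\<^sup>2)))"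
      using int intU by (intro integrable_mult_right Bochner_Integration.integrable_add)
    show "integrable cell_lebesgue (\<lambda>x. ?F x * (\<psi> x)\<^sup>2)"
      by (intro integrable_cell continuous_intros contV cont G) auto
  qed (use pw in \<open>simp add: space_restrict_space\<close>)
  also have "\<dots> \<le> 0" by (rule energy_lower_bound[OF contV ef h G])
  finally have "g / 2 * (\<integral>x. ?u x * (\<psi> x)\<^sup>2 \<partial>cell_lebesgue) \<le> 2 * \<eta> * ?I"
    using h by (simp add: mult_le_0_iff)
  then have "g / 2 * (measure (squared_measure \<psi>) (- U) * ?I) \<le> 2 * \<eta> * ?I" by (simp only: sm(1))
  then have "g * measure (squared_measure \<psi>) (- U) * ?I \<le> 4 * \<eta> * ?I" by simp
  then have "g * measure (squared_measure \<psi>) (- U) \<le> 4 * \<eta>" using sm(2) by (rule mult_right_le_imp_le)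
  then show ?thesis using \<eta> by (simp add: field_simps)
qed

theorem corollary1p1p2:
  fixes V :: "real ^ 'n::finite \<Rightarrow> real"
    and \<psi> :: "real \<Rightarrow> real ^ 'n \<Rightarrow> real"
  assumes "integer_periodic V"
    and "C_class 3 V"
    and "\<And>x. is_minimum V x \<Longrightarrow> invertible (hessian V x)"
    and "\<And>h. h > 0 \<Longrightarrow> is_ground_state h V (\<psi> h)"
  shows "concentrates_on (\<lambda>h. squared_measure (\<psi> h)) (selected_minima V) (at_right 0)"
  unfolding concentrates_on_def
proof (intro allI impI)
  fix U assume "open U \<and> selected_minima V \<subseteq> U"
  then have U: "open U" and sel: "selected_minima V \<subseteq> U" by auto
  note per = assms(1) and nd = assms(3)
  have C: "C_class 2 V" using assms(2) C_class_SucD[of 2 V] by (simp add: numeral_3_eq_3 numeral_2_eq_2)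
  have contV: "continuous_on UNIV V" using C by (rule C_class_imp_continuous)
  define P where "P = {p \<in> unit_cell. is_minimum V p}"
  define \<tau> where "\<tau> = (\<lambda>p. sum_nonneg_lyapunov (flow V) (p, 0))"
  have \<tau>_eq: "sum_nonneg_lyapunov (flow V) (p, 0) = \<tau> p" for p by (simp add: \<tau>_def)
  have fP: "finite P" unfolding P_def by (rule finite_minima[OF per C nd])
  have P0: "P \<noteq> {}" using periodic_attains_minimum[OF per contV] by (auto simp: P_def)
  have minP: "is_minimum V p" if "p \<in> P" for p using that by (simp add: P_def)
  have \<tau>0: "0 \<le> \<tau> p" if "p \<in> P" for p
    using hessian_root_exists[OF per C minP[OF that] nd[OF minP[OF that]]] sum_nonneg_lyapunov_root_nonneg
    unfolding \<tau>_def by blast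
  obtain p0 where p0: "p0 \<in> P" "\<And>p. p \<in> P \<Longrightarrow> \<tau> p0 \<le> \<tau> p"
    using ex_is_arg_min_if_finite[OF fP P0, of \<tau>] by (auto simp: is_arg_min_linorder)
  have \<tau>_rep: "\<exists>p\<in>P. \<tau> p = \<tau> y" if "is_minimum V y" for y
  proof -
    obtain k where k: "\<And>i. k $ i \<in> \<int>" "y + k \<in> unit_cell" using unit_cell_representative[of y] by blast
    have "y + k \<in> P" using minimum_translate[OF per k(1)] that k(2) by (simp add: P_def)
    moreover have "\<tau> (y + k) = \<tau> y" unfolding \<tau>_def by (rule sum_nonneg_lyapunov_translate[OF per C that nd[OF that] k(1)])
    ultimately show ?thesis by blast
  qed
  \<comment> \<open>A minimum outside \<open>U\<close> is not selected, so its sum of exponents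
    exceeds the smallest one strictly; finiteness of \<open>P\<close> turns this into a uniform
    gap.\<close>
  have gap: "\<tau> p - \<tau> p0 > 0" if "p \<in> {p \<in> P. to_torus p \<notin> U}" for p
  proof (rule ccontr)
    assume "\<not> \<tau> p - \<tau> p0 > 0"
    then have "\<tau> p \<le> \<tau> y" if "is_minimum V y" for y
      using \<tau>_rep[OF that] p0(2) by fastforce
    then have "to_torus p \<in> selected_minima V"
      using that minP unfolding selected_minima_def \<tau>_def by blast
    then show False using sel that by blast
  qed
  obtain c where c: "c > 0" "\<And>p. p \<in> {p \<in> P. to_torus p \<notin> U} \<Longrightarrow> c \<le> \<tau> p - \<tau> p0"
    using finite_positive_lower_bound[of "{p \<in> P. to_torus p \<notin> U}" "\<lambda>p. \<tau> p - \<tau> p0"] gap fP by auto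
  \<comment> \<open>Only half of the gap is claimed; the other half pays for replacing \<tau> by a
    \<tau>.\<close>
  define g where "g = c / 2"
  have g: "g > 0" using c(1) by (simp add: g_def)
  have eq_torus: "to_torus x = to_torus p" if "lattice_gap (x - p) = 0" for x p :: "real ^ 'n"
    using that by (intro torus.abs_eq_iff[THEN iffD2]) (simp add: lattice_gap_eq_0_iff)
  show "((\<lambda>h. measure (squared_measure (\<psi> h)) (- U)) \<longlongrightarrow> 0) (at_right 0)"
    unfolding tendsto_iff
  proof (intro allI impI)
    fix \<kappa> :: real assume \<kappa>: "\<kappa> > 0"
    \<comment> \<open>Ensures \<open>2 * \<eta> \<le> g\<close> and makes the final bound
      \<open>4 * \<eta> / g\<close> at most \<open>\<kappa> / 2\<close>.\<close>
    define \<eta> where "\<eta> = min (g / 2) (\<kappa> * g / 8)"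
    have \<eta>: "\<eta> > 0" "2 * \<eta> \<le> g" "8 * \<eta> \<le> \<kappa> * g" using g \<kappa> by (auto simp: \<eta>_def)
    define T where "T = (\<Sum>p\<in>P. \<tau> p)"
    have T: "\<tau> p \<le> T" if "p \<in> P" for p
      unfolding T_def using fP that \<tau>0 by (intro member_le_sum) auto
    have T0: "0 \<le> T" using T[OF p0(1)] \<tau>0[OF p0(1)] by linarith
    \<comment> \<open>The loss \<open>s * \<tau> p\<close> is to be at most
      \<open>\<eta> / 2\<close> at all minima simultaneously; \<open>T + 1\<close> keeps the
      denominator positive, and the cap 1/2 keeps \<open>a\<close> positive.\<close>
    define s where "s = min (1 / 2) (\<eta> / (2 * (T + 1)))"
    define a where "a = 1 - s"
    have s: "s > 0" using \<eta> T0 by (simp add: s_def)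
    moreover have "s \<le> 1 / 2" unfolding s_def by (rule min.cobounded1)
    ultimately have a: "0 < a" "a < 1" by (auto simp: a_def)
    have a\<tau>: "\<tau> p - \<eta> / 2 \<le> a * \<tau> p" if "p \<in> P" for p
    proof -
      have "s * \<tau> p \<le> s * (T + 1)" using T[OF that] s by (intro mult_left_mono) auto
      also have "\<dots> \<le> \<eta> / 2"
      proof -
        have "s \<le> (\<eta> / 2) / (T + 1)" by (simp add: s_def min_le_iff_disj)
        then show ?thesis using T0 by (subst (asm) pos_le_divide_eq) auto
      qed
      finally show ?thesis by (simp add: a_def algebra_simps)
    qed
    obtain G D where G: "\<And>i. integer_periodic (G i)" "\<And>i. continuous_on UNIV (G i)"
      "\<And>i. has_partial i (G i) (D i)" "\<And>i. continuous_on UNIV (D i)"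
      and GV: "\<And>x p. p \<in> P \<Longrightarrow> (\<Sum>i\<in>UNIV. (G i x)\<^sup>2) / 2 \<le> V x - V p"
      and GD: "\<And>x p. p \<in> P \<Longrightarrow> (\<Sum>i\<in>UNIV. (G i x)\<^sup>2) / 2 = V x - V p \<Longrightarrow>
        \<exists>q\<in>P. lattice_gap (x - q) = 0 \<and> (\<Sum>i\<in>UNIV. D i x) = a * \<tau> q"
      by (rule adapted_field_exists[OF per C _ a, folded P_def, unfolded \<tau>_eq], erule nd, rule that)
    let ?W = "\<lambda>x. V x - V p0 - (\<Sum>i\<in>UNIV. (G i x)\<^sup>2) / 2"
    let ?D = "\<lambda>x. \<Sum>i\<in>UNIV. D i x"
    have cW: "continuous_on S ?W" and cD: "continuous_on S ?D" for S
      by (intro continuous_intros continuous_on_subset[OF contV] continuous_on_subset[OF G(2)] continuous_on_subset[OF G(4)]; simp)+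
    have W0: "0 \<le> ?W x" for x using GV[OF p0(1), of x] by simp
    have WD: "\<exists>q\<in>P. lattice_gap (x - q) = 0 \<and> ?D x = a * \<tau> q" if "?W x = 0" for x
      using GD[OF p0(1), of x] that by simp
    obtain h1 where h1: "h1 > 0" "\<And>h x. 0 < h \<Longrightarrow> h < h1 \<Longrightarrow> x \<in> cbox 0 1 \<Longrightarrow> h / 2 * (\<tau> p0 - \<eta>) \<le> ?W x + h / 2 * ?D x"
    proof (rule eventually_field_bound[of "cbox 0 1" ?W ?D "\<tau> p0 - \<eta>"])
      fix x assume "?W x = 0"
      then obtain q where q: "q \<in> P" "?D x = a * \<tau> q" using WD by blast
      then show "\<tau> p0 - \<eta> < ?D x" using a\<tau>[OF q(1)] p0(2)[OF q(1)] \<eta>(1) by linarith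
    qed (use cW cD W0 compact_cbox in blast)+
    \<comment> \<open>Outside \<open>U\<close> the zeros of \<open>?W\<close> are congruent to
      unselected minima only, so the threshold in \<open>eventually_field_bound\<close> can be
      raised from \<open>\<tau> p0 - \<eta>\<close> to \<open>\<tau> p0 + g\<close>. The closed cube
      is used for compactness.\<close>
    let ?K = "cbox 0 1 - to_torus -` U :: (real ^ 'n) set"
    have K: "compact ?K" using U by (intro compact_diff) (auto simp: open_torus_def)
    obtain h2 where h2: "h2 > 0" "\<And>h x. 0 < h \<Longrightarrow> h < h2 \<Longrightarrow> x \<in> ?K \<Longrightarrow> h / 2 * (\<tau> p0 + g) \<le> ?W x + h / 2 * ?D x"
    proof (rule eventually_field_bound[of ?K ?W ?D "\<tau> p0 + g"])
      fix x assume x: "x \<in> ?K" "?W x = 0"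
      then obtain q where q: "q \<in> P" "lattice_gap (x - q) = 0" "?D x = a * \<tau> q" using WD by blast
      have "to_torus q \<notin> U" using eq_torus[OF q(2)] x(1) by simp
      then have "c \<le> \<tau> q - \<tau> p0" using c(2) q(1) by blast
      then show "\<tau> p0 + g < ?D x" using a\<tau>[OF q(1)] q(3) \<eta> g by (simp add: g_def)
    qed (use cW cD W0 K in blast)+
    obtain A where A: "hessian_root V p0 A" using hessian_root_exists[OF per C minP[OF p0(1)] nd[OF minP[OF p0(1)]]] by blast
    obtain h3 where h3: "h3 > 0" "\<And>h E \<psi>. 0 < h \<Longrightarrow> h < h3 \<Longrightarrow> is_eigenfunction h V E \<psi> \<Longrightarrow> \<forall>x. \<psi> x > 0 \<Longrightarrow> E \<le> V p0 + h / 2 * (\<tau> p0 + \<eta>)"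
      by (rule ground_energy_upper[OF per C minP[OF p0(1)] A \<eta>(1), unfolded \<tau>_eq], rule that)
    have "dist (measure (squared_measure (\<psi> h)) (- U)) 0 < \<kappa>" if h: "0 < h" "h < min h1 (min h2 h3)" for h
    proof -
      have gs: "is_ground_state h V (\<psi> h)" by (rule assms(4)[OF h(1)])
      then obtain E where E: "is_eigenfunction h V E (\<psi> h)" and pos: "\<And>x. \<psi> h x > 0"
        by (auto simp: is_ground_state_def)
      have "measure (squared_measure (\<psi> h)) (- U) \<le> 4 * \<eta> / g"
      proof (rule mass_bound_of_field[OF contV E h(1) pos U G \<eta>(1,2)])
        show "h / 2 * (\<tau> p0 - \<eta>) \<le> V x - V p0 - (\<Sum>i\<in>UNIV. (G i x)\<^sup>2) / 2 + h / 2 * (\<Sum>i\<in>UNIV. D i x)"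
          if "x \<in> unit_cell" for x using h1(2)[of h x] h that unit_cell_subset_cbox by auto
        show "h / 2 * (\<tau> p0 + g) \<le> V x - V p0 - (\<Sum>i\<in>UNIV. (G i x)\<^sup>2) / 2 + h / 2 * (\<Sum>i\<in>UNIV. D i x)"
          if "x \<in> unit_cell" "to_torus x \<notin> U" for x using h2(2)[of h x] h that unit_cell_subset_cbox by auto
        show "E \<le> V p0 + h / 2 * (\<tau> p0 + \<eta>)" using h3(2)[OF _ _ E] h pos by simp
      qed
      also have "\<dots> \<le> \<kappa> / 2" using \<eta>(3) g by (simp add: field_simps)
      also have "\<dots> < \<kappa>" using \<kappa> by simp
      finally show ?thesis by simp
    qed
    then show "eventually (\<lambda>h. dist (measure (squared_measure (\<psi> h)) (- U)) 0 < \<kappa>) (at_right 0)"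
      using h1(1) h2(1) h3(1) unfolding eventually_at_right_field by (intro exI[of _ "min h1 (min h2 h3)"]) auto
  qed
qed

end
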